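(* Let $\varepsilon>0$. (1) Let $T\subset\mathbb{R}^3$ be a nondegenerate closed tetrahedron with vertices $x_1,\dots,x_4$ and $\beta:T\to\mathbb{R}^3$ a vector field (not necessarily constant). Then the $H(\mathrm{curl})$ exponentially-fitted basis functions satisfy, for all $1\le i<j\le4$, $$n_s\times\phi^E_{ij}=0\quad\text{on }F_s,\qquad\text{for } s=i \text{ and } s=j.$$ (2) Consequently, let $\mathcal{T}_h$ be a conforming decomposition into tetrahedra of a bounded region $\Omega\subset\mathbb{R}^3$. If $\beta$ is tangentially continuous across every interior facet of $\mathcal{T}_h$ and piecewise $C^1$ with respect to $\mathcal{T}_h$, then the space $\mathcal{S}^1_{1^-}(\mathcal{T}_h)$ is $H(\mathrm{curl})$-conforming, i.e. $\mathcal{S}^1_{1^-}(\mathcal{T}_h)\subset H(\mathrm{curl};\Omega)$.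
   Context: $F_s$ is the facet of $T$ opposite $x_s$ and $n_s$ its unit outward normal. For $x\in T$: $l_i:=x_i-x$, $\sigma_i:=\beta(x)\cdot l_i$, $\sigma_{ij}:=\beta(x)\cdot(x_j-x_i)$. The 2D-Bernoulli function is $$B_2^\varepsilon(a,b):=\varepsilon\,\frac{\int_0^1 e^{a y_1/\varepsilon}\,dy_1}{2\int_0^1\int_0^{1-y_2}e^{(a y_1+b y_2)/\varepsilon}\,dy_1dy_2}.$$ For each $x\in T$, the pair $(j^E_{ij}(x),\phi^E_{ij}(x))\in\mathbb{R}^3\times\mathbb{R}^3$, $1\le i<j\le4$, is the unique solution of $$j^E_{ij}(x)\cdot\frac{l_s\times l_t}{2}-B_2^\varepsilon(\sigma_s,\sigma_t)\,\phi^E_{ij}(x)\cdot l_s+B_2^\varepsilon(\sigma_t,\sigma_s)\,\phi^E_{ij}(x)\cdot l_t=B_2^\varepsilon(\sigma_{st},-\sigma_s)\,\delta_{is,jt},\qquad 1\le s<t\le4,$$ with $\delta_{is,jt}=1$ if $(i,j)=(s,t)$ and $0$ otherwise (this system is uniquely solvable). The local space is $\mathcal{S}^1_{1^-}(T)=\mathrm{span}\{\phi^E_{ij}:1\le i<j\le4\}$, where on each $T\in\mathcal{T}_h$ the construction uses $\beta|_T$. The global space is $$\mathcal{S}^1_{1^-}(\mathcal{T}_h)=\{v: v|_T\in\mathcal{S}^1_{1^-}(T)\ \forall T\in\mathcal{T}_h,\ v\cdot t\text{ is continuous across all edges}\},$$ where $t$ is a unit tangent of the edge and continuity means that, on each edge,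 the values of $v\cdot t$ from all elements containing that edge agree. *)

theory Defs
  imports "HOL-Analysis.Analysis"
begin

section \<open>Tetrahedra\<close>

text \<open>
  A nondegenerate tetrahedron comes with a labelling \<open>x 1, \<dots>, x 4\<close> of its vertices; the values
  of \<open>x\<close> outside \<open>{1..4}\<close> play no role.
\<close>

definition tet_vertices :: "(nat \<Rightarrow> real^3) \<Rightarrow> (real^3) set \<Rightarrow> bool" where
  "tet_vertices x T \<longleftrightarrow>
     inj_on x {1..4} \<and> \<not> affine_dependent (x ` {1..4}) \<and> T = convex hull (x ` {1..4})"

definition tet_facet :: "(nat \<Rightarrow> real^3) \<Rightarrow> nat \<Rightarrow> (real^3) set" where
  "tet_facet x s = convex hull (x ` ({1..4} - {s}))"

definition unit_normal :: "(real^3) set \<Rightarrow> real^3 \<Rightarrow> bool" where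
  "unit_normal F n \<longleftrightarrow> norm n = 1 \<and> (\<forall>a\<in>F. \<forall>b\<in>F. n \<bullet> (a - b) = 0)"

definition tet_normal :: "(nat \<Rightarrow> real^3) \<Rightarrow> nat \<Rightarrow> real^3" where
  "tet_normal x s =
     (THE n. unit_normal (tet_facet x s) n \<and> (\<forall>a\<in>tet_facet x s. n \<bullet> (x s - a) < 0))"


section \<open>Exponentially fitted edge basis functions\<close>

definition bernoulli2 :: "real \<Rightarrow> real \<Rightarrow> real \<Rightarrow> real" where
  "bernoulli2 \<epsilon> a b =
     \<epsilon> * integral {0..1} (\<lambda>y1. exp (a * y1 / \<epsilon>))
       / (2 * integral {0..1} (\<lambda>y2. integral {0..1 - y2} (\<lambda>y1. exp ((a * y1 + b * y2) / \<epsilon>))))"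

text \<open>The linear system at the point \<open>y\<close>; only the value \<open>\<beta> y\<close> of the field enters.\<close>

definition edge_system ::
  "real \<Rightarrow> (nat \<Rightarrow> real^3) \<Rightarrow> (real^3 \<Rightarrow> real^3) \<Rightarrow> nat \<Rightarrow> nat \<Rightarrow> real^3 \<Rightarrow> real^3 \<Rightarrow> real^3 \<Rightarrow> bool" where
  "edge_system \<epsilon> x \<beta> i j y J \<phi> \<longleftrightarrow>
     (let l = (\<lambda>s. x s - y);
          \<sigma> = (\<lambda>s. \<beta> y \<bullet> l s);
          \<sigma>\<sigma> = (\<lambda>s t. \<beta> y \<bullet> (x t - x s))
      in \<forall>s\<in>{1..4}. \<forall>t\<in>{1..4}. s < t \<longrightarrow>
           J \<bullet> ((1/2) *\<^sub>R cross3 (l s) (l t))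
           - bernoulli2 \<epsilon> (\<sigma> s) (\<sigma> t) * (\<phi> \<bullet> l s)
           + bernoulli2 \<epsilon> (\<sigma> t) (\<sigma> s) * (\<phi> \<bullet> l t)
           = bernoulli2 \<epsilon> (\<sigma>\<sigma> s t) (- \<sigma> s) * (if (i, j) = (s, t) then 1 else 0))"

definition edge_pair ::
  "real \<Rightarrow> (nat \<Rightarrow> real^3) \<Rightarrow> (real^3 \<Rightarrow> real^3) \<Rightarrow> nat \<Rightarrow> nat \<Rightarrow> real^3 \<Rightarrow> (real^3) \<times> (real^3)" where
  "edge_pair \<epsilon> x \<beta> i j y = (THE p. edge_system \<epsilon> x \<beta> i j y (fst p) (snd p))"

definition \<phi>E ::
  "real \<Rightarrow> (nat \<Rightarrow> real^3) \<Rightarrow> (real^3 \<Rightarrow> real^3) \<Rightarrow> nat \<Rightarrow> nat \<Rightarrow> real^3 \<Rightarrow> real^3" where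
  "\<phi>E \<epsilon> x \<beta> i j y = snd (edge_pair \<epsilon> x \<beta> i j y)"

text \<open>The real span of the six basis functions, as functions on \<open>T\<close> (values outside \<open>T\<close> are free).\<close>

definition S_local ::
  "real \<Rightarrow> (nat \<Rightarrow> real^3) \<Rightarrow> (real^3 \<Rightarrow> real^3) \<Rightarrow> (real^3) set \<Rightarrow> (real^3 \<Rightarrow> real^3) set" where
  "S_local \<epsilon> x \<beta> T =
     {v. \<exists>c :: nat \<Rightarrow> nat \<Rightarrow> real. \<forall>y\<in>T.
           v y = (\<Sum>(i, j)\<in>{(i, j). 1 \<le> i \<and> i < j \<and> j \<le> 4}. c i j *\<^sub>R \<phi>E \<epsilon> x \<beta> i j y)}"


section \<open>Meshes and the global space\<close>

definition tet_mesh :: "(real^3) set set \<Rightarrow> (real^3) set \<Rightarrow> bool" where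
  "tet_mesh Th \<Omega> \<longleftrightarrow> triangulation Th \<and> (\<forall>T\<in>Th. 3 simplex T) \<and> \<Union>Th = closure \<Omega>"

text \<open>
  A piecewise field is a family indexed by the elements: \<open>\<beta> T\<close> is the restriction to the closed
  element \<open>T\<close>, so that the two one-sided traces on a shared facet are \<open>\<beta> T\<close> and \<open>\<beta> T'\<close>.
\<close>

definition C1_on :: "(real^3) set \<Rightarrow> (real^3 \<Rightarrow> real^3) \<Rightarrow> bool" where
  "C1_on T f \<longleftrightarrow>
     (\<exists>D :: real^3 \<Rightarrow> (real^3) \<Rightarrow>\<^sub>L (real^3).
        (\<forall>y\<in>T. (f has_derivative blinfun_apply (D y)) (at y within T)) \<and> continuous_on T D)"

definition piecewise_C1 :: "(real^3) set set \<Rightarrow> ((real^3) set \<Rightarrow> real^3 \<Rightarrow> real^3) \<Rightarrow> bool" where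
  "piecewise_C1 Th \<beta> \<longleftrightarrow> (\<forall>T\<in>Th. C1_on T (\<beta> T))"

definition tangentially_continuous ::
  "(real^3) set set \<Rightarrow> (real^3) set \<Rightarrow> ((real^3) set \<Rightarrow> real^3 \<Rightarrow> real^3) \<Rightarrow> bool" where
  "tangentially_continuous Th \<Omega> \<beta> \<longleftrightarrow>
     (\<forall>T\<in>Th. \<forall>T'\<in>Th. \<forall>F. F facet_of T \<and> F facet_of T' \<and> \<not> F \<subseteq> frontier \<Omega> \<longrightarrow>
        (\<forall>n. unit_normal F n \<longrightarrow> (\<forall>y\<in>F. cross3 n (\<beta> T y) = cross3 n (\<beta> T' y))))"

definition unit_tangent :: "(real^3) set \<Rightarrow> real^3 \<Rightarrow> bool" where
  "unit_tangent e t \<longleftrightarrow> norm t = 1 \<and> t \<in> span {a - b | a b. a \<in> e \<and> b \<in> e}"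

text \<open>
  A member of the global space is a field \<open>v\<close> on \<open>\<Omega>\<close>, determined up to the null set of element
  boundaries; \<open>w T\<close> is its restriction to the closed element \<open>T\<close>, boundary traces included.
  The labelling \<open>x T\<close> of the vertices of each element is arbitrary.
\<close>

definition S_global ::
  "real \<Rightarrow> (real^3) set set \<Rightarrow> ((real^3) set \<Rightarrow> nat \<Rightarrow> real^3) \<Rightarrow>
   ((real^3) set \<Rightarrow> real^3 \<Rightarrow> real^3) \<Rightarrow> (real^3 \<Rightarrow> real^3) set" where
  "S_global \<epsilon> Th x \<beta> =
     {v. \<exists>w. (\<forall>T\<in>Th. w T \<in> S_local \<epsilon> (x T) (\<beta> T) T \<and> (\<forall>y\<in>interior T. v y = w T y)) \<and>
             (\<forall>T\<in>Th. \<forall>T'\<in>Th. \<forall>e. e edge_of T \<and> e edge_of T' \<longrightarrow>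
                (\<forall>t. unit_tangent e t \<longrightarrow> (\<forall>y\<in>e. w T y \<bullet> t = w T' y \<bullet> t)))}"


section \<open>The space H(curl)\<close>

definition curl :: "(real^3 \<Rightarrow> real^3) \<Rightarrow> real^3 \<Rightarrow> real^3" where
  "curl f y =
     (let D = jacobian f (at y)
      in vector [D$3$2 - D$2$3, D$1$3 - D$3$1, D$2$1 - D$1$2])"

text \<open>In finite dimension, continuity of all directional derivatives of order at most \<open>k\<close>.\<close>

primrec Ck :: "nat \<Rightarrow> ('a::euclidean_space \<Rightarrow> 'b::euclidean_space) \<Rightarrow> bool" where
  "Ck 0 f \<longleftrightarrow> continuous_on UNIV f"
| "Ck (Suc k) f \<longleftrightarrow>
     (\<forall>y. f differentiable (at y)) \<and> (\<forall>h. Ck k (\<lambda>y. frechet_derivative f (at y) h))"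

definition test_fields :: "(real^3) set \<Rightarrow> (real^3 \<Rightarrow> real^3) set" where
  "test_fields \<Omega> =
     {\<psi>. (\<forall>k. Ck k \<psi>) \<and> (\<exists>K. compact K \<and> K \<subseteq> \<Omega> \<and> (\<forall>y. y \<notin> K \<longrightarrow> \<psi> y = 0))}"

definition L2_on :: "(real^3) set \<Rightarrow> (real^3 \<Rightarrow> real^3) set" where
  "L2_on \<Omega> =
     {v \<in> borel_measurable (lebesgue_on \<Omega>). integrable (lebesgue_on \<Omega>) (\<lambda>y. (norm (v y))\<^sup>2)}"

definition Hcurl :: "(real^3) set \<Rightarrow> (real^3 \<Rightarrow> real^3) set" where
  "Hcurl \<Omega> =
     {v \<in> L2_on \<Omega>. \<exists>w\<in>L2_on \<Omega>. \<forall>\<psi>\<in>test_fields \<Omega>.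
        (LINT y|lebesgue_on \<Omega>. v y \<bullet> curl \<psi> y) = (LINT y|lebesgue_on \<Omega>. w y \<bullet> \<psi> y)}"

end

theory Submission
  imports Defs
begin

text \<open>
  Multiplying the \<open>(s, t)\<close> equation by \<open>2 \<integral>\<integral> exp\<close> turns it into Stokes' theorem on the triangle
  \<open>y, x\<^sub>s, x\<^sub>t\<close> for constant \<open>J\<close> and \<open>\<phi>\<close> weighted with \<open>exp (\<beta>(y) \<bullet> (z - y) / \<epsilon>)\<close>. For vanishing right-hand
  sides the weighted flux of \<open>J\<close> through the triangles with apex \<open>y\<close> cancels, and the divergence theorem
  on the tetrahedra with apex \<open>y\<close> forces \<open>\<beta> \<bullet> J = 0\<close>, hence \<open>J = 0\<close> and then \<open>\<phi> = 0\<close>: the system is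
  uniquely solvable for every \<open>y \<in> T\<close>. The same argument inside a facet shows that the three equations
  of its edges already determine the tangential part of \<open>\<phi>\<close> there, and that they involve only the
  tangential part of \<open>\<beta>\<close>. This gives the vanishing tangential traces.

  In the global space the coefficients of an element are the edge values \<open>v(x\<^sub>s) \<bullet> (x\<^sub>t - x\<^sub>s)\<close>, so they are
  shared by neighbouring elements, and with the tangential continuity of \<open>\<beta>\<close> the tangential traces
  of \<open>v\<close> agree on every facet that meets \<open>\<Omega>\<close>. By Cramer's rule \<open>v\<close> is \<open>C\<^sup>1\<close> on every closed element, and
  elementwise integration by parts shows that its piecewise curl is its weak curl.
\<close>

section \<open>Integration over triangles and tetrahedra\<close>

text \<open>All integrals are pulled back to a fixed reference triangle or tetrahedron because the
  simplices that occur may be flat. The exponent \<open>b \<bullet> (z - y)\<close> maps the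
  triangle \<open>y, p, q\<close> to the real line, and the Bernoulli denominator becomes an
  integral of \<open>exp\<close> over the collapsed triangle
  \<open>0, b \<bullet> (p - y), b \<bullet> (q - y)\<close>. For \<open>y\<close> on the boundary
  of \<open>T\<close> some simplices with apex \<open>y\<close> are flat themselves. In pulled-back
  form the divergence theorem holds for all of them alike, with no case distinction on
  \<open>b\<close> or \<open>y\<close>. The basis functions are definite descriptions: nothing is
  known about them at \<open>y\<close> before the system is shown to be uniquely solvable there, and
  this includes the boundary points of \<open>T\<close>. The unknown \<open>J\<close> is auxiliary
  and may differ between neighbouring elements. This is harmless on a facet, because for
  \<open>y\<close> in the facet its equations contain \<open>J\<close> only through the component
  normal to the facet, and the homogeneous equations force that component to vanish.\<close>

text \<open>The preimage of a box is a box with the same side lengths in another order, and boxes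
  determine Lebesgue measure. Domain and codomain may be different types: this serves the passage
  from \<open>(real \<times> real) \<times> real\<close> to \<open>real^3\<close> as well as the
  permutation of coordinates.\<close>

lemma lborel_distr_basis:
  fixes f :: "'a::euclidean_space \<Rightarrow> 'b::euclidean_space"
  assumes "linear f" and bij: "bij_betw f Basis Basis"
  shows "distr lborel borel f = lborel"
proof (rule lborel_eqI[symmetric])
  interpret linear f by fact
  \<comment> \<open>\<open>g\<close> is the adjoint of \<open>f\<close>, here also its inverse; it
    supplies the corners of the preimage box.\<close>
  define g where "g y = (\<Sum>b\<in>Basis. (y \<bullet> f b) *\<^sub>R b)" for y
  have fb: "f b \<in> Basis" if "b \<in> Basis" for b using bij that by (auto simp: bij_betw_def)
  have inner: "f x \<bullet> f b = x \<bullet> b" if "b \<in> Basis" for x b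
  proof -
    have "f x = (\<Sum>c\<in>Basis. (x \<bullet> c) *\<^sub>R f c)"
      by (subst euclidean_representation[of x, symmetric]) (simp only: sum scaleR)
    hence "f x \<bullet> f b = (\<Sum>c\<in>Basis. (x \<bullet> c) * (f c \<bullet> f b))" by (simp add: inner_sum_left)
    also have "\<dots> = (\<Sum>c\<in>Basis. if c = b then x \<bullet> b else 0)"
    proof (rule sum.cong)
      fix c assume c: "c \<in> (Basis::'a set)"
      have "f c = f b \<longleftrightarrow> c = b" using bij c that by (auto simp: bij_betw_def inj_on_def)
      thus "(x \<bullet> c) * (f c \<bullet> f b) = (if c = b then x \<bullet> b else 0)"
        using c that fb by (auto simp: inner_Basis)
    qed auto
    finally show ?thesis using that by simp
  qed
  have gb: "g y \<bullet> b = y \<bullet> f b" if "b \<in> Basis" for y b using that by (simp add: g_def)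
  have [measurable]: "f \<in> borel_measurable borel"
    by (intro borel_measurable_continuous_onI linear_continuous_on linear_conv_bounded_linear[THEN iffD1] assms)
  fix l u :: 'b assume le: "\<And>b. b \<in> Basis \<Longrightarrow> l \<bullet> b \<le> u \<bullet> b"
  have "f -` box l u = box (g l) (g u)"
  proof -
    have "x \<in> f -` box l u \<longleftrightarrow> (\<forall>b\<in>f ` Basis. l \<bullet> b < f x \<bullet> b \<and> f x \<bullet> b < u \<bullet> b)" for x
      using bij by (simp add: bij_betw_def mem_box)
    thus ?thesis by (auto simp: mem_box inner gb)
  qed
  hence "emeasure (distr lborel borel f) (box l u) = emeasure lborel (box (g l) (g u))"
    by (simp add: emeasure_distr)
  also have "\<dots> = (\<Prod>b\<in>Basis. (g u - g l) \<bullet> b)"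
    by (rule emeasure_lborel_box) (simp add: gb fb le)
  also have "(\<Prod>b\<in>Basis. (g u - g l) \<bullet> b) = (\<Prod>b\<in>Basis. (u - l) \<bullet> f b)"
    by (rule prod.cong) (auto simp: gb inner_diff_left)
  also have "\<dots> = (\<Prod>b\<in>Basis. (u - l) \<bullet> b)"
    by (rule prod.reindex_bij_betw[OF bij])
  finally show "emeasure (distr lborel borel f) (box l u) = ennreal (\<Prod>b\<in>Basis. (u - l) \<bullet> b)" .
qed simp

lemma set_integrable_compact:
  fixes h :: "'a::euclidean_space \<Rightarrow> 'b::{banach, second_countable_topology}"
  assumes "compact S" "continuous_on S h"
  shows "set_integrable lborel S h"
  unfolding set_integrable_def by (rule borel_integrable_compact[OF assms])

lemma integral_compact_eq:
  fixes h :: "'a::euclidean_space \<Rightarrow> 'b::euclidean_space"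
  assumes "compact S" "continuous_on S h"
  shows "integral S h = (LINT x:S|lborel. h x)" "h integrable_on S"
  using set_borel_integral_eq_integral[OF set_integrable_compact[OF assms]] by auto

lemma integral_basis_image:
  fixes f :: "'a::euclidean_space \<Rightarrow> 'b::euclidean_space" and h :: "'b \<Rightarrow> 'c::euclidean_space"
  assumes f: "linear f" "bij_betw f Basis Basis"
    and S: "compact S" "continuous_on (f ` S) h"
  shows "integral (f ` S) h = integral S (\<lambda>x. h (f x))"
proof -
  have cf: "continuous_on A f" for A using linear_continuous_on f(1) linear_conv_bounded_linear by blast
  have inj: "inj f"
  proof -
    have "independent (f ` Basis)" using f(2) independent_Basis by (simp add: bij_betw_def)
    hence "inj_on f (span Basis)" 
      using f by (intro linear_inj_on_span_iff_independent_image[THEN iffD2]) (auto simp: bij_betw_def)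
    thus ?thesis by (simp add: span_Basis)
  qed
  have cS: "compact (f ` S)" by (rule compact_continuous_image[OF cf S(1)])
  have ch: "continuous_on S (\<lambda>x. h (f x))" by (rule continuous_on_compose2[OF S(2) cf]) auto
  have [measurable]: "f \<in> borel_measurable borel" by (intro borel_measurable_continuous_onI cf)
  have i: "(\<lambda>x. indicator (f ` S) x *\<^sub>R h x) \<in> borel_measurable borel"
    using borel_integrable_compact[OF cS S(2)] by (auto dest: borel_measurable_integrable)
  have "integral (f ` S) h = (LINT x|distr lborel borel f. indicator (f ` S) x *\<^sub>R h x)"
    by (simp add: integral_compact_eq[OF cS S(2)] lborel_distr_basis[OF f] set_lebesgue_integral_def)
  also have "\<dots> = (LINT x|lborel. indicator (f ` S) (f x) *\<^sub>R h (f x))"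
    by (rule integral_distr) (use i in auto)
  also have "\<dots> = (LINT x|lborel. indicator S x *\<^sub>R h (f x))"
    by (rule Bochner_Integration.integral_cong)
       (auto simp: inj_image_mem_iff[OF inj] indicator_def)
  also have "\<dots> = integral S (\<lambda>x. h (f x))"
    by (simp add: integral_compact_eq[OF S(1) ch] set_lebesgue_integral_def)
  finally show ?thesis .
qed

text \<open>The extension by zero is integrable on the product, so Fubini's theorem applies to the
  Bochner integral. Slices of a compact set are compact, which turns the inner integrals back into
  gauge integrals, and slices over points outside the projection are empty.\<close>

lemma integral_compact_Fubini:
  fixes h :: "'a::euclidean_space \<times> 'b::euclidean_space \<Rightarrow> 'c::euclidean_space"
  assumes S: "compact S" "continuous_on S h"
  shows "integral S h = integral (fst ` S) (\<lambda>x. integral {y. (x, y) \<in> S} (\<lambda>y. h (x, y)))"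
proof -
  let ?F = "\<lambda>z. indicator S z *\<^sub>R h z"
  have I: "integrable (lborel \<Otimes>\<^sub>M lborel) ?F"
    using borel_integrable_compact[OF S] by (simp add: lborel_prod)
  have sl: "(LINT y|lborel. ?F (x, y)) = integral {y. (x, y) \<in> S} (\<lambda>y. h (x, y))" for x
  proof -
    have "{y. (x, y) \<in> S} = snd ` (S \<inter> ({x} \<times> UNIV))" by force
    moreover have "compact (S \<inter> ({x} \<times> UNIV))"
      by (intro compact_Int_closed S closed_Times) auto
    ultimately have c: "compact {y. (x, y) \<in> S}" 
      by (simp add: compact_continuous_image continuous_on_snd)
    have "continuous_on {y. (x, y) \<in> S} (\<lambda>y. h (x, y))"
      by (rule continuous_on_compose2[OF S(2)]) (auto intro!: continuous_intros)
    from integral_compact_eq[OF c this] show ?thesis 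
      by (simp add: set_lebesgue_integral_def indicator_def of_bool_def)
  qed
  have "integral S h = (LINT z|(lborel \<Otimes>\<^sub>M lborel). ?F z)"
    by (simp add: integral_compact_eq[OF S] lborel_prod set_lebesgue_integral_def)
  also have "\<dots> = (LINT x|lborel. LINT y|lborel. ?F (x, y))"
    by (rule lborel_pair.integral_fst'[OF I, symmetric])
  also have "\<dots> = integral UNIV (\<lambda>x. LINT y|lborel. ?F (x, y))"
    by (rule integral_lborel[symmetric, OF lborel_pair.integrable_fst'[OF I]])
  also have "\<dots> = integral UNIV (\<lambda>x. integral {y. (x, y) \<in> S} (\<lambda>y. h (x, y)))"
    by (simp add: sl)
  also have "\<dots> = integral (fst ` S) (\<lambda>x. integral {y. (x, y) \<in> S} (\<lambda>y. h (x, y)))"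
  proof -
    have "integral {y. (x, y) \<in> S} (\<lambda>y. h (x, y)) = 0" if "x \<notin> fst ` S" for x
    proof -
      have "{y. (x, y) \<in> S} = {}" using that by force
      thus ?thesis by simp
    qed
    thus ?thesis
      by (subst integral_restrict_UNIV[symmetric])
         (auto intro!: Henstock_Kurzweil_Integration.integral_cong)
  qed
  finally show ?thesis .
qed

section \<open>Reference triangle and tetrahedron\<close>

definition std_tri :: "(real \<times> real) set" where
  "std_tri = {(u, v). 0 \<le> u \<and> 0 \<le> v \<and> u + v \<le> 1}"

definition std_tet :: "(real^3) set" where
  "std_tet = {x. 0 \<le> x$1 \<and> 0 \<le> x$2 \<and> 0 \<le> x$3 \<and> x$1 + x$2 + x$3 \<le> 1}"

lemma compact_std_tri [simp, intro]: "compact std_tri"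
proof -
  have "std_tri = (cbox (0, 0) (1, 1) \<inter> {z. fst z + snd z \<le> 1})"
    by (auto simp: std_tri_def cbox_Pair_eq)
  moreover have "closed {z :: real \<times> real. fst z + snd z \<le> 1}"
    by (intro closed_Collect_le continuous_intros)
  ultimately show ?thesis by (elim ssubst) (intro compact_Int_closed compact_cbox)
qed

lemma compact_std_tet [simp, intro]: "compact std_tet"
proof -
  have "std_tet = (cbox 0 1 \<inter> {x. x$1 + x$2 + x$3 \<le> 1})"
    by (auto simp: std_tet_def mem_box_cart forall_3)
  moreover have "closed {x :: real^3. x$1 + x$2 + x$3 \<le> 1}"
    by (intro closed_Collect_le continuous_intros)
  ultimately show ?thesis by (elim ssubst) (intro compact_Int_closed compact_cbox)
qed

lemma std_tri_iterated:
  fixes h :: "real \<times> real \<Rightarrow> real"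
  assumes "continuous_on std_tri h"
  shows "integral std_tri h = integral {0..1} (\<lambda>u. integral {0..1-u} (\<lambda>v. h (u, v)))"
proof -
  have "fst ` std_tri = {0..1}"
    by (force simp: std_tri_def image_iff intro!: bexI[where x = "(_, 0)"])
  moreover have "{v. (u, v) \<in> std_tri} = {0..1-u}" if "u \<in> {0..1}" for u
    using that by (auto simp: std_tri_def)
  ultimately show ?thesis
    by (subst integral_compact_Fubini[OF compact_std_tri assms])
       (auto intro!: Henstock_Kurzweil_Integration.integral_cong)
qed

lemma std_tri_swap:
  fixes h :: "real \<times> real \<Rightarrow> real"
  assumes "continuous_on std_tri h"
  shows "integral std_tri (\<lambda>(u, v). h (v, u)) = integral std_tri h"
proof -
  let ?f = "\<lambda>(u, v). (v, u) :: real \<times> real"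
  have img: "?f ` std_tri = std_tri" by (force simp: std_tri_def)
  have "linear ?f" by (intro linearI) auto
  moreover have "bij_betw ?f Basis Basis"
    by (auto simp: bij_betw_def Basis_prod_def inj_on_def image_def)
  ultimately have "integral (?f ` std_tri) h = integral std_tri (\<lambda>x. h (?f x))"
    by (rule integral_basis_image) (use assms img in auto)
  thus ?thesis unfolding img by (simp add: case_prod_unfold)
qed

lemma integral_reflect_interval:
  fixes f :: "real \<Rightarrow> real"
  shows "integral {0..c} (\<lambda>v. f (c - v)) = integral {0..c} f"
proof -
  have "integral {0..c} (\<lambda>v. f (c - v)) = integral {-c..0} (\<lambda>v. f (c + v))"
    using Henstock_Kurzweil_Integration.integral_reflect_real[where a = "-c" and b = 0 and f = "\<lambda>v. f (c + v)"]
    by (simp only: diff_conv_add_uminus minus_zero minus_minus)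
  also have "\<dots> = integral {0..c} f"
    using integral_shift_Icc_real[of "-c" 0 f c] by (simp add: o_def)
  finally show ?thesis .
qed

text \<open>The affine map \<open>(u, v) \<mapsto> (u, 1 - u - v)\<close> exchanges the vertices
  \<open>(0, 0)\<close> and \<open>(0, 1)\<close>, so together with \<open>std_tri_swap\<close> it
  generates all permutations of the three vertices. It moves the origin, hence the reflection of the
  inner interval in place of a permutation of axes.\<close>

lemma std_tri_reflect:
  fixes h :: "real \<times> real \<Rightarrow> real"
  assumes "continuous_on std_tri h"
  shows "integral std_tri (\<lambda>(u, v). h (u, 1 - u - v)) = integral std_tri h"
proof -
  have "continuous_on std_tri (\<lambda>(u, v). h (u, 1 - u - v))"
    unfolding case_prod_unfold
    by (rule continuous_on_compose2[OF assms]) (auto simp: std_tri_def intro!: continuous_intros)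
  thus ?thesis
    by (simp add: std_tri_iterated assms integral_reflect_interval[where f="\<lambda>v. h (u, v)" for u])
qed

lemma bij_betw_vector_Basis:
  "bij_betw (\<lambda>((u, v), w). vector [u, v, w] :: real^3) Basis Basis"
proof -
  have ax: "axis 1 1 = (vector [1,0,0] :: real^3)" "axis 2 1 = (vector [0,1,0] :: real^3)"
     "axis 3 1 = (vector [0,0,1] :: real^3)"
    by (auto simp: vec_eq_iff axis_def forall_3 vector_3)
  have B3: "(Basis :: (real^3) set) = {vector [1,0,0], vector [0,1,0], vector [0,0,1]}"
    by (auto simp: Basis_vec_def UNIV_3 ax)
  have B: "(Basis :: ((real \<times> real) \<times> real) set) = {((1,0),0), ((0,1),0), ((0,0),1)}"
    by (auto simp: Basis_prod_def zero_prod_def)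
  have "inj_on (\<lambda>((u, v), w). vector [u, v, w] :: real^3) Basis"
    by (auto simp: inj_on_def vec_eq_iff forall_3 vector_3)
  moreover have "(\<lambda>((u, v), w). vector [u, v, w] :: real^3) ` Basis = Basis"
    unfolding B B3 by simp
  ultimately show ?thesis by (simp add: bij_betw_def)
qed

lemma linear_vector3:
  assumes "linear f" "linear g" "linear h"
  shows "linear (\<lambda>x. vector [f x, g x, h x] :: real^3)"
  using assms by (intro linearI) (auto simp: vec_eq_iff forall_3 vector_3 linear_add linear_scale)

lemma std_tet_iterated:
  fixes h :: "real^3 \<Rightarrow> real"
  assumes "continuous_on std_tet h"
  shows "integral std_tet h =
    integral std_tri (\<lambda>(u, v). integral {0..1 - u - v} (\<lambda>w. h (vector [u, v, w])))"
proof -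
  let ?f = "\<lambda>((u, v), w). vector [u, v, w] :: real^3"
  let ?g = "\<lambda>x::real^3. ((x$1, x$2), x$3)"
  let ?S = "?g ` std_tet"
  have fg: "?f (?g x) = x" for x by (auto simp: vec_eq_iff forall_3 vector_3)
  have img: "?f ` ?S = std_tet" by (simp only: image_image fg image_ident)
  have lin: "linear ?f"
    unfolding case_prod_unfold by (intro linear_vector3) (auto intro!: linearI)
  have S: "compact ?S"
    by (intro compact_continuous_image continuous_intros compact_std_tet)
  have Sin: "((u, v), w) \<in> ?S \<longleftrightarrow> (u, v) \<in> std_tri \<and> w \<in> {0..1-u-v}" for u v w
  proof
    assume "(u, v) \<in> std_tri \<and> w \<in> {0..1-u-v}"
    hence "vector [u, v, w] \<in> std_tet" "((u, v), w) = ?g (vector [u, v, w])"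
      by (auto simp: std_tet_def std_tri_def vector_3)
    thus "((u, v), w) \<in> ?S" by blast
  qed (auto simp: std_tet_def std_tri_def)
  have "integral (?f ` ?S) h = integral ?S (\<lambda>x. h (?f x))"
    by (rule integral_basis_image[OF lin bij_betw_vector_Basis S]) (use assms img in auto)
  also have "\<dots> = integral (fst ` ?S) (\<lambda>x. integral {y. (x, y) \<in> ?S} (\<lambda>y. h (?f (x, y))))"
  proof (rule integral_compact_Fubini[OF S])
    have "continuous_on ?S ?f" using lin linear_continuous_on linear_conv_bounded_linear by blast
    thus "continuous_on ?S (\<lambda>x. h (?f x))"
      by (rule continuous_on_compose2[OF assms]) (use img in auto)
  qed
  also have "fst ` ?S = std_tri"
  proof
    show "fst ` ?S \<subseteq> std_tri" using Sin by fastforce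
    have in0: "((u, v), 0) \<in> ?S" if "(u, v) \<in> std_tri" for u v
      using that unfolding Sin by (auto simp: std_tri_def)
    show "std_tri \<subseteq> fst ` ?S" 
    proof (intro subrelI)
      fix u v assume "(u, v) \<in> std_tri"
      hence "((u, v), 0) \<in> ?S" by (rule in0)
      from imageI[OF this, of fst] show "(u, v) \<in> fst ` ?S" by (simp only: fst_conv)
    qed
  qed
  also have "integral std_tri (\<lambda>x. integral {y. (x, y) \<in> ?S} (\<lambda>y. h (?f (x, y)))) =
      integral std_tri (\<lambda>(u, v). integral {0..1 - u - v} (\<lambda>w. h (vector [u, v, w])))"
  proof (rule Henstock_Kurzweil_Integration.integral_cong)
    fix z assume z: "z \<in> std_tri"
    obtain u v where uv: "z = (u, v)" by fastforce
    have "{y. ((u, v), y) \<in> ?S} = {0..1-u-v}" using z unfolding uv Sin by auto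
    thus "integral {y. (z, y) \<in> ?S} (\<lambda>y. h (?f (z, y))) =
      (case z of (u, v) \<Rightarrow> integral {0..1-u-v} (\<lambda>w. h (vector [u, v, w])))" by (simp add: uv)
  qed
  finally show ?thesis by (simp only: img)
qed

text \<open>Axis permutations fix the origin, so they permute the last three vertices of a
  tetrahedron; the first one remains the apex throughout.\<close>

lemma std_tet_permute:
  fixes h :: "real^3 \<Rightarrow> real"
  assumes h: "continuous_on std_tet h" and p: "p permutes (UNIV :: 3 set)"
  shows "integral std_tet (\<lambda>x. h (\<chi> i. x $ p i)) = integral std_tet h"
proof -
  let ?f = "\<lambda>x::real^3. \<chi> i. x $ p i"
  have std: "std_tet = {x. (\<forall>i. 0 \<le> x$i) \<and> (\<Sum>i\<in>UNIV. x$i) \<le> 1}"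
    by (auto simp: std_tet_def forall_3 sum_3)
  have sp: "(\<Sum>i\<in>UNIV. x $ q i) = (\<Sum>i\<in>UNIV. x $ i)" if "q permutes (UNIV :: 3 set)" for q and x :: "real^3"
    using sum.permute[OF that, of "\<lambda>i. x $ i"] by (simp add: o_def)
  have ip: "inv p permutes UNIV" using p by (rule permutes_inv)
  have pin: "p (inv p i) = i" "inv p (p i) = i" for i using permutes_inverses[OF p] by auto
  have img: "?f ` std_tet = std_tet"
  proof safe
    fix x assume "x \<in> std_tet" thus "?f x \<in> std_tet" by (auto simp: std sp[OF p])
  next
    fix x assume "x \<in> std_tet"
    hence "(\<chi> i. x $ inv p i) \<in> std_tet" by (auto simp: std sp[OF ip])
    moreover have "x = ?f (\<chi> i. x $ inv p i)" by (simp add: vec_eq_iff pin)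
    ultimately show "x \<in> ?f ` std_tet" by blast
  qed
  have ax: "?f (axis i 1) = axis (inv p i) 1" for i
    by (simp add: vec_eq_iff axis_def) (metis pin)
  have B: "(Basis :: (real^3) set) = range (\<lambda>i. axis i 1)" by (auto simp: Basis_vec_def)
  have "linear ?f" by (intro linearI) (auto simp: vec_eq_iff)
  moreover have "bij_betw ?f Basis Basis"
  proof (rule bij_betw_imageI)
    show "inj_on ?f Basis" by (auto simp: inj_on_def vec_eq_iff) (metis pin(1))
    have "?f ` Basis = (\<lambda>i. axis i 1) ` (range (inv p))" by (simp only: B image_image ax)
    thus "?f ` Basis = Basis" using permutes_surj[OF ip] by (simp add: B)
  qed
  ultimately have "integral (?f ` std_tet) h = integral std_tet (\<lambda>x. h (?f x))"
    by (rule integral_basis_image) (use h img in auto)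
  thus ?thesis by (simp add: img)
qed

text \<open>These means are not normalised: the constant \<open>1\<close> has mean \<open>1/2\<close> and \<open>1/6\<close>. The vertices may be
  affinely dependent.\<close>

definition mean_tri :: "'a::real_normed_vector \<Rightarrow> 'a \<Rightarrow> 'a \<Rightarrow> ('a \<Rightarrow> real) \<Rightarrow> real" where
  "mean_tri p q r g = integral std_tri (\<lambda>(u, v). g (p + u *\<^sub>R (q - p) + v *\<^sub>R (r - p)))"

definition mean_tet :: "'a::real_normed_vector \<Rightarrow> 'a \<Rightarrow> 'a \<Rightarrow> 'a \<Rightarrow> ('a \<Rightarrow> real) \<Rightarrow> real" where
  "mean_tet p q r s g =
     integral std_tet (\<lambda>x. g (p + x$1 *\<^sub>R (q - p) + x$2 *\<^sub>R (r - p) + x$3 *\<^sub>R (s - p)))"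

lemma in_convex_hull_4:
  fixes p :: "'a::real_vector"
  assumes "0 \<le> a" "0 \<le> b" "0 \<le> c" "a + b + c \<le> 1"
  shows "p + a *\<^sub>R (q - p) + b *\<^sub>R (r - p) + c *\<^sub>R (s - p) \<in> convex hull {p, q, r, s}"
proof -
  let ?u = "\<lambda>i::nat. if i = 0 then 1 - a - b - c else if i = 1 then a else if i = 2 then b else c"
  let ?x = "\<lambda>i::nat. if i = 0 then p else if i = 1 then q else if i = 2 then r else s"
  have "(\<Sum>i\<in>{0, 1, 2, 3}. ?u i *\<^sub>R ?x i) \<in> convex hull {p, q, r, s}"
    using assms by (intro convex_sum) (auto intro: hull_inc)
  thus ?thesis by (simp add: algebra_simps)
qed

lemma in_convex_hull_3:
  fixes p :: "'a::real_vector"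
  assumes "0 \<le> a" "0 \<le> b" "a + b \<le> 1"
  shows "p + a *\<^sub>R (q - p) + b *\<^sub>R (r - p) \<in> convex hull {p, q, r}"
  using in_convex_hull_4[of a b 0 p q r r] assms by simp

lemma continuous_on_tri:
  fixes p :: "'a::real_normed_vector"
  assumes "continuous_on (convex hull {p, q, r}) g"
  shows "continuous_on std_tri (\<lambda>(u, v). g (p + u *\<^sub>R (q - p) + v *\<^sub>R (r - p)))"
  unfolding case_prod_unfold
  by (rule continuous_on_compose2[OF assms], intro continuous_intros)
     (auto simp: std_tri_def intro!: in_convex_hull_3)

lemma continuous_on_tet:
  fixes p :: "'a::real_normed_vector"
  assumes "continuous_on (convex hull {p, q, r, s}) g"
  shows "continuous_on std_tet
    (\<lambda>x. g (p + x$1 *\<^sub>R (q - p) + x$2 *\<^sub>R (r - p) + x$3 *\<^sub>R (s - p)))"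
  by (rule continuous_on_compose2[OF assms], intro continuous_intros)
     (auto simp: std_tet_def intro!: in_convex_hull_4)

lemma mean_tri_swap:
  assumes "continuous_on (convex hull {p, q, r}) g"
  shows "mean_tri p r q g = mean_tri p q r g"
  using std_tri_swap[OF continuous_on_tri[OF assms]]
  unfolding mean_tri_def by (simp add: case_prod_unfold algebra_simps)

lemma mean_tri_reverse:
  assumes "continuous_on (convex hull {p, q, r}) g"
  shows "mean_tri r q p g = mean_tri p q r g"
  using std_tri_reflect[OF continuous_on_tri[OF assms]]
  unfolding mean_tri_def by (simp add: case_prod_unfold algebra_simps)

lemma mean_tet_swap:
  assumes "continuous_on (convex hull {p, q, r, s}) g"
  shows "mean_tet p r q s g = mean_tet p q r s g" "mean_tet p q s r g = mean_tet p q r s g"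
proof -
  have t: "Transposition.transpose i j permutes (UNIV :: 3 set)" for i j
    by (rule permutes_swap_id) auto
  show "mean_tet p r q s g = mean_tet p q r s g"
    using std_tet_permute[OF continuous_on_tet[OF assms] t[of 1 2]]
    unfolding mean_tet_def by (simp add: Transposition.transpose_def algebra_simps)
  show "mean_tet p q s r g = mean_tet p q r s g"
    using std_tet_permute[OF continuous_on_tet[OF assms] t[of 2 3]]
    unfolding mean_tet_def by (simp add: Transposition.transpose_def algebra_simps)
qed

lemma mean_tri_add:
  assumes "continuous_on (convex hull {p, q, r}) g" "continuous_on (convex hull {p, q, r}) h"
  shows "mean_tri p q r (\<lambda>y. g y + h y) = mean_tri p q r g + mean_tri p q r h"
  unfolding mean_tri_def case_prod_unfold
  by (intro Henstock_Kurzweil_Integration.integral_add)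
     (use continuous_on_tri[OF assms(1)] continuous_on_tri[OF assms(2)] in
      \<open>auto simp: case_prod_unfold intro!: integral_compact_eq\<close>)

lemma mean_tet_add:
  assumes "continuous_on (convex hull {p, q, r, s}) g" "continuous_on (convex hull {p, q, r, s}) h"
  shows "mean_tet p q r s (\<lambda>y. g y + h y) = mean_tet p q r s g + mean_tet p q r s h"
  unfolding mean_tet_def
  by (intro Henstock_Kurzweil_Integration.integral_add)
     (use continuous_on_tet[OF assms(1)] continuous_on_tet[OF assms(2)] in
      \<open>auto intro!: integral_compact_eq\<close>)

lemma mean_tri_cong:
  assumes "\<And>y. y \<in> convex hull {p, q, r} \<Longrightarrow> g y = h y"
  shows "mean_tri p q r g = mean_tri p q r h"
  unfolding mean_tri_def
  by (rule Henstock_Kurzweil_Integration.integral_cong)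
     (auto simp: std_tri_def intro!: assms in_convex_hull_3)

lemma mean_tri_cmult: "mean_tri p q r (\<lambda>y. c * g y) = c * mean_tri p q r g"
  unfolding mean_tri_def by (simp add: case_prod_unfold)

lemma mean_tet_cmult: "mean_tet p q r s (\<lambda>y. c * g y) = c * mean_tet p q r s g"
  unfolding mean_tet_def by simp

text \<open>The tetrahedron is swept out by segments parallel to \<open>s - p\<close> that start on
  the facet \<open>p q r\<close> and end on the facet \<open>s q r\<close>; the fundamental theorem
  of calculus on each of them leaves the difference of the end values. No volume or area factor
  appears because both means live on reference simplices, so the identity also covers collapsed
  tetrahedra, in particular those in \<open>real\<close>.\<close>

lemma mean_tet_derivative:
  fixes g :: "'a::real_normed_vector \<Rightarrow> real"
  defines "K \<equiv> \<lambda>p q r s :: 'a. convex hull {p, q, r, s}"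
  assumes der: "\<And>y. y \<in> K p q r s \<Longrightarrow> (g has_derivative g' y) (at y within K p q r s)"
    and cont: "continuous_on (K p q r s) (\<lambda>y. g' y (s - p))"
  shows "mean_tet p q r s (\<lambda>y. g' y (s - p)) = mean_tri s q r g - mean_tri p q r g"
proof -
  define A where "A u v w = p + u *\<^sub>R (q - p) + v *\<^sub>R (r - p) + w *\<^sub>R (s - p)" for u v w
  have AK: "A u v w \<in> K p q r s" if "(u, v) \<in> std_tri" "w \<in> {0..1 - u - v}" for u v w
    using that by (auto simp: A_def K_def std_tri_def intro!: in_convex_hull_4)
  have cg: "continuous_on (K p q r s) g"
    using der has_derivative_continuous continuous_on_eq_continuous_within by blast
  have inner: "integral {0..1 - u - v} (\<lambda>w. g' (A u v w) (s - p)) =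
      g (A u v (1 - u - v)) - g (A u v 0)" if uv: "(u, v) \<in> std_tri" for u v
  proof (rule integral_unique, rule fundamental_theorem_of_calculus)
    show "0 \<le> 1 - u - v" using uv by (auto simp: std_tri_def)
    fix w assume w: "w \<in> {0..1 - u - v}"
    have dA: "(A u v has_derivative (\<lambda>w. w *\<^sub>R (s - p))) (at w within {0..1 - u - v})"
      unfolding A_def by (auto intro!: derivative_eq_intros)
    have "(g has_derivative g' (A u v w)) (at (A u v w) within A u v ` {0..1 - u - v})"
      by (rule has_derivative_subset[OF der]) (use AK uv w in auto)
    from has_derivative_in_compose[OF dA this]
    have "((\<lambda>w. g (A u v w)) has_derivative (\<lambda>x. g' (A u v w) (x *\<^sub>R (s - p)))) (at w within {0..1 - u - v})" .
    moreover have "linear (g' (A u v w))"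
      using der[OF AK[OF uv w]] has_derivative_linear by blast
    ultimately show "((\<lambda>w. g (A u v w)) has_vector_derivative g' (A u v w) (s - p)) (at w within {0..1 - u - v})"
      by (simp add: has_vector_derivative_def linear_scale)
  qed
  have sub: "convex hull {p, q, r} \<subseteq> K p q r s" "convex hull {s, q, r} \<subseteq> K p q r s"
    unfolding K_def by (intro hull_mono; auto)+
  have "mean_tet p q r s (\<lambda>y. g' y (s - p)) =
    integral std_tri (\<lambda>(u, v). integral {0..1 - u - v} (\<lambda>w. g' (A u v w) (s - p)))"
    unfolding mean_tet_def
    by (subst std_tet_iterated[OF continuous_on_tet[OF cont[unfolded K_def]]])
       (simp add: A_def vector_3)
  also have "\<dots> = integral std_tri (\<lambda>(u, v). g (A u v (1 - u - v)) - g (A u v 0))"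
    by (rule Henstock_Kurzweil_Integration.integral_cong) (auto simp: inner)
  also have "\<dots> = integral std_tri (\<lambda>(u, v). g (A u v (1 - u - v))) - integral std_tri (\<lambda>(u, v). g (A u v 0))"
  proof -
    have "continuous_on std_tri (\<lambda>z. g (A (fst z) (snd z) (1 - fst z - snd z)))"
         "continuous_on std_tri (\<lambda>z. g (A (fst z) (snd z) 0))"
      unfolding A_def
      by (rule continuous_on_compose2[OF cg], intro continuous_intros,
          use AK in \<open>force simp: A_def std_tri_def\<close>)+
    thus ?thesis unfolding case_prod_unfold
      by (intro Henstock_Kurzweil_Integration.integral_diff integral_compact_eq) auto
  qed
  also have "\<dots> = mean_tri s q r g - mean_tri p q r g"
    by (simp add: mean_tri_def A_def algebra_simps)
  finally show ?thesis .
qed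

section \<open>Exponential averages\<close>

definition exp_edge :: "real \<Rightarrow> real" where
  "exp_edge a = integral {0..1} (\<lambda>t. exp (a * t))"

text \<open>A triangle collapsed to the real line: the integral of \<open>exp\<close> of an affine
  function over a triangle depends only on its values at the vertices, here \<open>0\<close>,
  \<open>a\<close>, \<open>b\<close>. For \<epsilon> = 1, twice this number is the denominator of
  \<open>bernoulli2\<close>.\<close>

definition exp_tri :: "real \<Rightarrow> real \<Rightarrow> real" where
  "exp_tri a b = mean_tri 0 a b exp"

lemma continuous_on_exp_id [intro]: "continuous_on A (exp :: real \<Rightarrow> real)"
  by (rule continuous_on_exp[OF continuous_on_id])

lemma exp_tri_commute: "exp_tri a b = exp_tri b a"
  unfolding exp_tri_def by (rule mean_tri_swap) auto

text \<open>Translation by \<open>- a\<close> takes \<open>a, b, 0\<close> to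
  \<open>0, b - a, - a\<close> and contributes the factor \<open>exp (- a)\<close>. This is what
  puts the coefficient on the right of an edge equation over the same denominator as those on the
  left.\<close>

lemma exp_tri_shift: "exp_tri (b - a) (- a) = exp (- a) * exp_tri a b"
proof -
  have "exp_tri (b - a) (- a) = exp (- a) * mean_tri a b 0 exp"
    unfolding exp_tri_def mean_tri_cmult[symmetric]
    by (simp add: mean_tri_def mult_exp_exp algebra_simps)
  also have "mean_tri a b 0 exp = mean_tri 0 b a exp" by (rule mean_tri_reverse) auto
  also have "\<dots> = exp_tri a b" unfolding exp_tri_def by (rule mean_tri_swap) auto
  finally show ?thesis .
qed

text \<open>Both sides are the mean of \<open>exp\<close> over the segment between \<open>a\<close>
  and \<open>b\<close>, traversed in the two directions.\<close>

lemma exp_edge_shift: "exp a * exp_edge (b - a) = exp b * exp_edge (a - b)"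
proof -
  have "exp_edge (b - a) = integral {0..1} (\<lambda>t. exp ((b - a) * (1 - t)))"
    unfolding exp_edge_def by (rule integral_reflect_interval[symmetric])
  also have "\<dots> = integral {0..1} (\<lambda>t. exp (b - a) * exp ((a - b) * t))"
    by (simp add: mult_exp_exp algebra_simps)
  also have "\<dots> = exp (b - a) * exp_edge (a - b)" by (simp add: exp_edge_def)
  finally show ?thesis by (simp add: mult_exp_exp flip: mult.assoc)
qed

lemma exp_edge_pos: "exp_edge a > 0"
proof -
  have "integral {0..1::real} (\<lambda>t. exp (- \<bar>a\<bar>)) \<le> exp_edge a"
    unfolding exp_edge_def
  proof (rule integral_le)
    show "(\<lambda>t. exp (a * t)) integrable_on {0..1}"
      by (intro integrable_continuous_real continuous_intros)
    fix t :: real assume t: "t \<in> {0..1}"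
    hence "\<bar>a * t\<bar> \<le> \<bar>a\<bar>" by (simp add: abs_mult mult_left_le)
    thus "exp (- \<bar>a\<bar>) \<le> exp (a * t)" by simp
  qed auto
  thus ?thesis using less_le_trans[OF exp_gt_zero[of "- \<bar>a\<bar>"]] by simp
qed

lemma integral_ramp: "c \<ge> 0 \<Longrightarrow> integral {0..c} (\<lambda>v. c - v :: real) = c\<^sup>2 / 2"
proof (rule integral_unique)
  assume "c \<ge> 0"
  have "((\<lambda>v. c - v) has_integral (c * c - c\<^sup>2 / 2 - (c * 0 - 0\<^sup>2 / 2))) {0..c}"
    using \<open>c \<ge> 0\<close>
    by (intro fundamental_theorem_of_calculus)
       (auto intro!: derivative_eq_intros simp flip: has_real_derivative_iff_has_vector_derivative)
  thus "((\<lambda>v. c - v) has_integral c\<^sup>2 / 2) {0..c}" by (simp add: power2_eq_square)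
qed

lemma integral_std_tri_1: "integral std_tri (\<lambda>_. 1) = (1/2 :: real)"
proof -
  have "integral std_tri (\<lambda>_. 1 :: real) = integral {0..1} (\<lambda>u. 1 - u)"
    by (subst std_tri_iterated) (auto intro!: Henstock_Kurzweil_Integration.integral_cong)
  thus ?thesis using integral_ramp[of 1] by simp
qed

lemma integral_std_tet_1: "integral std_tet (\<lambda>_. 1) = (1/6 :: real)"
proof -
  have "integral std_tet (\<lambda>_. 1 :: real) = integral std_tri (\<lambda>(u, v). 1 - u - v)"
    by (subst std_tet_iterated)
       (auto intro!: Henstock_Kurzweil_Integration.integral_cong simp: std_tri_def)
  also have "\<dots> = integral {0..1} (\<lambda>u. integral {0..1 - u} (\<lambda>v. (1 - u) - v))"
    unfolding case_prod_unfold by (subst std_tri_iterated) (auto intro!: continuous_intros)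
  also have "\<dots> = integral {0..1} (\<lambda>u. (1 - u)\<^sup>2 / 2)"
    by (rule Henstock_Kurzweil_Integration.integral_cong) (simp add: integral_ramp)
  also have "\<dots> = 1/6"
  proof (rule integral_unique)
    have "((\<lambda>u. (1 - u)\<^sup>2 / 2) has_integral (- ((1 - 1) ^ 3) / 6 - (- ((1 - 0) ^ 3) / 6))) {0..1::real}"
      by (intro fundamental_theorem_of_calculus)
         (auto intro!: derivative_eq_intros simp: power2_eq_square
            simp flip: has_real_derivative_iff_has_vector_derivative)
    thus "((\<lambda>u. (1 - u)\<^sup>2 / 2) has_integral 1 / 6) {0..1::real}" by simp
  qed
  finally show ?thesis .
qed

lemma mean_tri_mono:
  assumes "continuous_on (convex hull {p, q, r}) g" "continuous_on (convex hull {p, q, r}) h"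
    and "\<And>y. y \<in> convex hull {p, q, r} \<Longrightarrow> g y \<le> h y"
  shows "mean_tri p q r g \<le> mean_tri p q r h"
  unfolding mean_tri_def
  by (intro integral_le integral_compact_eq compact_std_tri continuous_on_tri assms)
     (auto intro!: assms in_convex_hull_3 simp: std_tri_def)

lemma mean_tet_mono:
  assumes "continuous_on (convex hull {p, q, r, s}) g" "continuous_on (convex hull {p, q, r, s}) h"
    and "\<And>y. y \<in> convex hull {p, q, r, s} \<Longrightarrow> g y \<le> h y"
  shows "mean_tet p q r s g \<le> mean_tet p q r s h"
  unfolding mean_tet_def
  by (intro integral_le integral_compact_eq compact_std_tet continuous_on_tet assms)
     (auto intro!: assms in_convex_hull_4 simp: std_tet_def)

lemma mean_tri_const: "mean_tri p q r (\<lambda>_. c) = c / 2"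
  using mean_tri_cmult[of p q r c "\<lambda>_. 1"] integral_std_tri_1 by (simp add: mean_tri_def case_prod_unfold)

lemma mean_tet_const: "mean_tet p q r s (\<lambda>_. c) = c / 6"
  using mean_tet_cmult[of p q r s c "\<lambda>_. 1"] integral_std_tet_1 by (simp add: mean_tet_def)

lemma exp_lower_bound:
  assumes "finite X"
  obtains m where "m > 0" "\<And>y. y \<in> convex hull X \<Longrightarrow> m \<le> exp (y :: real)"
proof -
  have "bounded (convex hull X)"
    using finite_imp_compact_convex_hull[OF assms] compact_imp_bounded by blast
  then obtain B where "\<And>y. y \<in> convex hull X \<Longrightarrow> \<bar>y\<bar> \<le> B"
    by (auto simp: bounded_iff)
  hence "exp (- B) \<le> exp y" if "y \<in> convex hull X" for y using that by fastforce
  thus thesis using that[of "exp (- B)"] by simp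
qed

lemma mean_tri_exp_pos: "mean_tri p q r exp > (0 :: real)"
proof -
  obtain m where m: "m > 0" "\<And>y. y \<in> convex hull {p, q, r} \<Longrightarrow> m \<le> exp y"
    using exp_lower_bound[of "{p, q, r}"] by auto
  have "mean_tri p q r (\<lambda>_. m) \<le> mean_tri p q r exp"
    by (rule mean_tri_mono) (auto simp: m)
  thus ?thesis using m(1) by (simp add: mean_tri_const)
qed

lemma mean_tet_exp_pos: "mean_tet p q r s exp > (0 :: real)"
proof -
  obtain m where m: "m > 0" "\<And>y. y \<in> convex hull {p, q, r, s} \<Longrightarrow> m \<le> exp y"
    using exp_lower_bound[of "{p, q, r, s}"] by auto
  have "mean_tet p q r s (\<lambda>_. m) \<le> mean_tet p q r s exp"
    by (rule mean_tet_mono) (auto simp: m)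
  thus ?thesis using m(1) by (simp add: mean_tet_const)
qed

lemma exp_tri_pos: "exp_tri a b > 0"
  unfolding exp_tri_def by (rule mean_tri_exp_pos)

text \<open>The divergence theorem for \<open>exp\<close> on the tetrahedron
  \<open>0, a, b, c\<close> collapsed to the real line: \<open>V\<close> is the mean over the
  tetrahedron, \<open>W\<close> the mean over the facet opposite \<open>0\<close>. As
  \<open>exp\<close> is its own derivative, sweeping along the edge from \<open>0\<close> to
  \<open>c\<close> gives \<open>c * V = W - exp_tri a b\<close>, and by symmetry the same
  \<open>V\<close> and \<open>W\<close> serve the other two edges.\<close>

lemma exp_tri_flux:
  obtains V W where "V > 0" "W > 0" "exp_tri a b = W - c * V" "exp_tri b c = W - a * V"
    "exp_tri c a = W - b * V"
proof
  let ?V = "mean_tet 0 a b c exp" and ?W = "mean_tri a b c exp"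
  show "?V > 0" "?W > 0" by (rule mean_tet_exp_pos mean_tri_exp_pos)+
  have step: "z * mean_tet 0 x y z exp = mean_tri z x y exp - exp_tri x y" for x y z
    using mean_tet_derivative[where p = 0 and q = x and r = y and s = z and g = exp
        and g' = "\<lambda>y h. exp y * h :: real"]
    by (simp add: exp_tri_def mean_tet_cmult mult.commute[of _ z])
       (metis DERIV_exp continuous_on_exp_id has_field_derivative_at_within
          has_field_derivative_def mult_commute_abs continuous_on_mult_left)
  have tri: "mean_tri x z y exp = mean_tri x y z exp" "mean_tri z y x exp = mean_tri x y z exp"
    for x y z :: real by (rule mean_tri_swap mean_tri_reverse; auto)+
  have tet: "mean_tet 0 y x z exp = mean_tet 0 x y z exp" "mean_tet 0 x z y exp = mean_tet 0 x y z exp"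
    for x y z :: real by (rule mean_tet_swap; auto)+
  have "mean_tet 0 b c a exp = ?V" "mean_tet 0 c a b exp = ?V"
    by (metis tet)+
  moreover have "mean_tri c a b exp = ?W" "mean_tri b c a exp = ?W" by (metis tri)+
  ultimately show "exp_tri a b = ?W - c * ?V" "exp_tri b c = ?W - a * ?V" "exp_tri c a = ?W - b * ?V"
    using step[of c a b] step[of a b c] step[of b c a] by simp_all
qed

lemma bernoulli2_eq:
  assumes "\<epsilon> > 0"
  shows "bernoulli2 \<epsilon> a b = \<epsilon> * exp_edge (a / \<epsilon>) / (2 * exp_tri (a / \<epsilon>) (b / \<epsilon>))"
proof -
  let ?h = "\<lambda>(u, v). exp (u * (b / \<epsilon>) + v * (a / \<epsilon>))"
  have "continuous_on std_tri ?h"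
    unfolding case_prod_unfold by (intro continuous_intros)
  \<comment> \<open>The outer variable in \<open>bernoulli2\<close> belongs to \<open>b\<close>, so
    the arguments come out exchanged; \<open>exp_tri_commute\<close> restores their order.\<close>
  hence "exp_tri (b / \<epsilon>) (a / \<epsilon>) = 
     integral {0..1} (\<lambda>y2. integral {0..1 - y2} (\<lambda>y1. exp ((a * y1 + b * y2) / \<epsilon>)))"
    using std_tri_iterated[of ?h]
    by (simp add: exp_tri_def mean_tri_def add_divide_distrib algebra_simps)
  thus ?thesis
    unfolding bernoulli2_def exp_edge_def exp_tri_commute[of "a / \<epsilon>"] by simp
qed

section \<open>The local system\<close>

text \<open>
  The equation of the edge \<open>p, q\<close> multiplied by \<open>2 exp_tri / \<epsilon>\<close>, where \<open>b = \<beta>(y) / \<epsilon>\<close> and \<open>J\<close> stands for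
  \<open>j / \<epsilon>\<close>. In this form both sides change sign when \<open>p\<close> and \<open>q\<close> are exchanged.
\<close>

definition edge_eq ::
  "real^3 \<Rightarrow> real^3 \<Rightarrow> real^3 \<Rightarrow> real^3 \<Rightarrow> real^3 \<Rightarrow> real^3 \<Rightarrow> real \<Rightarrow> bool" where
  "edge_eq b y p q J \<phi> c \<longleftrightarrow>
     exp_tri (b \<bullet> (p - y)) (b \<bullet> (q - y)) * (J \<bullet> cross3 (p - y) (q - y))
     - exp_edge (b \<bullet> (p - y)) * (\<phi> \<bullet> (p - y)) + exp_edge (b \<bullet> (q - y)) * (\<phi> \<bullet> (q - y))
     = exp (b \<bullet> (p - y)) * exp_edge (b \<bullet> (q - p)) * c"

lemma edge_system_iff:
  assumes "\<epsilon> > 0"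
  shows "edge_system \<epsilon> x \<beta> i j y J \<phi> \<longleftrightarrow>
    (\<forall>s\<in>{1..4}. \<forall>t\<in>{1..4}. s < t \<longrightarrow>
       edge_eq (\<beta> y /\<^sub>R \<epsilon>) y (x s) (x t) (J /\<^sub>R \<epsilon>) \<phi> (if (i, j) = (s, t) then 1 else 0))"
proof -
  have "J \<bullet> ((1/2) *\<^sub>R cross3 (p - y) (q - y))
           - bernoulli2 \<epsilon> (\<beta> y \<bullet> (p - y)) (\<beta> y \<bullet> (q - y)) * (\<phi> \<bullet> (p - y))
           + bernoulli2 \<epsilon> (\<beta> y \<bullet> (q - y)) (\<beta> y \<bullet> (p - y)) * (\<phi> \<bullet> (q - y))
           = bernoulli2 \<epsilon> (\<beta> y \<bullet> (q - p)) (- (\<beta> y \<bullet> (p - y))) * c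
      \<longleftrightarrow> edge_eq (\<beta> y /\<^sub>R \<epsilon>) y p q (J /\<^sub>R \<epsilon>) \<phi> c" for p q c
  proof -
    define a where "a = (\<beta> y /\<^sub>R \<epsilon>) \<bullet> (p - y)"
    define b where "b = (\<beta> y /\<^sub>R \<epsilon>) \<bullet> (q - y)"
    define K where "K = exp_tri a b"
    have K: "K > 0" unfolding K_def by (rule exp_tri_pos)
    have ab: "\<beta> y \<bullet> (p - y) / \<epsilon> = a" "\<beta> y \<bullet> (q - y) / \<epsilon> = b" "- (\<beta> y \<bullet> (p - y)) / \<epsilon> = - a"
         "\<beta> y \<bullet> (q - p) / \<epsilon> = b - a" "(\<beta> y /\<^sub>R \<epsilon>) \<bullet> (q - p) = b - a"
      by (simp_all add: a_def b_def inner_diff_right divide_inverse algebra_simps)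
    \<comment> \<open>By \<open>exp_tri_shift\<close> the third coefficient also gets the
      denominator \<open>2 * K\<close>; the factor \<open>exp (- a)\<close> below turns into
      \<open>exp a\<close> above.\<close>
    have B: "bernoulli2 \<epsilon> (\<beta> y \<bullet> (p - y)) (\<beta> y \<bullet> (q - y)) = \<epsilon> * exp_edge a / (2 * K)"
        "bernoulli2 \<epsilon> (\<beta> y \<bullet> (q - y)) (\<beta> y \<bullet> (p - y)) = \<epsilon> * exp_edge b / (2 * K)"
        "bernoulli2 \<epsilon> (\<beta> y \<bullet> (q - p)) (- (\<beta> y \<bullet> (p - y))) = \<epsilon> * (exp a * exp_edge (b - a)) / (2 * K)"
      unfolding bernoulli2_eq[OF assms] ab K_def
      by (auto simp: exp_tri_commute[of b a] exp_tri_shift exp_minus field_simps)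
    have e: "edge_eq (\<beta> y /\<^sub>R \<epsilon>) y p q (J /\<^sub>R \<epsilon>) \<phi> c \<longleftrightarrow>
       K * (J \<bullet> cross3 (p - y) (q - y)) / \<epsilon> - exp_edge a * (\<phi> \<bullet> (p - y)) + exp_edge b * (\<phi> \<bullet> (q - y))
        = exp a * exp_edge (b - a) * c"
      unfolding edge_eq_def ab(5) a_def[symmetric] b_def[symmetric] K_def[symmetric]
      by (simp add: field_simps)
    show ?thesis unfolding B e using K assms by (simp add: field_simps)
  qed
  thus ?thesis unfolding edge_system_def Let_def by (simp only:)
qed

lemma edge_eq_commute:
  assumes "edge_eq b y p q J \<phi> c"
  shows "edge_eq b y q p J \<phi> (- c)"
proof -
  have 1: "cross3 (q - y) (p - y) = - cross3 (p - y) (q - y)" by (rule cross_skew)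
  have 2: "exp (b \<bullet> (q - y)) * exp_edge (b \<bullet> (p - q)) = exp (b \<bullet> (p - y)) * exp_edge (b \<bullet> (q - p))"
    using exp_edge_shift[of "b \<bullet> (q - y)" "b \<bullet> (p - y)"] by (simp add: inner_diff_right)
  show ?thesis
    using assms unfolding edge_eq_def 1 2 exp_tri_commute[of "b \<bullet> (q - y)"] by simp
qed

lemma edge_eq_add:
  assumes "edge_eq b y p q J \<phi> c" "edge_eq b y p q J' \<phi>' c'"
  shows "edge_eq b y p q (J + J') (\<phi> + \<phi>') (c + c')"
  using assms unfolding edge_eq_def by (simp add: inner_add_left algebra_simps)

lemma edge_eq_scaleR:
  assumes "edge_eq b y p q J \<phi> c"
  shows "edge_eq b y p q (k *\<^sub>R J) (k *\<^sub>R \<phi>) (k * c)"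
  using arg_cong[OF assms[unfolded edge_eq_def], of "\<lambda>z. k * z"]
  unfolding edge_eq_def by (simp add: algebra_simps)

lemma edge_eq_0: "edge_eq b y p q 0 0 0"
  by (simp add: edge_eq_def)

lemma edge_eq_sum:
  assumes "\<And>i. i \<in> I \<Longrightarrow> edge_eq b y p q (J i) (\<phi> i) (c i)"
  shows "edge_eq b y p q (\<Sum>i\<in>I. J i) (\<Sum>i\<in>I. \<phi> i) (\<Sum>i\<in>I. c i)"
  using assms by (induction I rule: infinite_finite_induct) (auto intro: edge_eq_0 edge_eq_add)

lemma edge_eq_diff:
  assumes "edge_eq b y p q J \<phi> c" "edge_eq b y p q J' \<phi>' c'"
  shows "edge_eq b y p q (J - J') (\<phi> - \<phi>') (c - c')"
  using edge_eq_add[OF assms(1) edge_eq_scaleR[OF assms(2), of "-1"]] by simp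

text \<open>The vector \<open>b\<close> enters only through its products with \<open>p - y\<close>
  and \<open>q - y\<close>. If \<open>y\<close>, \<open>p\<close>, \<open>q\<close> lie in a facet,
  these see only the tangential part of \<open>b\<close>, which is all that two neighbouring
  elements share.\<close>

lemma edge_eq_cong:
  assumes "b \<bullet> (p - y) = b' \<bullet> (p - y)" "b \<bullet> (q - y) = b' \<bullet> (q - y)"
  shows "edge_eq b y p q J \<phi> c \<longleftrightarrow> edge_eq b' y p q J \<phi> c"
proof -
  have "b \<bullet> (q - p) = b' \<bullet> (q - p)" using assms by (simp add: inner_diff_right)
  thus ?thesis unfolding edge_eq_def assms by simp
qed

lemma edge_eq_0_iff:
  "edge_eq b y p q J \<phi> 0 \<longleftrightarrow>
     exp_tri (b \<bullet> (p - y)) (b \<bullet> (q - y)) * (J \<bullet> cross3 (p - y) (q - y))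
       = exp_edge (b \<bullet> (p - y)) * (\<phi> \<bullet> (p - y)) - exp_edge (b \<bullet> (q - y)) * (\<phi> \<bullet> (q - y))"
  unfolding edge_eq_def by auto

text \<open>The divergence theorem for the exponentially weighted constant field \<open>J\<close> on the (possibly
  degenerate) tetrahedron with apex \<open>y\<close> and base \<open>p q r\<close>.\<close>

lemma edge_eq_flux:
  assumes "edge_eq b y p q J \<phi> 0" "edge_eq b y q r J \<phi> 0" "edge_eq b y r p J \<phi> 0"
  obtains \<rho> where "\<rho> > 0"
    "J \<bullet> cross3 (q - p) (r - p) = \<rho> * ((p - y) \<bullet> cross3 (q - y) (r - y)) * (b \<bullet> J)"
proof -
  define P Q R where "P = p - y" and "Q = q - y" and "R = r - y"
  obtain V W where VW: "V > 0" "W > 0" "exp_tri (b \<bullet> P) (b \<bullet> Q) = W - (b \<bullet> R) * V"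
    "exp_tri (b \<bullet> Q) (b \<bullet> R) = W - (b \<bullet> P) * V" "exp_tri (b \<bullet> R) (b \<bullet> P) = W - (b \<bullet> Q) * V"
    by (rule exp_tri_flux)
  \<comment> \<open>Around the triangle \<open>p q r\<close> the terms with \<phi>
    telescope.\<close>
  have sum: "exp_tri (b \<bullet> P) (b \<bullet> Q) * (J \<bullet> cross3 P Q) + exp_tri (b \<bullet> Q) (b \<bullet> R) * (J \<bullet> cross3 Q R)
       + exp_tri (b \<bullet> R) (b \<bullet> P) * (J \<bullet> cross3 R P) = 0"
    using assms unfolding edge_eq_0_iff P_def Q_def R_def by linarith
  \<comment> \<open>Up to the determinant of \<open>P, Q, R\<close> the three cross products form
    the dual basis, so the combination inside is that determinant times \<open>b\<close>.\<close>
  have 1: "(b \<bullet> R) * (J \<bullet> cross3 P Q) + (b \<bullet> P) * (J \<bullet> cross3 Q R) + (b \<bullet> Q) * (J \<bullet> cross3 R P)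
      = (P \<bullet> cross3 Q R) * (b \<bullet> J)"
    by (simp add: inner_vec_def cross3_def sum_3 vector_3) algebra
  \<comment> \<open>The vector areas of the three triangles with apex \<open>y\<close> add up to
    that of the base.\<close>
  have 2: "J \<bullet> cross3 P Q + J \<bullet> cross3 Q R + J \<bullet> cross3 R P = J \<bullet> cross3 (q - p) (r - p)"
  proof -
    have qp: "q - p = Q - P" "r - p = R - P" by (simp_all add: P_def Q_def R_def)
    show ?thesis unfolding qp by (simp add: inner_vec_def cross3_def sum_3 vector_3) algebra
  qed
  have "W * (J \<bullet> cross3 (q - p) (r - p)) = V * ((P \<bullet> cross3 Q R) * (b \<bullet> J))"
    using sum unfolding VW(3-5) 2[symmetric] 1[symmetric] by (simp add: algebra_simps)
  hence "J \<bullet> cross3 (q - p) (r - p) = (V / W) * (P \<bullet> cross3 Q R) * (b \<bullet> J)"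
    using VW(2) by (simp add: field_simps)
  thus ?thesis using that[of "V / W"] VW(1,2) by (simp add: P_def Q_def R_def)
qed

section \<open>Determinants and uniqueness on a tetrahedron and on a facet\<close>

text \<open>Cramer's rule cleared of its denominator, and therefore a polynomial identity valid for
  dependent vectors too.\<close>

lemma cross3_basis_expansion:
  "((a \<bullet> cross3 b c)) *\<^sub>R v = (v \<bullet> cross3 b c) *\<^sub>R a + (v \<bullet> cross3 c a) *\<^sub>R b + (v \<bullet> cross3 a b) *\<^sub>R c"
  by (simp add: inner_vec_def cross3_def sum_3 vector_3 vec_eq_iff forall_3; algebra)

lemma triple_inner_eq_0:
  assumes "a \<bullet> cross3 b c \<noteq> 0" "v \<bullet> a = 0" "v \<bullet> b = 0" "v \<bullet> c = 0"
  shows "v = 0"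
proof -
  have "(a \<bullet> cross3 b c) * (v \<bullet> v) = 0"
    using arg_cong[OF cross3_basis_expansion[of a b c v], of "\<lambda>z. v \<bullet> z"] assms
    by (simp add: inner_add_right)
  thus ?thesis using assms(1) by simp
qed

lemma triple_cross_eq_0:
  assumes "a \<bullet> cross3 b c \<noteq> 0" "v \<bullet> cross3 b c = 0" "v \<bullet> cross3 c a = 0" "v \<bullet> cross3 a b = 0"
  shows "v = 0"
  using cross3_basis_expansion[of a b c v] assms by simp

text \<open>Barycentric coordinates are volume ratios: the origin has coordinates
  \<open>a, b, c, d\<close> with respect to \<open>P, Q, R, S\<close>, and the left side is the
  signed volume, up to the common factor, of the tetrahedron in which the origin replaces
  \<open>P\<close>.\<close>

lemma barycentric_triple:
  fixes P Q R S :: "real^3"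
  assumes 0: "a *\<^sub>R P + b *\<^sub>R Q + c *\<^sub>R R + d *\<^sub>R S = 0" and 1: "a + b + c + d = 1"
  shows "Q \<bullet> cross3 R S = a * ((Q - P) \<bullet> cross3 (R - P) (S - P))"
proof -
  have d: "d = 1 - a - b - c" using 1 by simp
  have *: "a * P$i + b * Q$i + c * R$i + (1 - a - b - c) * S$i = 0" for i
    using arg_cong[OF 0, of "\<lambda>z. z$i"] by (simp add: d)
  show ?thesis using *[of 1] *[of 2] *[of 3]
    by (simp add: inner_vec_def cross3_def sum_3 vector_3) algebra
qed

text \<open>
  The fluxes of \<open>J\<close> through the four facets add up to zero, but all of them are nonnegative
  multiples of the same number \<open>(b \<bullet> J) D\<close>.
\<close>

lemma edge_eq_unique_tet:
  fixes p q r s y :: "real^3"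
  assumes D: "(q - p) \<bullet> cross3 (r - p) (s - p) \<noteq> 0"
    and y: "y = a *\<^sub>R p + a' *\<^sub>R q + a'' *\<^sub>R r + a''' *\<^sub>R s"
    and a: "a \<ge> 0" "a' \<ge> 0" "a'' \<ge> 0" "a''' \<ge> 0" "a + a' + a'' + a''' = 1"
    and e: "edge_eq b y p q J \<phi> 0" "edge_eq b y p r J \<phi> 0" "edge_eq b y p s J \<phi> 0"
      "edge_eq b y q r J \<phi> 0" "edge_eq b y q s J \<phi> 0" "edge_eq b y r s J \<phi> 0"
  shows "J = 0 \<and> \<phi> = 0"
proof -
  note e' = edge_eq_commute[OF e(1), simplified] edge_eq_commute[OF e(2), simplified]
     edge_eq_commute[OF e(3), simplified] edge_eq_commute[OF e(4), simplified]
     edge_eq_commute[OF e(5), simplified] edge_eq_commute[OF e(6), simplified]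
  define P Q R S where "P = p - y" and "Q = q - y" and "R = r - y" and "S = s - y"
  note PQRS = P_def[symmetric] Q_def[symmetric] R_def[symmetric] S_def[symmetric]
  define D where "D = (q - p) \<bullet> cross3 (r - p) (s - p)"
  have zero: "a *\<^sub>R P + a' *\<^sub>R Q + a'' *\<^sub>R R + a''' *\<^sub>R S = 0"
  proof -
    have "a *\<^sub>R P + a' *\<^sub>R Q + a'' *\<^sub>R R + a''' *\<^sub>R S = y - (a + a' + a'' + a''') *\<^sub>R y"
      proof -
      have "a *\<^sub>R P + a' *\<^sub>R Q + a'' *\<^sub>R R + a''' *\<^sub>R S =
          (a *\<^sub>R p + a' *\<^sub>R q + a'' *\<^sub>R r + a''' *\<^sub>R s) - (a + a' + a'' + a''') *\<^sub>R y"
        by (simp add: P_def Q_def R_def S_def algebra_simps)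
      thus ?thesis unfolding y[symmetric] .
    qed
    thus ?thesis using a(5) by simp
  qed
  have diffs: "q - p = Q - P" "r - p = R - P" "s - p = S - P" "r - q = R - Q" "s - q = S - Q"
     "s - r = S - R" "p - s = P - S" "r - s = R - S"  "p - q = P - Q" "p - r = P - R" "q - r = Q - R" "q - s = Q - S"
    by (simp_all add: P_def Q_def R_def S_def)
  \<comment> \<open>The vertices of each facet are listed so that the four normals are coherently
    oriented. Only then do the vector areas add up to zero and do the determinants below become
    \<open>a * D\<close>, \<open>a' * D\<close>, \<open>a'' * D\<close>, \<open>a''' * D\<close>
    with one common sign.\<close>
  obtain \<rho>1 where 1: "\<rho>1 > 0" "J \<bullet> cross3 (R - Q) (S - Q) = \<rho>1 * (Q \<bullet> cross3 R S) * (b \<bullet> J)"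
    using edge_eq_flux[OF e(4) e(6) e'(5)] unfolding PQRS diffs by blast
  obtain \<rho>2 where 2: "\<rho>2 > 0" "J \<bullet> cross3 (S - P) (R - P) = \<rho>2 * (P \<bullet> cross3 S R) * (b \<bullet> J)"
    using edge_eq_flux[OF e(3) e'(6) e'(2)] unfolding PQRS diffs by blast
  obtain \<rho>3 where 3: "\<rho>3 > 0" "J \<bullet> cross3 (Q - P) (S - P) = \<rho>3 * (P \<bullet> cross3 Q S) * (b \<bullet> J)"
    using edge_eq_flux[OF e(1) e(5) e'(3)] unfolding PQRS diffs by blast
  obtain \<rho>4 where 4: "\<rho>4 > 0" "J \<bullet> cross3 (R - P) (Q - P) = \<rho>4 * (P \<bullet> cross3 R Q) * (b \<bullet> J)"
    using edge_eq_flux[OF e(2) e'(4) e'(1)] unfolding PQRS diffs by blast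
  have D': "D = (Q - P) \<bullet> cross3 (R - P) (S - P)" by (simp add: D_def diffs)
  have b1: "Q \<bullet> cross3 R S = a * D"
    unfolding D' by (rule barycentric_triple[OF zero a(5)])
  have b2: "P \<bullet> cross3 S R = a' * D"
  proof -
    have "P \<bullet> cross3 S R = a' * ((P - Q) \<bullet> cross3 (S - Q) (R - Q))"
      by (rule barycentric_triple[of _ _ a _ a''' _ a'']) (use zero a in \<open>auto simp: algebra_simps\<close>)
    also have "(P - Q) \<bullet> cross3 (S - Q) (R - Q) = D"
      unfolding D' by (simp add: inner_vec_def cross3_def sum_3 vector_3) algebra
    finally show ?thesis .
  qed
  have b3: "P \<bullet> cross3 Q S = a'' * D"
  proof -
    have "P \<bullet> cross3 Q S = a'' * ((P - R) \<bullet> cross3 (Q - R) (S - R))"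
      by (rule barycentric_triple[of _ _ a _ a' _ a''']) (use zero a in \<open>auto simp: algebra_simps\<close>)
    also have "(P - R) \<bullet> cross3 (Q - R) (S - R) = D"
      unfolding D' by (simp add: inner_vec_def cross3_def sum_3 vector_3) algebra
    finally show ?thesis .
  qed
  have b4: "P \<bullet> cross3 R Q = a''' * D"
  proof -
    have "P \<bullet> cross3 R Q = a''' * ((P - S) \<bullet> cross3 (R - S) (Q - S))"
      by (rule barycentric_triple[of _ _ a _ a'' _ a']) (use zero a in \<open>auto simp: algebra_simps\<close>)
    also have "(P - S) \<bullet> cross3 (R - S) (Q - S) = D"
      unfolding D' by (simp add: inner_vec_def cross3_def sum_3 vector_3) algebra
    finally show ?thesis .
  qed
  have "J \<bullet> cross3 (R - Q) (S - Q) + J \<bullet> cross3 (S - P) (R - P) + J \<bullet> cross3 (Q - P) (S - P)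
     + J \<bullet> cross3 (R - P) (Q - P) = 0"
    by (simp add: inner_vec_def cross3_def sum_3 vector_3) algebra
  hence "(\<rho>1 * a + \<rho>2 * a' + \<rho>3 * a'' + \<rho>4 * a''') * (D * (b \<bullet> J)) = 0"
    unfolding 1(2) 2(2) 3(2) 4(2) b1 b2 b3 b4 by (simp add: algebra_simps)
  moreover have "\<rho>1 * a + \<rho>2 * a' + \<rho>3 * a'' + \<rho>4 * a''' \<noteq> 0"
  proof
    assume "\<rho>1 * a + \<rho>2 * a' + \<rho>3 * a'' + \<rho>4 * a''' = 0"
    moreover have "\<rho>1 * a \<ge> 0" "\<rho>2 * a' \<ge> 0" "\<rho>3 * a'' \<ge> 0" "\<rho>4 * a''' \<ge> 0"
      using 1 2 3 4 a by auto
    ultimately have "\<rho>1 * a = 0" "\<rho>2 * a' = 0" "\<rho>3 * a'' = 0" "\<rho>4 * a''' = 0" by linarith+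
    hence "a = 0" "a' = 0" "a'' = 0" "a''' = 0" using 1(1) 2(1) 3(1) 4(1) by auto
    thus False using a(5) by simp
  qed
  ultimately have bJ: "b \<bullet> J = 0" using D by (simp add: D_def)
  \<comment> \<open>Every flux carries the factor \<open>b \<bullet> J\<close>, so \<open>J\<close>
    is orthogonal to the normals of the three facets that meet at \<open>p\<close>, and these are
    independent.\<close>
  have J: "J = 0"
  proof (rule triple_cross_eq_0[OF D])
    show "J \<bullet> cross3 (r - p) (s - p) = 0"
      using 2(2) bJ unfolding diffs by (metis cross_skew inner_minus_right mult_zero_right neg_equal_0_iff_equal)
    show "J \<bullet> cross3 (s - p) (q - p) = 0"
      using 3(2) bJ unfolding diffs by (metis cross_skew inner_minus_right mult_zero_right neg_equal_0_iff_equal)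
    show "J \<bullet> cross3 (q - p) (r - p) = 0"
      using 4(2) bJ unfolding diffs by (metis cross_skew inner_minus_right mult_zero_right neg_equal_0_iff_equal)
  qed
  \<comment> \<open>With \<open>J = 0\<close> the products
    \<open>exp_edge (b \<bullet> Z) * (\<phi> \<bullet> Z)\<close> take one common value
    \<open>k\<close> at all four vertices. Weighted with the barycentric coordinates the numbers
    \<open>\<phi> \<bullet> Z\<close> add up to zero, yet for \<open>k \<noteq> 0\<close> they would
    all have the sign of \<open>k\<close>.\<close>
  define k where "k = exp_edge (b \<bullet> P) * (\<phi> \<bullet> P)"
  have k: "exp_edge (b \<bullet> Q) * (\<phi> \<bullet> Q) = k" "exp_edge (b \<bullet> R) * (\<phi> \<bullet> R) = k" "exp_edge (b \<bullet> S) * (\<phi> \<bullet> S) = k"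
    using e(1,2,3) unfolding edge_eq_0_iff PQRS J k_def by auto
  have fz: "\<phi> \<bullet> Z = k / exp_edge (b \<bullet> Z)" if "exp_edge (b \<bullet> Z) * (\<phi> \<bullet> Z) = k" for Z
    using that exp_edge_pos[of "b \<bullet> Z"] by (simp add: field_simps)
  have "k = 0"
  proof (rule ccontr)
    assume "k \<noteq> 0"
    have "a * (\<phi> \<bullet> P) + a' * (\<phi> \<bullet> Q) + a'' * (\<phi> \<bullet> R) + a''' * (\<phi> \<bullet> S) = 0"
      using arg_cong[OF zero, of "\<lambda>z. \<phi> \<bullet> z"] by (simp add: inner_add_right)
    hence "k * (a / exp_edge (b \<bullet> P) + a' / exp_edge (b \<bullet> Q) + a'' / exp_edge (b \<bullet> R) + a''' / exp_edge (b \<bullet> S)) = 0"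
      by (simp add: fz[OF k(1)] fz[OF k(2)] fz[OF k(3)] fz[OF k_def[symmetric]] algebra_simps)
    with \<open>k \<noteq> 0\<close> have "a / exp_edge (b \<bullet> P) + a' / exp_edge (b \<bullet> Q) + a'' / exp_edge (b \<bullet> R) + a''' / exp_edge (b \<bullet> S) = 0"
      by simp
    moreover have nn: "z / exp_edge w \<ge> 0" "z / exp_edge w = 0 \<longleftrightarrow> z = 0" if "z \<ge> 0" for z w
      using that exp_edge_pos[of w] by auto
    ultimately have "a = 0" "a' = 0" "a'' = 0" "a''' = 0"
      using nn[OF a(1)] nn[OF a(2)] nn[OF a(3)] nn[OF a(4)] by (smt (verit))+
    thus False using a(5) by simp
  qed
  hence z: "\<phi> \<bullet> P = 0" "\<phi> \<bullet> Q = 0" "\<phi> \<bullet> R = 0" "\<phi> \<bullet> S = 0"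
    using fz[OF k(1)] fz[OF k(2)] fz[OF k(3)] fz[OF k_def[symmetric]] by auto
  have "\<phi> = 0"
    by (rule triple_inner_eq_0[OF D]) (auto simp: diffs inner_diff_right z)
  with J show ?thesis by simp
qed

text \<open>Barycentric coordinates in a triangle are area ratios: seen from \<open>y\<close>, the
  vector areas of the three subtriangles are these coordinates times the single vector
  \<open>N\<close>. Hence \<open>J\<close> enters only through \<open>J \<bullet> N\<close>, and the
  sum of the equations around the triangle is a positive multiple of it. Afterwards the argument
  with the common value \<open>k\<close> works as on the tetrahedron, with three weights.\<close>

lemma edge_eq_unique_facet:
  fixes p q r y :: "real^3"
  assumes N: "cross3 (q - p) (r - p) \<noteq> 0"
    and y: "y = a *\<^sub>R p + a' *\<^sub>R q + a'' *\<^sub>R r"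
    and a: "a \<ge> 0" "a' \<ge> 0" "a'' \<ge> 0" "a + a' + a'' = 1"
    and e: "edge_eq b y p q J \<phi> 0" "edge_eq b y q r J \<phi> 0" "edge_eq b y r p J \<phi> 0"
  shows "\<phi> \<bullet> (q - p) = 0" "\<phi> \<bullet> (r - p) = 0"
proof -
  define P Q R where "P = p - y" and "Q = q - y" and "R = r - y"
  note PQR = P_def[symmetric] Q_def[symmetric] R_def[symmetric]
  define N where "N = cross3 (q - p) (r - p)"
  have zero: "a *\<^sub>R P + a' *\<^sub>R Q + a'' *\<^sub>R R = 0"
  proof -
    have "a *\<^sub>R P + a' *\<^sub>R Q + a'' *\<^sub>R R = y - (a + a' + a'') *\<^sub>R y"
      proof -
      have "a *\<^sub>R P + a' *\<^sub>R Q + a'' *\<^sub>R R =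
          (a *\<^sub>R p + a' *\<^sub>R q + a'' *\<^sub>R r) - (a + a' + a'') *\<^sub>R y"
        by (simp add: P_def Q_def R_def algebra_simps)
      thus ?thesis unfolding y[symmetric] .
    qed
    thus ?thesis using a(4) by simp
  qed
  have diffs: "q - p = Q - P" "r - p = R - P" by (simp_all add: P_def Q_def R_def)
  have a'': "a'' = 1 - a - a'" using a(4) by simp
  have *: "a * P$i + a' * Q$i + (1 - a - a') * R$i = 0" for i
    using arg_cong[OF zero, of "\<lambda>z. z$i"] by (simp add: a'')
  have c: "cross3 P Q = a'' *\<^sub>R N" "cross3 Q R = a *\<^sub>R N" "cross3 R P = a' *\<^sub>R N"
    using *[of 1] *[of 2] *[of 3] unfolding N_def diffs a''
    by (simp_all add: cross3_def vector_3 vec_eq_iff forall_3) (algebra+)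
  have "(exp_tri (b \<bullet> P) (b \<bullet> Q) * a'' + exp_tri (b \<bullet> Q) (b \<bullet> R) * a + exp_tri (b \<bullet> R) (b \<bullet> P) * a') * (J \<bullet> N) = 0"
    using e unfolding edge_eq_0_iff PQR c by (simp add: algebra_simps)
  moreover have "exp_tri (b \<bullet> P) (b \<bullet> Q) * a'' + exp_tri (b \<bullet> Q) (b \<bullet> R) * a + exp_tri (b \<bullet> R) (b \<bullet> P) * a' \<noteq> 0"
  proof
    assume "exp_tri (b \<bullet> P) (b \<bullet> Q) * a'' + exp_tri (b \<bullet> Q) (b \<bullet> R) * a + exp_tri (b \<bullet> R) (b \<bullet> P) * a' = 0"
    moreover have nn: "exp_tri u v * z \<ge> 0" "exp_tri u v * z = 0 \<longleftrightarrow> z = 0" if "z \<ge> 0" for z u v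
      using that exp_tri_pos[of u v] by auto
    ultimately have "a'' = 0" "a = 0" "a' = 0"
      using nn[OF a(1)] nn[OF a(2)] nn[OF a(3)] by (smt (verit))+
    thus False using a(4) by simp
  qed
  ultimately have JN: "J \<bullet> N = 0" by simp
  define k where "k = exp_edge (b \<bullet> P) * (\<phi> \<bullet> P)"
  have k: "exp_edge (b \<bullet> Q) * (\<phi> \<bullet> Q) = k" "exp_edge (b \<bullet> R) * (\<phi> \<bullet> R) = k"
    using e(1,3) unfolding edge_eq_0_iff PQR c by (auto simp: JN k_def)
  have fz: "\<phi> \<bullet> Z = k / exp_edge (b \<bullet> Z)" if "exp_edge (b \<bullet> Z) * (\<phi> \<bullet> Z) = k" for Z
    using that exp_edge_pos[of "b \<bullet> Z"] by (simp add: field_simps)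
  have "k = 0"
  proof (rule ccontr)
    assume "k \<noteq> 0"
    have "a * (\<phi> \<bullet> P) + a' * (\<phi> \<bullet> Q) + a'' * (\<phi> \<bullet> R) = 0"
      using arg_cong[OF zero, of "\<lambda>z. \<phi> \<bullet> z"] by (simp add: inner_add_right)
    hence "k * (a / exp_edge (b \<bullet> P) + a' / exp_edge (b \<bullet> Q) + a'' / exp_edge (b \<bullet> R)) = 0"
      by (simp add: fz[OF k(1)] fz[OF k(2)] fz[OF k_def[symmetric]] algebra_simps)
    with \<open>k \<noteq> 0\<close> have "a / exp_edge (b \<bullet> P) + a' / exp_edge (b \<bullet> Q) + a'' / exp_edge (b \<bullet> R) = 0"
      by simp
    moreover have nn: "z / exp_edge w \<ge> 0" "z / exp_edge w = 0 \<longleftrightarrow> z = 0" if "z \<ge> 0" for z w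
      using that exp_edge_pos[of w] by auto
    ultimately have "a = 0" "a' = 0" "a'' = 0"
      using nn[OF a(1)] nn[OF a(2)] nn[OF a(3)] by (smt (verit))+
    thus False using a(4) by simp
  qed
  hence z: "\<phi> \<bullet> P = 0" "\<phi> \<bullet> Q = 0" "\<phi> \<bullet> R = 0"
    using fz[OF k(1)] fz[OF k(2)] fz[OF k_def[symmetric]] by auto
  thus "\<phi> \<bullet> (q - p) = 0" "\<phi> \<bullet> (r - p) = 0"
    by (auto simp: diffs inner_diff_right)
qed

text \<open>If the product vanished, \<open>cross3 (r - p) (s - p)\<close> would be orthogonal to
  three vectors that span the space, hence zero, and \<open>r - p\<close> and \<open>s - p\<close>
  would be parallel.\<close>

lemma triple_neq_0:
  fixes p q r s :: "real^3"
  assumes ind: "\<not> affine_dependent {p, q, r, s}" and dist: "distinct [p, q, r, s]"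
  shows "(q - p) \<bullet> cross3 (r - p) (s - p) \<noteq> 0"
proof
  assume 0: "(q - p) \<bullet> cross3 (r - p) (s - p) = 0"
  let ?B = "{q - p, r - p, s - p}"
  have "(\<lambda>z. z - p) ` {q, r, s} = ?B" by auto
  hence B: "independent ?B"
    using ind affine_dependent_iff_dependent[of p "{q, r, s}"] dist by simp
  have "card ?B = 3" using dist by (simp add: card_insert_if)
  hence sp: "span ?B = UNIV"
    using B by (simp add: dim_eq_full[symmetric] dim_eq_card_independent)
  have "orthogonal (cross3 (r - p) (s - p)) z" if "z \<in> ?B" for z
    using that 0 by (elim insertE) (simp_all add: orthogonal_def dot_cross_self inner_commute[of _ "q - p"])
  hence "orthogonal (cross3 (r - p) (s - p)) z" for z
    using orthogonal_to_span[of z ?B] sp by auto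
  hence "cross3 (r - p) (s - p) = 0" by (metis orthogonal_self)
  hence "collinear {0, r - p, s - p}" by (simp add: cross_eq_0)
  then obtain c where "s - p = c *\<^sub>R (r - p)"
    using dist by (auto simp: collinear_lemma)
  hence "s - p \<in> span {r - p}" by (auto simp: span_singleton)
  moreover have "s - p \<notin> span (?B - {s - p})"
    using B unfolding dependent_def by auto
  moreover have "{r - p} \<subseteq> ?B - {s - p}" using dist by auto
  ultimately show False using span_mono by blast
qed

lemma convex_hull_4E:
  fixes p :: "'a::real_vector"
  assumes "y \<in> convex hull {p, q, r, s}"
  obtains a b c d where "0 \<le> a" "0 \<le> b" "0 \<le> c" "0 \<le> d" "a + b + c + d = 1"
    "y = a *\<^sub>R p + b *\<^sub>R q + c *\<^sub>R r + d *\<^sub>R s"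
proof -
  from assms obtain u v z where 1: "u \<ge> 0" "v \<ge> 0" "u + v = 1" "z \<in> convex hull {q, r, s}" "y = u *\<^sub>R p + v *\<^sub>R z"
    by (subst (asm) convex_hull_insert) auto
  from 1(4) obtain a b c where 2: "0 \<le> a" "0 \<le> b" "0 \<le> c" "a + b + c = 1" "z = a *\<^sub>R q + b *\<^sub>R r + c *\<^sub>R s"
    by (auto simp: convex_hull_3)
  have "u + v * a + v * b + v * c = 1" using 1 2 by (metis add.assoc distrib_left mult.right_neutral)
  thus thesis using 1 2 by (intro that[of u "v * a" "v * b" "v * c"]) (auto simp: algebra_simps)
qed

lemma atLeastAtMost_1_4: "{1..4::nat} = {1, 2, 3, 4}" by auto

lemma tet_vertices_points:
  assumes "tet_vertices x T" "distinct [i, j, k, l]" "{i, j, k, l} = {1..4}"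
  shows "distinct [x i, x j, x k, x l]" "\<not> affine_dependent {x i, x j, x k, x l}"
    "T = convex hull {x i, x j, x k, x l}"
    "(x j - x i) \<bullet> cross3 (x k - x i) (x l - x i) \<noteq> 0"
proof -
  have im: "x ` {1..4} = {x i, x j, x k, x l}" unfolding assms(3)[symmetric] by (simp only: image_insert image_empty)
  show 1: "\<not> affine_dependent {x i, x j, x k, x l}" "T = convex hull {x i, x j, x k, x l}"
    using assms(1) unfolding tet_vertices_def im by auto
  show 2: "distinct [x i, x j, x k, x l]"
  proof -
    have "inj_on x (set [i, j, k, l])" using assms(1,3) by (simp add: tet_vertices_def)
    hence "distinct (map x [i, j, k, l])" using assms(2) by (simp only: distinct_map)
    thus ?thesis by simp
  qed
  show "(x j - x i) \<bullet> cross3 (x k - x i) (x l - x i) \<noteq> 0" by (rule triple_neq_0[OF 1(1) 2])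
qed

section \<open>The square linear system and its solvability\<close>

text \<open>The right-hand side is an arbitrary family \<open>c\<close>: Kronecker deltas give the
  basis functions, and a member of their span satisfies the same system with its coefficients as
  \<open>c\<close>.\<close>

definition edge_eqs ::
  "real^3 \<Rightarrow> (nat \<Rightarrow> real^3) \<Rightarrow> real^3 \<Rightarrow> real^3 \<Rightarrow> real^3 \<Rightarrow> (nat \<Rightarrow> nat \<Rightarrow> real) \<Rightarrow> bool" where
  "edge_eqs b x y J \<phi> c \<longleftrightarrow>
     (\<forall>s\<in>{1..4}. \<forall>t\<in>{1..4}. s < t \<longrightarrow> edge_eq b y (x s) (x t) J \<phi> (c s t))"

lemma edge_eqs_iff:
  "edge_eqs b x y J \<phi> c \<longleftrightarrow>
     edge_eq b y (x 1) (x 2) J \<phi> (c 1 2) \<and> edge_eq b y (x 1) (x 3) J \<phi> (c 1 3) \<and>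
     edge_eq b y (x 1) (x 4) J \<phi> (c 1 4) \<and> edge_eq b y (x 2) (x 3) J \<phi> (c 2 3) \<and>
     edge_eq b y (x 2) (x 4) J \<phi> (c 2 4) \<and> edge_eq b y (x 3) (x 4) J \<phi> (c 3 4)"
  unfolding edge_eqs_def atLeastAtMost_1_4 by (simp del: One_nat_def)

lemma edge_eqs_unique:
  assumes x: "tet_vertices x T" and y: "y \<in> T"
    and "edge_eqs b x y J \<phi> c" "edge_eqs b x y J' \<phi>' c"
  shows "J = J' \<and> \<phi> = \<phi>'"
proof -
  note T = tet_vertices_points[OF x, of 1 2 3 4, OF _ atLeastAtMost_1_4[symmetric]]
  have d: "distinct [1, 2, 3, 4::nat]" by simp
  obtain a a' a'' a''' where a: "0 \<le> a" "0 \<le> a'" "0 \<le> a''" "0 \<le> a'''" "a + a' + a'' + a''' = 1"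
    "y = a *\<^sub>R x 1 + a' *\<^sub>R x 2 + a'' *\<^sub>R x 3 + a''' *\<^sub>R x 4"
    using y unfolding T(3)[OF d] by (rule convex_hull_4E)
  have "edge_eqs b x y (J - J') (\<phi> - \<phi>') (\<lambda>s t. 0)"
    unfolding edge_eqs_def
  proof (intro ballI impI)
    fix s t assume "s \<in> {1..4}" "t \<in> {1..4}" "s < (t::nat)"
    hence "edge_eq b y (x s) (x t) (J - J') (\<phi> - \<phi>') (c s t - c s t)"
      using assms(3,4) by (intro edge_eq_diff) (auto simp only: edge_eqs_def)
    thus "edge_eq b y (x s) (x t) (J - J') (\<phi> - \<phi>') 0" by simp
  qed
  hence "J - J' = 0 \<and> \<phi> - \<phi>' = 0"
    unfolding edge_eqs_iff by (intro edge_eq_unique_tet[OF T(4)[OF d] a(6) a(1-5)]) auto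
  thus ?thesis by simp
qed

text \<open>The index type \<open>3 + 3\<close> serves for the six edges as well as for the unknowns \<open>(J, \<phi>)\<close>, which makes the
  matrix square.\<close>

definition edge_of_index :: "3 + 3 \<Rightarrow> nat \<times> nat" where
  "edge_of_index e = (case e of
     Inl k \<Rightarrow> if k = 1 then (1, 2) else if k = 2 then (1, 3) else (1, 4)
   | Inr k \<Rightarrow> if k = 1 then (2, 3) else if k = 2 then (2, 4) else (3, 4))"

definition edge_matrix :: "real^3 \<Rightarrow> (nat \<Rightarrow> real^3) \<Rightarrow> real^3 \<Rightarrow> real^(3+3)^(3+3)" where
  "edge_matrix b x y = (\<chi> e. let p = x (fst (edge_of_index e)); q = x (snd (edge_of_index e)) in
     \<chi> j. case j of
       Inl k \<Rightarrow> exp_tri (b \<bullet> (p - y)) (b \<bullet> (q - y)) * cross3 (p - y) (q - y) $ k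
     | Inr k \<Rightarrow> exp_edge (b \<bullet> (q - y)) * (q - y) $ k - exp_edge (b \<bullet> (p - y)) * (p - y) $ k)"

definition edge_rhs :: "real^3 \<Rightarrow> (nat \<Rightarrow> real^3) \<Rightarrow> (nat \<Rightarrow> nat \<Rightarrow> real) \<Rightarrow> real^3 \<Rightarrow> real^(3+3)" where
  "edge_rhs b x c y = (\<chi> e. let s = fst (edge_of_index e); t = snd (edge_of_index e) in
     exp (b \<bullet> (x s - y)) * exp_edge (b \<bullet> (x t - x s)) * c s t)"

definition join_vec :: "real^3 \<Rightarrow> real^3 \<Rightarrow> real^(3+3)" where
  "join_vec J \<phi> = (\<chi> j. case j of Inl k \<Rightarrow> J $ k | Inr k \<Rightarrow> \<phi> $ k)"

lemma sum_UNIV_sum: "(\<Sum>j\<in>UNIV. f (j :: 3 + 3)) = (\<Sum>k\<in>UNIV. f (Inl k)) + (\<Sum>k\<in>UNIV. f (Inr k))"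
  using sum.Plus[of UNIV UNIV f] by (simp add: o_def)

lemma forall_edge_index:
  "(\<forall>e. P (edge_of_index e)) \<longleftrightarrow> P (1, 2) \<and> P (1, 3) \<and> P (1, 4) \<and> P (2, 3) \<and> P (2, 4) \<and> P (3, 4)"
proof -
  have "(\<forall>e. P (edge_of_index e)) \<longleftrightarrow> (\<forall>k. P (edge_of_index (Inl k))) \<and> (\<forall>k. P (edge_of_index (Inr k)))"
    by (metis sumE)
  thus ?thesis by (simp add: forall_3 edge_of_index_def)
qed

lemma edge_eqs_matrix:
  "edge_eqs b x y J \<phi> c \<longleftrightarrow> edge_matrix b x y *v join_vec J \<phi> = edge_rhs b x c y"
proof -
  have "(edge_matrix b x y *v join_vec J \<phi>) $ e = edge_rhs b x c y $ e \<longleftrightarrow>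
      (case edge_of_index e of (s, t) \<Rightarrow> edge_eq b y (x s) (x t) J \<phi> (c s t))" for e
    unfolding edge_matrix_def edge_rhs_def join_vec_def edge_eq_def matrix_vector_mult_def Let_def
    by (simp add: sum_UNIV_sum case_prod_unfold inner_vec_def sum_distrib_left sum_distrib_right
          algebra_simps sum_subtractf sum.distrib)
  hence "edge_matrix b x y *v join_vec J \<phi> = edge_rhs b x c y \<longleftrightarrow>
     (\<forall>e. case edge_of_index e of (s, t) \<Rightarrow> edge_eq b y (x s) (x t) J \<phi> (c s t))"
    by (simp add: vec_eq_iff)
  also have "\<dots> \<longleftrightarrow> edge_eqs b x y J \<phi> c"
    unfolding forall_edge_index[where P = "\<lambda>e. case e of (s, t) \<Rightarrow> edge_eq b y (x s) (x t) J \<phi> (c s t)"]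
      edge_eqs_iff by simp
  finally show ?thesis ..
qed

lemma join_vec_surj: "\<exists>J \<phi>. z = join_vec J \<phi>"
proof -
  have "z = join_vec (\<chi> k. z $ Inl k) (\<chi> k. z $ Inr k)"
    by (simp add: join_vec_def vec_eq_iff split: sum.split)
  thus ?thesis by blast
qed

text \<open>By \<open>edge_eqs_unique\<close> the kernel is trivial. That the determinant is nonzero
  on the whole closed element is used twice: for the existence of solutions, and as the denominator
  in Cramer's rule when smoothness is proved.\<close>

lemma det_edge_matrix:
  assumes "tet_vertices x T" "y \<in> T"
  shows "det (edge_matrix b x y) \<noteq> 0"
proof -
  have "inj ((*v) (edge_matrix b x y))"
  proof (subst linear_injective_0[OF matrix_vector_mul_linear], safe)
    fix z assume z: "edge_matrix b x y *v z = 0"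
    obtain J \<phi> where J: "z = join_vec J \<phi>" using join_vec_surj by blast
    have r: "edge_rhs b x (\<lambda>_ _. 0) y = 0" by (simp add: edge_rhs_def vec_eq_iff)
    have "edge_eqs b x y J \<phi> (\<lambda>_ _. 0)" "edge_eqs b x y 0 0 (\<lambda>_ _. 0)"
      using z r by (simp_all only: edge_eqs_matrix[of _ _ _ J] J edge_eqs_iff[of _ _ _ 0] edge_eq_0)
    from edge_eqs_unique[OF assms this] show "z = 0" by (simp add: J join_vec_def vec_eq_iff split: sum.split)
  qed
  thus ?thesis
    by (metis invertible_det_nz invertible_left_inverse matrix_left_invertible_injective)
qed

lemma edge_eqs_exists:
  assumes "tet_vertices x T" "y \<in> T"
  shows "\<exists>J \<phi>. edge_eqs b x y J \<phi> c"
proof -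
  obtain z where "edge_matrix b x y *v z = edge_rhs b x c y"
    using cramer[OF det_edge_matrix[OF assms], of b _ "edge_rhs b x c y"] by blast
  thus ?thesis using join_vec_surj[of z] unfolding edge_eqs_matrix by blast
qed

text \<open>\<open>edge_pair\<close> is a definite description, so it solves the system only because
  existence and uniqueness are available at every \<open>y\<close> in \<open>T\<close>.\<close>

lemma edge_pair_system:
  assumes "\<epsilon> > 0" "tet_vertices x T" "y \<in> T"
  shows "edge_system \<epsilon> x \<beta> i j y (fst (edge_pair \<epsilon> x \<beta> i j y)) (\<phi>E \<epsilon> x \<beta> i j y)"
proof -
  let ?c = "\<lambda>s t. if (i, j) = (s, t) then 1 else 0"
  have iff: "edge_system \<epsilon> x \<beta> i j y J \<phi> \<longleftrightarrow> edge_eqs (\<beta> y /\<^sub>R \<epsilon>) x y (J /\<^sub>R \<epsilon>) \<phi> ?c" for J \<phi>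
    unfolding edge_system_iff[OF assms(1)] edge_eqs_def ..
  obtain J \<phi> where J: "edge_eqs (\<beta> y /\<^sub>R \<epsilon>) x y J \<phi> ?c"
    using edge_eqs_exists[OF assms(2,3)] by blast
  have "\<exists>!p. edge_system \<epsilon> x \<beta> i j y (fst p) (snd p)"
  proof (rule ex1I[of _ "(\<epsilon> *\<^sub>R J, \<phi>)"])
    show "edge_system \<epsilon> x \<beta> i j y (fst (\<epsilon> *\<^sub>R J, \<phi>)) (snd (\<epsilon> *\<^sub>R J, \<phi>))"
      using J assms(1) by (simp add: iff)
    fix p assume "edge_system \<epsilon> x \<beta> i j y (fst p) (snd p)"
    hence "fst p /\<^sub>R \<epsilon> = J \<and> snd p = \<phi>"
      using edge_eqs_unique[OF assms(2,3) _ J] iff by blast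
    thus "p = (\<epsilon> *\<^sub>R J, \<phi>)" using assms(1) by (auto simp: prod_eq_iff)
  qed
  from theI'[OF this] show ?thesis by (simp add: edge_pair_def \<phi>E_def)
qed

text \<open>Superposition: since each basis function has a Kronecker delta on the right, the
  coefficients of \<open>v\<close> reappear as the right-hand sides. One family \<open>c\<close>
  serves all \<open>y\<close>, while \<open>J\<close> varies with \<open>y\<close>.\<close>

lemma S_local_edge_eqs:
  assumes "\<epsilon> > 0" "tet_vertices x T" "v \<in> S_local \<epsilon> x \<beta> T"
  obtains c where "\<And>y. y \<in> T \<Longrightarrow> \<exists>J. edge_eqs (\<beta> y /\<^sub>R \<epsilon>) x y J (v y) c"
proof -
  let ?P = "{(i, j). 1 \<le> i \<and> i < j \<and> j \<le> (4::nat)}"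
  have fin: "finite ?P" by (rule finite_subset[of _ "{..4} \<times> {..4}"]) auto
  obtain c where c: "\<And>y. y \<in> T \<Longrightarrow> v y = (\<Sum>(i, j)\<in>?P. c i j *\<^sub>R \<phi>E \<epsilon> x \<beta> i j y)"
    using assms(3) unfolding S_local_def by blast
  show thesis
  proof (rule that[of c])
    fix y assume y: "y \<in> T"
    let ?J = "\<lambda>i j. fst (edge_pair \<epsilon> x \<beta> i j y) /\<^sub>R \<epsilon>"
    have "edge_eqs (\<beta> y /\<^sub>R \<epsilon>) x y (\<Sum>e\<in>?P. c (fst e) (snd e) *\<^sub>R ?J (fst e) (snd e)) (v y) c"
      unfolding edge_eqs_def
    proof (intro ballI impI)
      fix s t assume st: "s \<in> {1..4}" "t \<in> {1..4}" "s < (t::nat)"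
      have "edge_eq (\<beta> y /\<^sub>R \<epsilon>) y (x s) (x t) (?J i j) (\<phi>E \<epsilon> x \<beta> i j y) (if (i, j) = (s, t) then 1 else 0)" for i j
        using edge_pair_system[OF assms(1,2) y] st unfolding edge_system_iff[OF assms(1)] by blast
      hence "edge_eq (\<beta> y /\<^sub>R \<epsilon>) y (x s) (x t)
         (\<Sum>e\<in>?P. c (fst e) (snd e) *\<^sub>R ?J (fst e) (snd e))
         (\<Sum>e\<in>?P. c (fst e) (snd e) *\<^sub>R \<phi>E \<epsilon> x \<beta> (fst e) (snd e) y)
         (\<Sum>e\<in>?P. c (fst e) (snd e) * (if (fst e, snd e) = (s, t) then 1 else 0))"
        by (intro edge_eq_sum edge_eq_scaleR)
      moreover have "(\<Sum>e\<in>?P. c (fst e) (snd e) * (if (fst e, snd e) = (s, t) then 1 else 0)) = c s t"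
      proof -
        have "(\<Sum>e\<in>?P. c (fst e) (snd e) * (if (fst e, snd e) = (s, t) then 1 else 0))
          = (\<Sum>e\<in>?P. if e = (s, t) then c s t else 0)"
          by (rule sum.cong) auto
        also have "\<dots> = c s t" using fin st by (subst sum.delta) auto
        finally show ?thesis .
      qed
      ultimately show "edge_eq (\<beta> y /\<^sub>R \<epsilon>) y (x s) (x t)
         (\<Sum>e\<in>?P. c (fst e) (snd e) *\<^sub>R ?J (fst e) (snd e)) (v y) (c s t)"
        by (simp add: c[OF y] case_prod_unfold)
    qed
    thus "\<exists>J. edge_eqs (\<beta> y /\<^sub>R \<epsilon>) x y J (v y) c" by blast
  qed
qed

section \<open>Facet normals and vanishing tangential traces\<close>

lemma cross3_cross3: "cross3 (cross3 a b) c = (a \<bullet> c) *\<^sub>R b - (b \<bullet> c) *\<^sub>R a"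
  by (simp add: inner_vec_def cross3_def sum_3 vector_3 vec_eq_iff forall_3 algebra_simps)

lemma cross3_neq_0_facet:
  assumes "(q - p) \<bullet> cross3 (r - p) (s - p) \<noteq> (0::real)"
  shows "cross3 (q - p) (r - p) \<noteq> 0"
proof
  assume 0: "cross3 (q - p) (r - p) = 0"
  have "(q - p) \<bullet> cross3 (r - p) (s - p) = (s - p) \<bullet> cross3 (q - p) (r - p)"
    by (simp add: inner_vec_def cross3_def sum_3 vector_3 algebra_simps)
  thus False using assms 0 by simp
qed

lemma inner_const_hull_3:
  fixes n :: "'a::real_inner"
  assumes "n \<bullet> (q - p) = 0" "n \<bullet> (r - p) = 0" "a \<in> convex hull {p, q, r}"
  shows "n \<bullet> a = n \<bullet> p"
proof -
  have eq: "n \<bullet> q = n \<bullet> p" "n \<bullet> r = n \<bullet> p" using assms(1,2) by (auto simp: inner_diff_right)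
  obtain u v w where "u + v + w = 1" "a = u *\<^sub>R p + v *\<^sub>R q + w *\<^sub>R r"
    using assms(3) by (auto simp: convex_hull_3)
  thus ?thesis by (simp add: inner_add_right eq flip: distrib_right)
qed

lemma unit_normal_facet_iff:
  assumes "F = convex hull {p, q, r}"
  shows "unit_normal F n \<longleftrightarrow> norm n = 1 \<and> n \<bullet> (q - p) = 0 \<and> n \<bullet> (r - p) = 0"
proof
  assume "unit_normal F n"
  thus "norm n = 1 \<and> n \<bullet> (q - p) = 0 \<and> n \<bullet> (r - p) = 0"
    by (auto simp: unit_normal_def assms hull_inc)
next
  assume n: "norm n = 1 \<and> n \<bullet> (q - p) = 0 \<and> n \<bullet> (r - p) = 0"
  hence "n \<bullet> a = n \<bullet> p" if "a \<in> F" for a using that inner_const_hull_3 unfolding assms by blast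
  thus "unit_normal F n" using n by (simp add: unit_normal_def inner_diff_right)
qed

lemma parallel_cross3:
  assumes "n \<bullet> a = 0" "n \<bullet> b = 0" "cross3 a b \<noteq> 0"
  shows "\<exists>c. n = c *\<^sub>R cross3 a b"
proof -
  define N where "N = cross3 a b"
  have "cross3 N n = 0" using assms(1,2) by (simp add: N_def cross3_cross3 inner_commute)
  hence "(N \<bullet> n) *\<^sub>R N = (N \<bullet> N) *\<^sub>R n"
    using cross3_cross3[of N n N] by (simp add: inner_commute)
  hence "n = ((N \<bullet> n) / (N \<bullet> N)) *\<^sub>R N"
    using assms(3) by (simp add: N_def vector_fraction_eq_iff)
       (metis (no_types, lifting) divide_inverse_commute inner_eq_zero_iff inverse_eq_divide real_vector_eq_affinity scaleR_scaleR vector_fraction_eq_iff)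
  thus ?thesis unfolding N_def by blast
qed

lemma tet_normal_facet:
  assumes F: "tet_facet x s = convex hull {p, q, r}"
    and D: "cross3 (q - p) (r - p) \<bullet> (x s - p) \<noteq> 0"
  shows "\<exists>c. tet_normal x s = c *\<^sub>R cross3 (q - p) (r - p)"
proof -
  define N where "N = cross3 (q - p) (r - p)"
  have N0: "N \<noteq> 0" using D by (auto simp: N_def)
  have NF: "N \<bullet> (q - p) = 0" "N \<bullet> (r - p) = 0"
    by (simp_all add: N_def dot_cross_self)
  have pF: "p \<in> tet_facet x s" unfolding F by (simp add: hull_inc)
  let ?P = "\<lambda>n. unit_normal (tet_facet x s) n \<and> (\<forall>a\<in>tet_facet x s. n \<bullet> (x s - a) < 0)"
  have iff: "?P n \<longleftrightarrow> norm n = 1 \<and> n \<bullet> (q - p) = 0 \<and> n \<bullet> (r - p) = 0 \<and> n \<bullet> (x s - p) < 0" for n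
  proof
    assume "?P n"
    thus "norm n = 1 \<and> n \<bullet> (q - p) = 0 \<and> n \<bullet> (r - p) = 0 \<and> n \<bullet> (x s - p) < 0"
      using pF unit_normal_facet_iff[OF F] by blast
  next
    assume n: "norm n = 1 \<and> n \<bullet> (q - p) = 0 \<and> n \<bullet> (r - p) = 0 \<and> n \<bullet> (x s - p) < 0"
    have "n \<bullet> (x s - a) = n \<bullet> (x s - p)" if "a \<in> tet_facet x s" for a
      using inner_const_hull_3[of n q p r a] n that unfolding F by (simp add: inner_diff_right)
    thus "?P n" using n unit_normal_facet_iff[OF F] by simp
  qed
  \<comment> \<open>The sign makes \<open>n0\<close> point away from the opposite vertex
    \<open>x s\<close>; the length is one.\<close>
  define n0 where "n0 = (- sgn (N \<bullet> (x s - p)) / norm N) *\<^sub>R N"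
  have "?P n0"
  proof (unfold iff, intro conjI)
    have "sgn (N \<bullet> (x s - p)) * (N \<bullet> (x s - p)) > 0"
      using D by (simp add: N_def sgn_if)
    thus "n0 \<bullet> (x s - p) < 0"
      using N0 by (simp add: n0_def divide_less_0_iff mult_less_0_iff)
    show "norm n0 = 1" using N0 D by (simp add: n0_def abs_sgn_eq N_def)
  qed (use NF in \<open>simp_all add: n0_def\<close>)
  moreover have "n = n0" if "?P n" for n
  proof -
    note n = that[unfolded iff]
    obtain c where c: "n = c *\<^sub>R N"
      using parallel_cross3[of n "q - p" "r - p"] N0 n unfolding N_def by blast
    have "\<bar>c\<bar> * norm N = 1" "c * (N \<bullet> (x s - p)) < 0" using n c by auto
    hence "c = - sgn (N \<bullet> (x s - p)) / norm N"
      using N0 by (auto simp: sgn_if field_simps abs_if mult_less_0_iff split: if_splits)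
    thus ?thesis by (simp add: n0_def c)
  qed
  ultimately have "tet_normal x s = n0" unfolding tet_normal_def by (rule the_equality)
  thus ?thesis unfolding n0_def N_def by blast
qed

text \<open>The labels come out in increasing order because the system lists the equation of an edge
  only for \<open>s < t\<close>.\<close>

lemma facet_labels:
  assumes "s \<in> {1..4::nat}"
  obtains k l m where "{1..4} - {s} = {k, l, m}" "{k, l, m, s} = {1..4}" "k < l" "l < m" "s \<notin> {k, l, m}"
    "distinct [k, l, m, s]"
proof -
  consider "s = 1" | "s = 2" | "s = 3" | "s = 4" using assms by force
  thus thesis
  proof cases
    case 1 show ?thesis by (rule that[of 2 3 4]) (auto simp: 1)
  next
    case 2 show ?thesis by (rule that[of 1 3 4]) (auto simp: 2)
  next
    case 3 show ?thesis by (rule that[of 1 2 4]) (auto simp: 3)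
  next
    case 4 show ?thesis by (rule that[of 1 2 3]) (auto simp: 4)
  qed
qed

lemma tet_facet_eq:
  assumes "{1..4} - {s} = {k, l, m}"
  shows "tet_facet x s = convex hull {x k, x l, x m}"
  by (simp only: tet_facet_def assms image_insert image_empty)

text \<open>The edge from \<open>x i\<close> to \<open>x j\<close> ends at \<open>x s\<close>, so it
  is not an edge of the opposite facet, and the three equations belonging to that facet are
  homogeneous. By \<open>edge_eq_unique_facet\<close> the basis function is then orthogonal to two
  independent directions of the facet.\<close>

lemma cross3_normal_phiE:
  assumes \<epsilon>: "\<epsilon> > 0" and x: "tet_vertices x T" and ij: "1 \<le> i" "i < j" "j \<le> 4"
    and s: "s \<in> {i, j}" and y: "y \<in> tet_facet x s"
  shows "cross3 (tet_normal x s) (\<phi>E \<epsilon> x \<beta> i j y) = 0"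
proof -
  have "s \<in> {1..4}" using ij s by auto
  then obtain k l m where klm: "{1..4} - {s} = {k, l, m}" "{k, l, m, s} = {1..4}" "k < l" "l < m" "s \<notin> {k, l, m}"
    "distinct [k, l, m, s]" by (rule facet_labels)
  note F = tet_facet_eq[OF klm(1), of x]
  note T = tet_vertices_points[OF x klm(6) klm(2)]
  have "y \<in> T" using y hull_mono[of "{x k, x l, x m}" "{x k, x l, x m, x s}"] unfolding F T(3) by auto
  from edge_pair_system[OF \<epsilon> x this, of \<beta> i j, unfolded edge_system_iff[OF \<epsilon>]]
  have "\<exists>J. \<forall>s\<in>{1..4}. \<forall>t\<in>{1..4}. s < t \<longrightarrow>
       edge_eq (\<beta> y /\<^sub>R \<epsilon>) y (x s) (x t) J (\<phi>E \<epsilon> x \<beta> i j y) (if (i, j) = (s, t) then 1 else 0)" by blast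
  then obtain J where J: "\<And>a b. a \<in> {1..4} \<Longrightarrow> b \<in> {1..4} \<Longrightarrow> a < b \<Longrightarrow>
       edge_eq (\<beta> y /\<^sub>R \<epsilon>) y (x a) (x b) J (\<phi>E \<epsilon> x \<beta> i j y) (if (i, j) = (a, b) then 1 else 0)" by blast
  have e: "edge_eq (\<beta> y /\<^sub>R \<epsilon>) y (x a) (x b) J (\<phi>E \<epsilon> x \<beta> i j y) 0"
    if "a \<in> {k, l, m}" "b \<in> {k, l, m}" "a < b" for a b
  proof -
    have "(i, j) \<noteq> (a, b)" using that s klm(5) by blast
    moreover have "a \<in> {1..4}" "b \<in> {1..4}" using that(1,2) klm(2) by blast+
    ultimately show ?thesis using J[of a b] that(3) by (simp only: if_False)
  qed
  obtain u v w where uvw: "0 \<le> u" "0 \<le> v" "0 \<le> w" "u + v + w = 1" "y = u *\<^sub>R x k + v *\<^sub>R x l + w *\<^sub>R x m"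
    using y unfolding F by (auto simp: convex_hull_3)
  have D: "cross3 (x l - x k) (x m - x k) \<bullet> (x s - x k) \<noteq> 0"
  proof -
    have "cross3 (x l - x k) (x m - x k) \<bullet> (x s - x k) = (x l - x k) \<bullet> cross3 (x m - x k) (x s - x k)"
      by (simp add: inner_vec_def cross3_def sum_3 vector_3 algebra_simps)
    thus ?thesis using T(4) by simp
  qed
  have N: "cross3 (x l - x k) (x m - x k) \<noteq> 0" by (rule cross3_neq_0_facet[OF T(4)])
  have e3: "edge_eq (\<beta> y /\<^sub>R \<epsilon>) y (x m) (x k) J (\<phi>E \<epsilon> x \<beta> i j y) 0"
    using edge_eq_commute[OF e[of k m]] klm(3,4) by simp
  have *: "\<phi>E \<epsilon> x \<beta> i j y \<bullet> (x l - x k) = 0" "\<phi>E \<epsilon> x \<beta> i j y \<bullet> (x m - x k) = 0"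
    using edge_eq_unique_facet[OF N uvw(5) uvw(1-4) e[of k l] e[of l m] e3] klm(3,4) by auto
  obtain c where "tet_normal x s = c *\<^sub>R cross3 (x l - x k) (x m - x k)"
    using tet_normal_facet[OF F D] by blast
  thus ?thesis using * by (simp add: cross_mult_left cross3_cross3 inner_commute)
qed

section \<open>Smoothness of the basis functions on closed elements\<close>

lemma DERIV_exp_edge:
  "(exp_edge has_real_derivative integral {0..1} (\<lambda>t. t * exp (a * t))) (at a)"
  unfolding exp_edge_def[abs_def] interval_cbox
  by (rule leibniz_rule_field_derivative)
     (auto intro!: derivative_eq_intros integrable_continuous_real continuous_intros simp: case_prod_unfold)

lemma continuous_on_exp_edge': "continuous_on A (\<lambda>a. integral {0..1} (\<lambda>t. t * exp (a * t :: real)))"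
  unfolding interval_cbox
  by (rule integral_continuous_on_param) (auto intro!: continuous_intros simp: case_prod_unfold)

lemma continuous_on_exp_edge: "continuous_on A exp_edge"
  using DERIV_exp_edge DERIV_isCont continuous_at_imp_continuous_on by blast

text \<open>Rescaling the inner variable to the unit interval makes the domain of integration fixed,
  and the dependence on \<open>b\<close> is absorbed into \<open>exp_edge\<close>; in this form the
  Leibniz rule applies.\<close>

lemma exp_tri_iterated:
  "exp_tri a b = integral {0..1} (\<lambda>u. (1 - u) * exp (a * u) * exp_edge (b * (1 - u)))"
proof -
  have c: "continuous_on std_tri (\<lambda>(u, v). exp (u * a + v * b))"
    unfolding case_prod_unfold by (intro continuous_intros)
  have inner: "integral {0..1 - u} (\<lambda>v. exp (u * a + v * b)) = (1 - u) * exp (a * u) * exp_edge (b * (1 - u))"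
    if u: "u \<in> {0..1}" for u
  \<comment> \<open>At \<open>u = 1\<close> the inner interval is a point and cannot be rescaled,
    but the factor \<open>1 - u\<close> vanishes as well.\<close>
  proof (cases "u = 1")
    case False
    hence m: "1 - u > 0" using u by auto
    have "integral ((\<lambda>x. x / (1 - u)) ` {0..1 - u}) (\<lambda>t. exp (u * a + ((1 - u) * t) * b)) =
       (1 / \<bar>1 - u\<bar>) *\<^sub>R integral {0..1 - u} (\<lambda>v. exp (u * a + v * b))"
      by (rule integral_stretch_real) (use m in simp)
    moreover have "(\<lambda>x. x / (1 - u)) ` {0..1 - u} = {0..1}"
      using m by (simp add: image_divide_atLeastAtMost)
    moreover have "integral {0..1} (\<lambda>t. exp (u * a + ((1 - u) * t) * b)) = exp (a * u) * exp_edge (b * (1 - u))"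
    proof -
      have "exp (u * a + ((1 - u) * t) * b) = exp (a * u) * exp (b * (1 - u) * t)" for t
        by (simp add: mult_exp_exp algebra_simps)
      thus ?thesis by (simp add: exp_edge_def)
    qed
    ultimately show ?thesis using m by (simp add: field_simps)
  qed simp
  show ?thesis
    using std_tri_iterated[OF c]
      Henstock_Kurzweil_Integration.integral_cong[of "{0..1}", OF inner]
    by (simp add: exp_tri_def mean_tri_def)
qed

lemma continuous_on_exp_edge_compose [continuous_intros]:
  "continuous_on A f \<Longrightarrow> continuous_on A (\<lambda>x. exp_edge (f x))"
  using continuous_on_compose2[OF continuous_on_exp_edge[of UNIV]] by blast

lemma continuous_on_exp_edge'_compose [continuous_intros]:
  "continuous_on A f \<Longrightarrow> continuous_on A (\<lambda>x. integral {0..1} (\<lambda>t. t * exp (f x * t :: real)))"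
  using continuous_on_compose2[OF continuous_on_exp_edge'[of UNIV]] by blast

text \<open>The partial derivative of \<open>exp_tri\<close> in its first argument. By symmetry the
  one in the second argument is \<open>exp_tri_d b a\<close>.\<close>

definition exp_tri_d :: "real \<Rightarrow> real \<Rightarrow> real" where
  "exp_tri_d a b = integral {0..1} (\<lambda>u. (1 - u) * u * exp (a * u) * exp_edge (b * (1 - u)))"

lemma DERIV_exp_tri_left: "((\<lambda>a. exp_tri a b) has_real_derivative exp_tri_d a b) (at a)"
  unfolding exp_tri_iterated exp_tri_d_def interval_cbox
  by (rule leibniz_rule_field_derivative)
     (auto intro!: derivative_eq_intros integrable_continuous_real continuous_intros simp: case_prod_unfold)

lemma DERIV_exp_tri_right: "(exp_tri a has_real_derivative exp_tri_d b a) (at b)"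
  proof -
  have "exp_tri a = (\<lambda>b. exp_tri b a)" by (rule ext) (rule exp_tri_commute)
  thus ?thesis using DERIV_exp_tri_left[of a b] by simp
qed

lemma continuous_on_exp_tri_d: "continuous_on A (\<lambda>z. exp_tri_d (fst z) (snd z))"
  unfolding exp_tri_d_def interval_cbox
  by (rule integral_continuous_on_param) (auto intro!: continuous_intros simp: case_prod_unfold)

lemma has_derivative_exp_tri:
  "((\<lambda>(a, b). exp_tri a b) has_derivative (\<lambda>(ta, tb). exp_tri_d a b * ta + exp_tri_d b a * tb)) (at (a, b))"
proof -
  have "((\<lambda>(a, b). exp_tri a b) has_derivative
    (\<lambda>(ta, tb). exp_tri_d a b * ta + blinfun_apply (blinfun_mult_right (exp_tri_d b a)) tb)) (at (a, b) within UNIV \<times> UNIV)"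
  proof (rule has_derivative_partialsI)
    show "((\<lambda>x. exp_tri x b) has_derivative (*) (exp_tri_d a b)) (at a within UNIV)"
      using DERIV_exp_tri_left has_field_derivative_def by blast
    show "((\<lambda>y. exp_tri x y) has_derivative blinfun_apply (blinfun_mult_right (exp_tri_d y x))) (at y within UNIV)" for x y
      using DERIV_exp_tri_right[of x y] by (simp add: has_field_derivative_def blinfun_mult_right.rep_eq)
    have "continuous_on UNIV (\<lambda>z. blinfun_mult_right (exp_tri_d (snd z) (fst z)) :: real \<Rightarrow>\<^sub>L real)"
    proof (intro bounded_linear.continuous_on[OF bounded_linear_blinfun_mult_right])
      have "continuous_on UNIV (\<lambda>z::real\<times>real. (snd z, fst z))" by (intro continuous_intros)
      from continuous_on_compose2[OF continuous_on_exp_tri_d[of UNIV] this]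
      show "continuous_on UNIV (\<lambda>z. exp_tri_d (snd z) (fst z))" by simp
    qed
    thus "continuous (at (a, b) within UNIV \<times> UNIV) (\<lambda>(x, y). blinfun_mult_right (exp_tri_d y x) :: real \<Rightarrow>\<^sub>L real)"
      by (simp add: case_prod_unfold continuous_on_eq_continuous_at)
  qed auto
  thus ?thesis by (simp add: blinfun_mult_right.rep_eq)
qed

section \<open>Fields continuously differentiable up to the boundary\<close>

text \<open>Continuity is required of each directional derivative and not of an operator-valued map
  as in \<open>C1_on\<close>. Closure under products, quotients and compositions then needs no
  construction of bounded operators, and this is the form that the divergence theorem
  consumes.\<close>

definition C1_within :: "'a::real_normed_vector set \<Rightarrow> ('a \<Rightarrow> 'b::real_normed_vector) \<Rightarrow> bool" where
  "C1_within S f \<longleftrightarrow> (\<exists>f'. (\<forall>y\<in>S. (f has_derivative f' y) (at y within S)) \<and>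
     (\<forall>h. continuous_on S (\<lambda>y. f' y h)))"

lemma C1_withinI:
  assumes "\<And>y. y \<in> S \<Longrightarrow> (f has_derivative f' y) (at y within S)" "\<And>h. continuous_on S (\<lambda>y. f' y h)"
  shows "C1_within S f"
  using assms unfolding C1_within_def by blast

lemma C1_withinE:
  assumes "C1_within S f"
  obtains f' where "\<And>y. y \<in> S \<Longrightarrow> (f has_derivative f' y) (at y within S)" "\<And>h. continuous_on S (\<lambda>y. f' y h)"
  using assms unfolding C1_within_def by blast

lemma C1_within_continuous_on: "C1_within S f \<Longrightarrow> continuous_on S f"
  by (metis C1_withinE continuous_on_eq_continuous_within has_derivative_continuous)

lemma C1_within_cong:
  assumes "C1_within S f" "\<And>y. y \<in> S \<Longrightarrow> g y = f y"
  shows "C1_within S g"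
  using assms(1) by (elim C1_withinE) (auto intro!: C1_withinI intro: has_derivative_transform assms(2))

lemma C1_within_const: "C1_within S (\<lambda>_. c)"
  by (rule C1_withinI[where f' = "\<lambda>_ _. 0"]) auto

lemma C1_within_linear:
  assumes "bounded_linear L" "C1_within S f"
  shows "C1_within S (\<lambda>y. L (f y))"
  using assms(2)
proof (elim C1_withinE)
  fix f' assume "\<And>y. y \<in> S \<Longrightarrow> (f has_derivative f' y) (at y within S)" "\<And>h. continuous_on S (\<lambda>y. f' y h)"
  thus ?thesis
    by (intro C1_withinI[where f' = "\<lambda>y h. L (f' y h)"] bounded_linear.has_derivative[OF assms(1)]
       bounded_linear.continuous_on[OF assms(1)])
qed

lemma C1_within_id: "C1_within S (\<lambda>y. y)"
  by (rule C1_withinI[where f' = "\<lambda>_ h. h"]) auto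

lemma C1_within_add:
  assumes "C1_within S f" "C1_within S g"
  shows "C1_within S (\<lambda>y. f y + g y)"
  using assms
proof (elim C1_withinE)
  fix f' g' assume "\<And>y. y \<in> S \<Longrightarrow> (f has_derivative f' y) (at y within S)" "\<And>h. continuous_on S (\<lambda>y. f' y h)"
    "\<And>y. y \<in> S \<Longrightarrow> (g has_derivative g' y) (at y within S)" "\<And>h. continuous_on S (\<lambda>y. g' y h)"
  thus ?thesis
    by (intro C1_withinI[where f' = "\<lambda>y h. f' y h + g' y h"] has_derivative_add continuous_on_add)
qed

lemma C1_within_diff:
  assumes "C1_within S f" "C1_within S g"
  shows "C1_within S (\<lambda>y. f y - g y)"
  using C1_within_add[OF assms(1) C1_within_linear[OF bounded_linear_minus[OF bounded_linear_ident] assms(2)]] by simp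

lemma C1_within_mult:
  fixes f g :: "'a::real_normed_vector \<Rightarrow> real"
  assumes "C1_within S f" "C1_within S g"
  shows "C1_within S (\<lambda>y. f y * g y)"
proof -
  note c = assms[THEN C1_within_continuous_on]
  show ?thesis using assms
  proof (elim C1_withinE)
    fix f' g' assume "\<And>y. y \<in> S \<Longrightarrow> (f has_derivative f' y) (at y within S)" "\<And>h. continuous_on S (\<lambda>y. f' y h)"
      "\<And>y. y \<in> S \<Longrightarrow> (g has_derivative g' y) (at y within S)" "\<And>h. continuous_on S (\<lambda>y. g' y h)"
    thus ?thesis
      by (intro C1_withinI[where f' = "\<lambda>y h. f y * g' y h + f' y h * g y"] has_derivative_mult continuous_intros c)
  qed
qed

lemma C1_within_sum:
  assumes "\<And>i. i \<in> I \<Longrightarrow> C1_within S (f i)"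
  shows "C1_within S (\<lambda>y. \<Sum>i\<in>I. f i y)"
  using assms by (induction I rule: infinite_finite_induct) (auto intro: C1_within_const C1_within_add)

lemma C1_within_prod:
  fixes f :: "'i \<Rightarrow> 'a::real_normed_vector \<Rightarrow> real"
  assumes "\<And>i. i \<in> I \<Longrightarrow> C1_within S (f i)"
  shows "C1_within S (\<lambda>y. \<Prod>i\<in>I. f i y)"
  using assms by (induction I rule: infinite_finite_induct) (auto intro: C1_within_const C1_within_mult)

lemma C1_within_real_compose:
  fixes f :: "'a::real_normed_vector \<Rightarrow> real"
  assumes "C1_within S f"
    and g: "\<And>y. y \<in> S \<Longrightarrow> (g has_real_derivative g' (f y)) (at (f y))" and g': "continuous_on (f ` S) g'"
  shows "C1_within S (\<lambda>y. g (f y))"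
proof -
  note c = assms(1)[THEN C1_within_continuous_on]
  show ?thesis using assms(1)
  proof (elim C1_withinE)
    fix f' assume f': "\<And>y. y \<in> S \<Longrightarrow> (f has_derivative f' y) (at y within S)" "\<And>h. continuous_on S (\<lambda>y. f' y h)"
    show ?thesis
    proof (rule C1_withinI[where f' = "\<lambda>y h. g' (f y) * f' y h"])
      show "((\<lambda>y. g (f y)) has_derivative (\<lambda>h. g' (f y) * f' y h)) (at y within S)" if "y \<in> S" for y
        using has_derivative_compose[OF f'(1)[OF that], of g "(*) (g' (f y))"] g[OF that]
        by (simp add: has_field_derivative_def)
      show "continuous_on S (\<lambda>y. g' (f y) * f' y h)" for h
        by (intro continuous_on_mult f'(2) continuous_on_compose2[OF g' c]) auto
    qed
  qed
qed

lemma C1_within_exp: "C1_within S f \<Longrightarrow> C1_within S (\<lambda>y. exp (f y :: real))"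
  by (rule C1_within_real_compose[where g' = exp]) auto

lemma C1_within_exp_edge: "C1_within S f \<Longrightarrow> C1_within S (\<lambda>y. exp_edge (f y))"
  by (rule C1_within_real_compose[where g' = "\<lambda>a. integral {0..1} (\<lambda>t. t * exp (a * t))"])
     (auto intro: continuous_on_exp_edge' DERIV_exp_edge)

lemma C1_within_inverse:
  assumes "C1_within S f" "\<And>y. y \<in> S \<Longrightarrow> f y \<noteq> (0::real)"
  shows "C1_within S (\<lambda>y. inverse (f y))"
  by (rule C1_within_real_compose[OF assms(1), where g' = "\<lambda>z. - (inverse z * inverse z)"])
     (use assms(2) in \<open>auto intro!: derivative_eq_intros continuous_intros simp: divide_inverse\<close>)

lemma C1_within_divide:
  assumes "C1_within S f" "C1_within S g" "\<And>y. y \<in> S \<Longrightarrow> g y \<noteq> (0::real)"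
  shows "C1_within S (\<lambda>y. f y / g y)"
  using C1_within_mult[OF assms(1) C1_within_inverse[OF assms(2,3)]] by (simp add: divide_inverse)

lemma C1_within_exp_tri:
  assumes "C1_within S f" "C1_within S g"
  shows "C1_within S (\<lambda>y. exp_tri (f y) (g y))"
proof -
  note c = assms[THEN C1_within_continuous_on]
  show ?thesis using assms
  proof (elim C1_withinE)
    fix f' g' assume d: "\<And>y. y \<in> S \<Longrightarrow> (f has_derivative f' y) (at y within S)" "\<And>h. continuous_on S (\<lambda>y. f' y h)"
      "\<And>y. y \<in> S \<Longrightarrow> (g has_derivative g' y) (at y within S)" "\<And>h. continuous_on S (\<lambda>y. g' y h)"
    show ?thesis
    proof (rule C1_withinI[where f' = "\<lambda>y h. exp_tri_d (f y) (g y) * f' y h + exp_tri_d (g y) (f y) * g' y h"])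
      show "((\<lambda>y. exp_tri (f y) (g y)) has_derivative
         (\<lambda>h. exp_tri_d (f y) (g y) * f' y h + exp_tri_d (g y) (f y) * g' y h)) (at y within S)" if "y \<in> S" for y
        using has_derivative_compose[OF has_derivative_Pair[OF d(1)[OF that] d(3)[OF that]] has_derivative_exp_tri]
        by simp
      have "continuous_on S (\<lambda>y. exp_tri_d (f y) (g y))" "continuous_on S (\<lambda>y. exp_tri_d (g y) (f y))"
        using continuous_on_compose2[OF continuous_on_exp_tri_d[of UNIV] continuous_on_Pair[OF c]]
          continuous_on_compose2[OF continuous_on_exp_tri_d[of UNIV] continuous_on_Pair[OF c(2,1)]] by auto
      thus "continuous_on S (\<lambda>y. exp_tri_d (f y) (g y) * f' y h + exp_tri_d (g y) (f y) * g' y h)" for h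
        by (intro continuous_intros d)
    qed
  qed
qed

lemma C1_within_det:
  fixes A :: "'a::real_normed_vector \<Rightarrow> real^'n^'n"
  assumes "\<And>i j. C1_within S (\<lambda>y. A y $ i $ j)"
  shows "C1_within S (\<lambda>y. det (A y))"
  unfolding det_def by (intro C1_within_sum C1_within_mult C1_within_const C1_within_prod assms)

lemma C1_within_nth: "C1_within S f \<Longrightarrow> C1_within S (\<lambda>y. f y $ i)"
  by (rule C1_within_linear[OF bounded_linear_vec_nth])

lemma C1_within_vec:
  fixes f :: "'a::real_normed_vector \<Rightarrow> real^'n"
  assumes "\<And>i. C1_within S (\<lambda>y. f y $ i)"
  shows "C1_within S f"
proof -
  have "C1_within S (\<lambda>y. \<Sum>i\<in>UNIV. (f y $ i) *\<^sub>R axis i 1)"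
    by (intro C1_within_sum C1_within_linear[OF bounded_linear_scaleR_left assms])
  moreover have "f y = (\<Sum>i\<in>UNIV. (f y $ i) *\<^sub>R axis i 1)" for y
    using basis_expansion[of "f y"] by (simp add: scalar_mult_eq_scaleR)
  ultimately show ?thesis by (rule C1_within_cong)
qed

lemma C1_within_inner:
  fixes f g :: "'a::real_normed_vector \<Rightarrow> real^'n"
  assumes "C1_within S f" "C1_within S g"
  shows "C1_within S (\<lambda>y. f y \<bullet> g y)"
  unfolding inner_vec_def inner_real_def
  by (intro C1_within_sum C1_within_mult C1_within_nth assms)

lemma C1_within_cross3:
  assumes "C1_within S f" "C1_within S g"
  shows "C1_within S (\<lambda>y. cross3 (f y) (g y))"
proof (rule C1_within_vec)
  show "C1_within S (\<lambda>y. cross3 (f y) (g y) $ i)" for i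
    using exhaust_3[of i]
    by (elim disjE; simp add: cross3_def vector_3; intro C1_within_diff C1_within_mult C1_within_nth assms)
qed

lemma C1_on_imp_C1_within:
  assumes "C1_on T f"
  shows "C1_within T f"
proof -
  obtain D where D: "\<And>y. y \<in> T \<Longrightarrow> (f has_derivative blinfun_apply (D y)) (at y within T)" "continuous_on T D"
    using assms unfolding C1_on_def by blast
  show ?thesis by (rule C1_withinI[OF D(1)]) (auto intro!: continuous_intros D(2))
qed

lemma edge_eqs_C1_within:
  assumes x: "tet_vertices x T" and b: "C1_within T b"
    and eq: "\<And>y. y \<in> T \<Longrightarrow> \<exists>J. edge_eqs (b y) x y J (w y) c"
  shows "C1_within T w"
proof (rule C1_within_vec)
  fix k
  let ?A = "\<lambda>y. edge_matrix (b y) x y"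
  \<comment> \<open>The matrix of Cramer's rule for the \<open>k\<close>-th component of \<phi>: the
    column \<open>Inr k\<close> is replaced by the right-hand side.\<close>
  let ?M = "\<lambda>y. (\<chi> i j. if j = Inr k then edge_rhs (b y) x c y $ i else ?A y $ i $ j) :: real^(3+3)^(3+3)"
  have A: "C1_within T (\<lambda>y. ?A y $ i $ j)" for i j
    unfolding edge_matrix_def Let_def vec_lambda_beta
    by (cases j) (auto intro!: C1_within_diff C1_within_mult C1_within_exp_tri C1_within_exp_edge
      C1_within_inner C1_within_nth C1_within_cross3 b C1_within_const C1_within_id)
  have r: "C1_within T (\<lambda>y. edge_rhs (b y) x c y $ i)" for i
    unfolding edge_rhs_def Let_def vec_lambda_beta
    by (intro C1_within_diff C1_within_mult C1_within_exp_edge C1_within_exp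
      C1_within_inner b C1_within_const C1_within_id)
  have "C1_within T (\<lambda>y. det (?M y) / det (?A y))"
  proof (intro C1_within_divide C1_within_det A det_edge_matrix[OF x])
    show "C1_within T (\<lambda>y. ?M y $ i $ j)" for i j
      using A r by (cases "j = Inr k") auto
  qed
  moreover have "w y $ k = det (?M y) / det (?A y)" if y: "y \<in> T" for y
  proof -
    obtain J where "edge_eqs (b y) x y J (w y) c" using eq[OF y] by blast
    hence "join_vec J (w y) $ Inr k = det (?M y) / det (?A y)"
      unfolding edge_eqs_matrix cramer[OF det_edge_matrix[OF x y]] by simp
    thus ?thesis by (simp add: join_vec_def)
  qed
  ultimately show "C1_within T (\<lambda>y. w y $ k)" by (rule C1_within_cong)
qed

section \<open>The divergence theorem on a tetrahedron\<close>

lemma std_tet_image: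
  fixes p :: "'a::real_vector"
  shows "(\<lambda>x. p + x$1 *\<^sub>R (q - p) + x$2 *\<^sub>R (r - p) + x$3 *\<^sub>R (s - p)) ` std_tet = convex hull {p, q, r, s}"
proof safe
  fix x assume "x \<in> std_tet"
  thus "p + x$1 *\<^sub>R (q - p) + x$2 *\<^sub>R (r - p) + x$3 *\<^sub>R (s - p) \<in> convex hull {p, q, r, s}"
    by (intro in_convex_hull_4) (auto simp: std_tet_def)
next
  fix y assume "y \<in> convex hull {p, q, r, s}"
  then obtain a b c d where abcd: "0 \<le> a" "0 \<le> b" "0 \<le> c" "0 \<le> d" "a + b + c + d = 1"
    "y = a *\<^sub>R p + b *\<^sub>R q + c *\<^sub>R r + d *\<^sub>R s" by (rule convex_hull_4E)
  have a: "a = 1 - b - c - d" using abcd(5) by simp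
  have "y = p + b *\<^sub>R (q - p) + c *\<^sub>R (r - p) + d *\<^sub>R (s - p)"
    unfolding abcd(6) a by (simp add: algebra_simps)
  moreover have "vector [b, c, d] \<in> std_tet" using abcd by (simp add: std_tet_def vector_3)
  ultimately show "y \<in> (\<lambda>x. p + x$1 *\<^sub>R (q - p) + x$2 *\<^sub>R (r - p) + x$3 *\<^sub>R (s - p)) ` std_tet"
    by (intro image_eqI[of _ _ "vector [b, c, d]"]) (auto simp: vector_3)
qed

lemma integral_tet_mean:
  fixes p :: "real^3" and f :: "real^3 \<Rightarrow> real"
  defines "D \<equiv> (\<lambda>p q r s :: real^3. (q - p) \<bullet> cross3 (r - p) (s - p))"
  assumes D: "D p q r s \<noteq> 0" and f: "continuous_on (convex hull {p, q, r, s}) f"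
  shows "integral (convex hull {p, q, r, s}) f = \<bar>D p q r s\<bar> * mean_tet p q r s f"
proof -
  let ?T = "convex hull {p, q, r, s}"
  let ?L = "\<lambda>x::real^3. x$1 *\<^sub>R (q - p) + x$2 *\<^sub>R (r - p) + x$3 *\<^sub>R (s - p)"
  let ?g = "\<lambda>x::real^3. p + x$1 *\<^sub>R (q - p) + x$2 *\<^sub>R (r - p) + x$3 *\<^sub>R (s - p)"
  \<comment> \<open>The change of variables theorem is applied to functions with values in a
    Cartesian space, so the scalar integrand is wrapped into \<open>real^1\<close> and read off
    again by its component.\<close>
  let ?f = "\<lambda>x. vec (f x) :: real^1"
  have lin: "linear ?L" by (intro linearI) (auto simp: algebra_simps)
  have det: "det (matrix ?L) = D p q r s"
    by (simp add: det_3 matrix_def axis_def D_def inner_vec_def sum_3 cross3_def vector_3 algebra_simps)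
  have T: "compact ?T" by (intro finite_imp_compact_convex_hull) auto
  have "inj ?L"
    using det_nz_iff_inj[OF lin] det D by simp
  moreover have gL: "?g = (\<lambda>x. p + ?L x)" by (simp only: add.assoc)
  ultimately have inj: "inj_on ?g std_tet"
    unfolding gL by (intro inj_onI) (simp only: add_left_cancel, erule injD)
  have der: "(?g has_derivative ?L) (at x within std_tet)" for x
    unfolding gL using has_derivative_add[OF has_derivative_const linear_imp_has_derivative[OF lin], of p]
    by (simp only: add_0_left)
  have ai: "?f absolutely_integrable_on ?T"
  proof -
    have "continuous_on ?T ?f" unfolding vec_def by (intro continuous_on_vec_lambda f)
    hence "integrable lborel (\<lambda>x. indicator ?T x *\<^sub>R ?f x)" by (rule borel_integrable_compact[OF T])
    thus ?thesis
      unfolding set_integrable_def by (subst integrable_completion) (auto dest: borel_measurable_integrable)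
  qed
  have "integral std_tet (\<lambda>x. \<bar>det (matrix ?L)\<bar> *\<^sub>R ?f (?g x)) = integral ?T ?f
     \<and> (\<lambda>x. \<bar>det (matrix ?L)\<bar> *\<^sub>R ?f (?g x)) absolutely_integrable_on std_tet"
    using has_absolute_integral_change_of_variables[OF _ der inj, of ?f "integral ?T ?f"] ai
    by (simp add: std_tet_image lmeasurable_compact fmeasurableD)
  hence 1: "integral std_tet (\<lambda>x. \<bar>det (matrix ?L)\<bar> *\<^sub>R ?f (?g x)) = integral ?T ?f"
    and 2: "(\<lambda>x. \<bar>det (matrix ?L)\<bar> *\<^sub>R ?f (?g x)) integrable_on std_tet"
    using set_lebesgue_integral_eq_integral(1) by blast+
  have 3: "?f integrable_on ?T" using ai set_lebesgue_integral_eq_integral(1) by blast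
  have "integral ?T f = integral ?T (\<lambda>x. ?f x $ 1)" by simp
  also have "\<dots> = integral ?T ?f $ 1" by (rule integral_component_eq_cart[OF 3])
  also have "\<dots> = integral std_tet (\<lambda>x. (\<bar>det (matrix ?L)\<bar> *\<^sub>R ?f (?g x)) $ 1)"
    unfolding 1[symmetric] by (rule integral_component_eq_cart[OF 2, symmetric])
  also have "\<dots> = \<bar>D p q r s\<bar> * mean_tet p q r s f" unfolding mean_tet_def det by simp
  finally show ?thesis .
qed

text \<open>The apex \<open>z\<close> orients the triangle: the normal points towards \<open>z\<close>.\<close>

definition tri_flux :: "real^3 \<Rightarrow> real^3 \<Rightarrow> real^3 \<Rightarrow> real^3 \<Rightarrow> (real^3 \<Rightarrow> real^3) \<Rightarrow> real" where
  "tri_flux p q r z G =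
     sgn (cross3 (q - p) (r - p) \<bullet> (z - p)) * mean_tri p q r (\<lambda>y. cross3 (q - p) (r - p) \<bullet> G y)"

text \<open>Exchanging two vertices reverses the normal, which flips both the sign factor and the
  integrand.\<close>

lemma tri_flux_perm:
  assumes G: "continuous_on (convex hull {p, q, r}) G"
  shows "tri_flux p r q z G = tri_flux p q r z G" "tri_flux r q p z G = tri_flux p q r z G"
proof -
  let ?N = "cross3 (q - p) (r - p)"
  have 1: "cross3 (r - p) (q - p) = - ?N" "cross3 (q - r) (p - r) = - ?N" "?N \<bullet> (z - r) = ?N \<bullet> (z - p)"
    by (simp_all add: inner_vec_def cross3_def sum_3 vector_3 vec_eq_iff forall_3 algebra_simps)
  have c: "continuous_on (convex hull {p, q, r}) (\<lambda>y. ?N \<bullet> G y)" by (intro continuous_intros G)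
  have m: "mean_tri a b c (\<lambda>y. - (?N \<bullet> G y)) = - mean_tri a b c (\<lambda>y. ?N \<bullet> G y)" for a b c
    using mean_tri_cmult[of a b c "-1" "\<lambda>y. ?N \<bullet> G y"] by simp
  show "tri_flux p r q z G = tri_flux p q r z G" "tri_flux r q p z G = tri_flux p q r z G"
    unfolding tri_flux_def 1 by (simp_all add: 1 m sgn_minus mean_tri_swap[OF c] mean_tri_reverse[OF c])
qed

text \<open>The divergence is written through the derivatives along the three edges at
  \<open>p\<close>, and \<open>mean_tet_derivative\<close> turns each of these into a difference of
  two facet means. The minus sign arises because \<open>tri_flux\<close> uses the normal towards the
  opposite vertex, that is, the inward one.\<close>

theorem tet_divergence_theorem:
  fixes G :: "real^3 \<Rightarrow> real^3"
  defines "D \<equiv> (\<lambda>p q r s :: real^3. (q - p) \<bullet> cross3 (r - p) (s - p))"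
    and "T \<equiv> (\<lambda>p q r s :: real^3. convex hull {p, q, r, s})"
  assumes D: "D p q r s \<noteq> 0"
    and der: "\<And>y. y \<in> T p q r s \<Longrightarrow> (G has_derivative G' y) (at y within T p q r s)"
    and cont: "\<And>h. continuous_on (T p q r s) (\<lambda>y. G' y h)"
  shows "integral (T p q r s) (\<lambda>y. \<Sum>i\<in>UNIV. G' y (axis i 1) $ i) =
    - (tri_flux q r s p G + tri_flux p r s q G + tri_flux p q s r G + tri_flux p q r s G)"
proof -
  let ?K = "T p q r s"
  define e1 e2 e3 where "e1 = q - p" and "e2 = r - p" and "e3 = s - p"
  let ?n1 = "cross3 e2 e3" and ?n2 = "cross3 e3 e1" and ?n3 = "cross3 e1 e2"
  let ?dv = "\<lambda>y. \<Sum>i\<in>UNIV. G' y (axis i 1) $ i"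
  have cG: "continuous_on ?K G"
    using der has_derivative_continuous continuous_on_eq_continuous_within by blast
  have K: "convex hull {p, r, s, q} = ?K" "convex hull {p, s, q, r} = ?K" "convex hull {p, q, s, r} = ?K"
     "convex hull {p, s, r, q} = ?K" "convex hull {p, r, q, s} = ?K" "convex hull {p, s, q, r} = ?K"
    by (simp_all add: T_def insert_commute)
  have sub: "A \<subseteq> {p, q, r, s} \<Longrightarrow> convex hull A \<subseteq> ?K" for A unfolding T_def by (rule hull_mono)
  have cK: "continuous_on (convex hull A) f" if "continuous_on ?K f" "A \<subseteq> {p, q, r, s}" for A and f :: "real^3 \<Rightarrow> real"
    using continuous_on_subset that sub by blast
  have ib: "bounded_linear (\<lambda>v. n \<bullet> v)" for n :: "real^3" by (rule bounded_linear_inner_right)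
  have d: "((\<lambda>y. n \<bullet> G y) has_derivative (\<lambda>h. n \<bullet> G' y h)) (at y within ?K)" if "y \<in> ?K" for n y
    by (rule bounded_linear.has_derivative[OF ib der[OF that]])
  have cn: "continuous_on ?K (\<lambda>y. n \<bullet> G' y h)" for n h by (intro continuous_intros cont)
  have cg: "continuous_on ?K (\<lambda>y. n \<bullet> G y)" for n by (intro continuous_intros cG)
  have m3: "mean_tet p q r s (\<lambda>y. ?n3 \<bullet> G' y e3) = mean_tri s q r (\<lambda>y. ?n3 \<bullet> G y) - mean_tri p q r (\<lambda>y. ?n3 \<bullet> G y)"
    unfolding e3_def
    by (rule mean_tet_derivative[where g' = "\<lambda>y h. _ \<bullet> G' y h"]) (use d cn in \<open>simp_all add: T_def\<close>)
  have m1: "mean_tet p r s q (\<lambda>y. ?n1 \<bullet> G' y e1) = mean_tri q r s (\<lambda>y. ?n1 \<bullet> G y) - mean_tri p r s (\<lambda>y. ?n1 \<bullet> G y)"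
    unfolding e1_def
    by (rule mean_tet_derivative[where g' = "\<lambda>y h. _ \<bullet> G' y h"]) (use d cn in \<open>simp_all add: K\<close>)
  have m2: "mean_tet p s q r (\<lambda>y. ?n2 \<bullet> G' y e2) = mean_tri r s q (\<lambda>y. ?n2 \<bullet> G y) - mean_tri p s q (\<lambda>y. ?n2 \<bullet> G y)"
    unfolding e2_def
    by (rule mean_tet_derivative[where g' = "\<lambda>y h. _ \<bullet> G' y h"]) (use d cn in \<open>simp_all add: K\<close>)
  have p1: "mean_tet p r s q f = mean_tet p q r s f" "mean_tet p s q r f = mean_tet p q r s f"
    if "continuous_on ?K f" for f
    using mean_tet_swap[of p r q s f] mean_tet_swap[of p q r s f] mean_tet_swap[of p q s r f] that
    by (simp_all add: K T_def[symmetric])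
  have t: "mean_tri r s q f = mean_tri q r s f" "mean_tri s q r f = mean_tri q r s f" "mean_tri p s q f = mean_tri p q s f"
    if "continuous_on ?K f" for f
    using mean_tri_swap[OF cK[OF that], of q r s] mean_tri_reverse[OF cK[OF that], of q r s]
      mean_tri_swap[OF cK[OF that], of r q s] mean_tri_reverse[OF cK[OF that], of q s r]
      mean_tri_swap[OF cK[OF that], of p q s] mean_tri_swap[OF cK[OF that], of s q r] by simp_all
  have lin: "linear (G' y)" if "y \<in> ?K" for y using der[OF that] has_derivative_linear by blast
  \<comment> \<open>Divided by \<open>D\<close>, the vectors \<open>?n1\<close>, \<open>?n2\<close>,
    \<open>?n3\<close> form the basis dual to \<open>e1\<close>, \<open>e2\<close>,
    \<open>e3\<close>, and the trace of a linear map can be computed with any pair of dual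
    bases.\<close>
  have dv: "D p q r s * ?dv y = (?n1 \<bullet> G' y e1 + ?n2 \<bullet> G' y e2) + ?n3 \<bullet> G' y e3" if "y \<in> ?K" for y
  proof -
    have ex: "G' y e = e$1 *\<^sub>R G' y (axis 1 1) + e$2 *\<^sub>R G' y (axis 2 1) + e$3 *\<^sub>R G' y (axis 3 1)" for e
    proof -
      have "e = e$1 *\<^sub>R axis 1 1 + e$2 *\<^sub>R axis 2 1 + e$3 *\<^sub>R axis 3 1"
        by (simp add: vec_eq_iff forall_3 axis_def)
      hence "G' y e = G' y (e$1 *\<^sub>R axis 1 1 + e$2 *\<^sub>R axis 2 1 + e$3 *\<^sub>R axis 3 1)" by simp
      thus ?thesis by (simp add: linear_add[OF lin[OF that]] linear_scale[OF lin[OF that]])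
    qed
    show ?thesis
      unfolding ex[of e1] ex[of e2] ex[of e3] D_def e1_def[symmetric] e2_def[symmetric] e3_def[symmetric]
      by (simp add: inner_vec_def cross3_def sum_3 vector_3) algebra
  qed
  have cdv: "continuous_on ?K ?dv" by (intro continuous_intros cont)
  have "D p q r s * mean_tet p q r s ?dv = mean_tet p q r s (\<lambda>y. D p q r s * ?dv y)"
    by (rule mean_tet_cmult[symmetric])
  also have "\<dots> = mean_tet p q r s (\<lambda>y. (?n1 \<bullet> G' y e1 + ?n2 \<bullet> G' y e2) + ?n3 \<bullet> G' y e3)"
    unfolding mean_tet_def
    by (rule Henstock_Kurzweil_Integration.integral_cong)
       (use dv in \<open>auto simp: T_def std_tet_def intro!: in_convex_hull_4\<close>)
  also have "\<dots> = mean_tet p q r s (\<lambda>y. ?n1 \<bullet> G' y e1) + mean_tet p q r s (\<lambda>y. ?n2 \<bullet> G' y e2)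
       + mean_tet p q r s (\<lambda>y. ?n3 \<bullet> G' y e3)"
    using cn by (simp add: mean_tet_add continuous_on_add T_def)
  also have "\<dots> = (mean_tri q r s (\<lambda>y. ?n1 \<bullet> G y) + mean_tri q r s (\<lambda>y. ?n2 \<bullet> G y) + mean_tri q r s (\<lambda>y. ?n3 \<bullet> G y))
      - mean_tri p r s (\<lambda>y. ?n1 \<bullet> G y) - mean_tri p q s (\<lambda>y. ?n2 \<bullet> G y) - mean_tri p q r (\<lambda>y. ?n3 \<bullet> G y)"
    using m1 m2 m3 p1[OF cn] t[OF cg] by simp
  \<comment> \<open>All three sweeps end on the facet opposite \<open>p\<close>; the three vector
    areas add up to that of this facet.\<close>
  also have "mean_tri q r s (\<lambda>y. ?n1 \<bullet> G y) + mean_tri q r s (\<lambda>y. ?n2 \<bullet> G y) + mean_tri q r s (\<lambda>y. ?n3 \<bullet> G y)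
      = mean_tri q r s (\<lambda>y. cross3 (r - q) (s - q) \<bullet> G y)"
  proof -
    have "?n1 + ?n2 + ?n3 = cross3 (r - q) (s - q)"
      by (simp add: e1_def e2_def e3_def cross3_def vector_3 vec_eq_iff forall_3 algebra_simps)
    thus ?thesis
      by (simp add: mean_tri_add[symmetric] cK[OF cg] continuous_on_add inner_add_left[symmetric])
  qed
  finally have main: "D p q r s * mean_tet p q r s ?dv = mean_tri q r s (\<lambda>y. cross3 (r - q) (s - q) \<bullet> G y)
      - mean_tri p r s (\<lambda>y. ?n1 \<bullet> G y) - mean_tri p q s (\<lambda>y. ?n2 \<bullet> G y) - mean_tri p q r (\<lambda>y. ?n3 \<bullet> G y)" .
  have "integral ?K ?dv = \<bar>D p q r s\<bar> * mean_tet p q r s ?dv"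
    using integral_tet_mean[where p = p and q = q and r = r and s = s and f = ?dv] D cdv unfolding D_def T_def by blast
  also have "\<dots> = sgn (D p q r s) * (D p q r s * mean_tet p q r s ?dv)" by (simp add: abs_sgn)
  also have "\<dots> = - (tri_flux q r s p G + tri_flux p r s q G + tri_flux p q s r G + tri_flux p q r s G)"
  proof -
    have f1: "tri_flux q r s p G = - sgn (D p q r s) * mean_tri q r s (\<lambda>y. cross3 (r - q) (s - q) \<bullet> G y)"
    proof -
      have "cross3 (r - q) (s - q) \<bullet> (p - q) = - D p q r s"
        by (simp add: D_def inner_vec_def cross3_def sum_3 vector_3 algebra_simps)
      thus ?thesis by (simp add: tri_flux_def sgn_minus)
    qed
    have f2: "tri_flux p r s q G = sgn (D p q r s) * mean_tri p r s (\<lambda>y. ?n1 \<bullet> G y)"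
      by (simp add: tri_flux_def D_def e1_def e2_def e3_def inner_commute)
    have f4: "tri_flux p q r s G = sgn (D p q r s) * mean_tri p q r (\<lambda>y. ?n3 \<bullet> G y)"
    proof -
      have "cross3 (q - p) (r - p) \<bullet> (s - p) = D p q r s"
        by (simp add: D_def inner_vec_def cross3_def sum_3 vector_3 algebra_simps)
      thus ?thesis by (simp add: tri_flux_def e1_def e2_def)
    qed
    have f3: "tri_flux p q s r G = sgn (D p q r s) * mean_tri p q s (\<lambda>y. ?n2 \<bullet> G y)"
    proof -
      have "cross3 (q - p) (s - p) \<bullet> (r - p) = - D p q r s"
        by (simp add: D_def inner_vec_def cross3_def sum_3 vector_3 algebra_simps)
      moreover have "cross3 (q - p) (s - p) = - ?n2"
        by (simp add: e1_def e3_def cross_skew[of "s - p"])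
      moreover have "mean_tri p q s (\<lambda>y. - (?n2 \<bullet> G y)) = - mean_tri p q s (\<lambda>y. ?n2 \<bullet> G y)"
        using mean_tri_cmult[of p q s "-1" "\<lambda>y. ?n2 \<bullet> G y"] by simp
      ultimately show ?thesis by (simp add: tri_flux_def sgn_minus)
    qed
    show ?thesis unfolding main f1 f2 f3 f4 by (simp add: algebra_simps)
  qed
  finally show ?thesis .
qed

section \<open>Facets of a mesh\<close>

text \<open>Vertices as points and not as labels: two elements with a common facet can be described
  by the same \<open>p, q, r\<close> and their own apex \<open>z\<close>, however each of them is
  labelled.\<close>

definition facet_rep :: "(real^3) set \<Rightarrow> (real^3) set \<Rightarrow> real^3 \<Rightarrow> real^3 \<Rightarrow> real^3 \<Rightarrow> real^3 \<Rightarrow> bool" where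
  "facet_rep F T p q r z \<longleftrightarrow> F = convex hull {p, q, r} \<and> T = convex hull {p, q, r, z} \<and>
     distinct [p, q, r, z] \<and> \<not> affine_dependent {p, q, r, z}"

lemma facet_rep_facet:
  assumes "facet_rep F T p q r z"
  shows "F facet_of T"
proof -
  have "F = convex hull ({p, q, r, z} - {z})" "F \<noteq> {}"
    using assms by (auto simp: facet_rep_def insert_Diff_if)
  thus ?thesis
    using assms unfolding facet_rep_def by (metis facet_of_convex_hull_affine_independent insertCI)
qed

lemma facet_rep_subset: "facet_rep F T p q r z \<Longrightarrow> F \<subseteq> T"
  by (simp add: facet_rep_facet facet_of_imp_subset)

lemma facet_rep_triple:
  assumes "facet_rep F T p q r z"
  shows "cross3 (q - p) (r - p) \<bullet> (z - p) \<noteq> 0" "cross3 (q - p) (r - p) \<noteq> 0"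
proof -
  have "cross3 (q - p) (r - p) \<bullet> (z - p) = (q - p) \<bullet> cross3 (r - p) (z - p)"
    by (simp add: inner_vec_def cross3_def sum_3 vector_3 algebra_simps)
  thus "cross3 (q - p) (r - p) \<bullet> (z - p) \<noteq> 0"
    using triple_neq_0[of p q r z] assms by (simp add: facet_rep_def)
  thus "cross3 (q - p) (r - p) \<noteq> 0" by auto
qed

lemma facet_rep_labels:
  assumes "tet_vertices x T" "s \<in> {1..4}"
  obtains k l m where "facet_rep (tet_facet x s) T (x k) (x l) (x m) (x s)" "{k, l, m} = {1..4} - {s}"
proof -
  obtain k l m where klm: "{1..4} - {s} = {k, l, m}" "{k, l, m, s} = {1..4}" "k < l" "l < m" "s \<notin> {k, l, m}"
    "distinct [k, l, m, s]" using assms(2) by (rule facet_labels)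
  show thesis
    using tet_vertices_points[OF assms(1) klm(6) klm(2)] tet_facet_eq[OF klm(1), of x] klm(1)
    by (intro that[of k l m]) (auto simp: facet_rep_def)
qed

lemma facets_of_tet:
  assumes "tet_vertices x T"
  shows "{F. F facet_of T} = tet_facet x ` {1..4}" "inj_on (tet_facet x) {1..4}"
proof -
  have x: "inj_on x {1..4}" "\<not> affine_dependent (x ` {1..4})" "T = convex hull (x ` {1..4})"
    using assms by (auto simp: tet_vertices_def)
  have im: "x ` {1..4} - {x s} = x ` ({1..4} - {s})" if "s \<in> {1..4}" for s
    using inj_on_image_set_diff[OF x(1), of "{1..4}" "{s}"] that by simp
  have ne: "x ` ({1..4} - {s}) \<noteq> {}" for s
  proof -
    have "(if s = 1 then 2 else 1) \<in> {1..4} - {s}" by auto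
    thus ?thesis by blast
  qed
  have "F facet_of T \<longleftrightarrow> (\<exists>s\<in>{1..4}. F = tet_facet x s)" for F
  proof -
    have "F facet_of T \<longleftrightarrow> F \<noteq> {} \<and> (\<exists>s\<in>{1..4}. F = convex hull (x ` {1..4} - {x s}))"
      unfolding x(3) facet_of_convex_hull_affine_independent[OF x(2)] by blast
    also have "\<dots> \<longleftrightarrow> F \<noteq> {} \<and> (\<exists>s\<in>{1..4}. F = tet_facet x s)"
      unfolding tet_facet_def by (intro conj_cong refl bex_cong) (simp only: im)
    also have "\<dots> \<longleftrightarrow> (\<exists>s\<in>{1..4}. F = tet_facet x s)"
      using ne unfolding tet_facet_def by (auto simp only: convex_hull_eq_empty)
    finally show ?thesis .
  qed
  thus "{F. F facet_of T} = tet_facet x ` {1..4}" by blast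
  show "inj_on (tet_facet x) {1..4}"
  proof (rule inj_onI)
    fix s t assume st: "s \<in> {1..4}" "t \<in> {1..4}" "tet_facet x s = tet_facet x t"
    have "\<not> affine_dependent (x ` ({1..4} - {u}))" for u
      by (rule contrapos_nn[OF x(2)]) (rule affine_dependent_subset, auto)
    hence "x ` ({1..4} - {s}) = x ` ({1..4} - {t})"
      using arg_cong[OF st(3), of "\<lambda>F. {v. v extreme_point_of F}"]
      by (simp add: tet_facet_def extreme_point_of_convex_hull_affine_independent)
    hence "{1..4} - {s} = {1..4} - {t}"
      using inj_on_image_eq_iff[OF x(1), of "{1..4} - {s}" "{1..4} - {t}"] by blast
    thus "s = t" using st by blast
  qed
qed

lemma facet_rep_exists:
  assumes "tet_vertices x T" "F facet_of T"
  obtains p q r z where "facet_rep F T p q r z"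
proof -
  from assms(2) facets_of_tet(1)[OF assms(1)] obtain s where "s \<in> {1..4}" "F = tet_facet x s" by blast
  thus thesis using that facet_rep_labels[OF assms(1)] by metis
qed

lemma facet_rep_vertices:
  assumes "facet_rep F T p q r z"
  shows "{v. v extreme_point_of F} = {p, q, r}" "{v. v extreme_point_of T} = {p, q, r, z}"
proof -
  have "\<not> affine_dependent {p, q, r, z}" using assms by (simp add: facet_rep_def)
  moreover hence "\<not> affine_dependent {p, q, r}"
    by (rule contrapos_nn) (rule affine_dependent_subset, auto)
  ultimately show "{v. v extreme_point_of F} = {p, q, r}" "{v. v extreme_point_of T} = {p, q, r, z}"
    using assms by (auto simp: facet_rep_def extreme_point_of_convex_hull_affine_independent)
qed

lemma facet_rep_vertices_eq:
  assumes "facet_rep F T p q r z" "facet_rep F T' p' q' r' z'"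
  shows "{p', q', r'} = {p, q, r}"
  using assms facet_rep_vertices(1) by metis

text \<open>The vertices of \<open>F\<close> are its extreme points and so do not depend on the
  element; only the apex does.\<close>

lemma facet_rep_transfer:
  assumes "facet_rep F T p q r z" "facet_rep F T' p' q' r' z'"
  shows "facet_rep F T' p q r z'"
proof -
  have "{p', q', r'} = {p, q, r}" by (rule facet_rep_vertices_eq[OF assms])
  hence "{p', q', r', z'} = {p, q, r, z'}" by blast
  thus ?thesis
    using assms \<open>{p', q', r'} = {p, q, r}\<close> unfolding facet_rep_def by auto
qed

lemma facet_rep_apex_eq:
  assumes "facet_rep F T p q r z" "facet_rep F T p' q' r' z'"
  shows "z' = z"
proof -
  have "{p', q', r'} = {p, q, r}" by (rule facet_rep_vertices_eq[OF assms])
  moreover have "{p', q', r', z'} = {p, q, r, z}"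
    using facet_rep_vertices(2)[OF assms(1)] facet_rep_vertices(2)[OF assms(2)] by simp
  moreover have "z \<notin> {p, q, r}" "z' \<notin> {p', q', r'}" using assms by (auto simp: facet_rep_def)
  ultimately show ?thesis by blast
qed

lemma tri_flux_set:
  assumes eq: "{p', q', r'} = {p, q, r}" and dist: "distinct [p', q', r']" "distinct [p, q, r]"
    and c: "continuous_on (convex hull {p, q, r}) G"
  shows "tri_flux p' q' r' z G = tri_flux p q r z G"
proof -
  have c': "continuous_on (convex hull {p, r, q}) G" "continuous_on (convex hull {r, q, p}) G"
      "continuous_on (convex hull {r, p, q}) G"
    using c by (simp_all add: insert_commute)
  note perm = tri_flux_perm[of p q r G z, OF c] tri_flux_perm(2)[of p r q G z, OF c'(1)]
    tri_flux_perm(1)[of r q p G z, OF c'(2)] tri_flux_perm(2)[of r p q G z, OF c'(3)]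
  have "(p', q', r') \<in> {(p, q, r), (p, r, q), (q, p, r), (q, r, p), (r, p, q), (r, q, p)}"
  proof -
    have "p' \<in> {p, q, r}" "q' \<in> {p, q, r}" "r' \<in> {p, q, r}" using eq by blast+
    thus ?thesis using dist by (elim insertE emptyE; simp)
  qed
  thus ?thesis by (elim insertE emptyE; simp add: perm)
qed

text \<open>For continuous \<open>G\<close> the choice is immaterial, as
  \<open>facet_flux_eq\<close> shows: the apex is determined by \<open>F\<close> and
  \<open>T\<close>, and \<open>tri_flux\<close> ignores the order of \<open>p, q, r\<close>. The
  element stays an argument because it decides the orientation.\<close>

definition facet_flux :: "(real^3) set \<Rightarrow> (real^3) set \<Rightarrow> (real^3 \<Rightarrow> real^3) \<Rightarrow> real" where
  "facet_flux T F G = (SOME c. \<exists>p q r z. facet_rep F T p q r z \<and> c = tri_flux p q r z G)"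

lemma facet_flux_eq:
  assumes rep: "facet_rep F T p q r z" and c: "continuous_on F G"
  shows "facet_flux T F G = tri_flux p q r z G"
  unfolding facet_flux_def
proof (rule some_equality)
  show "\<exists>p' q' r' z'. facet_rep F T p' q' r' z' \<and> tri_flux p q r z G = tri_flux p' q' r' z' G"
    using rep by blast
  fix c' assume "\<exists>p q r z. facet_rep F T p q r z \<and> c' = tri_flux p q r z G"
  then obtain p' q' r' z' where r': "facet_rep F T p' q' r' z'" "c' = tri_flux p' q' r' z' G" by blast
  have "z' = z" by (rule facet_rep_apex_eq[OF rep r'(1)])
  moreover have "tri_flux p' q' r' z G = tri_flux p q r z G"
    using rep r'(1) c by (intro tri_flux_set facet_rep_vertices_eq[OF rep r'(1)]) (auto simp: facet_rep_def)
  ultimately show "c' = tri_flux p q r z G" using r'(2) by simp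
qed

lemma tet_divergence_facets:
  assumes x: "tet_vertices x T"
    and der: "\<And>y. y \<in> T \<Longrightarrow> (G has_derivative G' y) (at y within T)"
    and cont: "\<And>h. continuous_on T (\<lambda>y. G' y h)"
  shows "integral T (\<lambda>y. \<Sum>i\<in>UNIV. G' y (axis i 1) $ i) = - (\<Sum>F | F facet_of T. facet_flux T F G)"
proof -
  have cG: "continuous_on T G"
    using der has_derivative_continuous continuous_on_eq_continuous_within by blast
  have flux: "facet_flux T (tet_facet x s) G = tri_flux (x k) (x l) (x m) (x s) G"
    if "{1..4} - {s} = {k, l, m}" "{k, l, m, s} = {1..4}" "distinct [k, l, m, s]" for s k l m
  proof -
    have rep: "facet_rep (tet_facet x s) T (x k) (x l) (x m) (x s)"
      using tet_vertices_points[OF x that(3,2)] tet_facet_eq[OF that(1), of x] by (simp add: facet_rep_def)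
    show ?thesis
      by (rule facet_flux_eq[OF rep continuous_on_subset[OF cG facet_rep_subset[OF rep]]])
  qed
  have d: "distinct [1, 2, 3, 4::nat]" by simp
  note T = tet_vertices_points[OF x d atLeastAtMost_1_4[symmetric]]
  have "integral T (\<lambda>y. \<Sum>i\<in>UNIV. G' y (axis i 1) $ i) =
    - (tri_flux (x 2) (x 3) (x 4) (x 1) G + tri_flux (x 1) (x 3) (x 4) (x 2) G
       + tri_flux (x 1) (x 2) (x 4) (x 3) G + tri_flux (x 1) (x 2) (x 3) (x 4) G)"
    using tet_divergence_theorem[where p = "x 1" and q = "x 2" and r = "x 3" and s = "x 4" and G = G and G' = G']
      T(4) der cont unfolding T(3) by blast
  also have "\<dots> = - (\<Sum>s\<in>{1..4}. facet_flux T (tet_facet x s) G)"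
    using flux[of 1 2 3 4] flux[of 2 1 3 4] flux[of 3 1 2 4] flux[of 4 1 2 3]
    unfolding atLeastAtMost_1_4 by (simp add: insert_commute insert_Diff_if)
  also have "(\<Sum>s\<in>{1..4}. facet_flux T (tet_facet x s) G) = (\<Sum>F | F facet_of T. facet_flux T F G)"
    using sum.reindex[OF facets_of_tet(2)[OF x], of "\<lambda>F. facet_flux T F G"]
    unfolding facets_of_tet(1)[OF x] by (simp only: o_def)
  finally show ?thesis .
qed

section \<open>The two sides of a facet\<close>

text \<open>At the centroid the three coordinates belonging to the facet are positive, so a short
  step along the normal towards the apex stays in the element. Two elements on the same side of a
  facet are thereby seen to overlap.\<close>

lemma facet_rep_near_centroid:
  assumes rep: "facet_rep F T p q r z"
  defines "N \<equiv> cross3 (q - p) (r - p)"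
  obtains t0 where "t0 > 0"
    "\<And>t. 0 \<le> t \<Longrightarrow> t \<le> t0 \<Longrightarrow>
       p + (1/3) *\<^sub>R (q - p) + (1/3) *\<^sub>R (r - p) + (t * sgn (N \<bullet> (z - p))) *\<^sub>R N \<in> T"
proof -
  define a b v where "a = q - p" and "b = r - p" and "v = z - p"
  define \<alpha> \<nu> where "\<alpha> = N \<bullet> v" and "\<nu> = N \<bullet> N"
  define A B where "A = v \<bullet> cross3 b N" and "B = v \<bullet> cross3 N a"
  have N: "N = cross3 a b" by (simp add: N_def a_def b_def)
  have \<alpha>: "\<alpha> \<noteq> 0" using facet_rep_triple(1)[OF rep] by (simp add: \<alpha>_def N_def v_def)
  have \<nu>: "\<nu> > 0" using facet_rep_triple(2)[OF rep] by (simp add: \<nu>_def N_def)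
  have "a \<bullet> cross3 b N = \<nu>"
    unfolding \<nu>_def N by (simp add: inner_vec_def cross3_def sum_3 vector_3 algebra_simps)
  hence ex: "\<nu> *\<^sub>R v = A *\<^sub>R a + B *\<^sub>R b + \<alpha> *\<^sub>R N"
    using cross3_basis_expansion[of a b N v] by (simp add: A_def B_def \<alpha>_def N[symmetric] inner_commute)
  \<comment> \<open>By \<open>ex\<close>, moving by \<open>s * \<alpha>\<close> times
    \<open>N\<close> changes the coordinates along \<open>a\<close> and \<open>b\<close> by at most
    \<open>s * \<bar>A\<bar>\<close> and \<open>s * \<bar>B\<bar>\<close> and adds
    \<open>s * \<nu>\<close> along \<open>v\<close>. At the centroid the coordinates of
    \<open>p\<close>, \<open>q\<close>, \<open>r\<close> are all \<open>1/3\<close>, so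
    \<open>s * M \<le> 1/3\<close> keeps every coordinate nonnegative.\<close>
  define M where "M = \<bar>A\<bar> + \<bar>B\<bar> + \<nu>"
  have M: "M > 0" using \<nu> by (simp add: M_def)
  show thesis
  proof (rule that[of "\<bar>\<alpha>\<bar> / (3 * M)"])
    show "\<bar>\<alpha>\<bar> / (3 * M) > 0" using \<alpha> M by simp
    fix t assume t: "0 \<le> t" "t \<le> \<bar>\<alpha>\<bar> / (3 * M)"
    define s where "s = t / \<bar>\<alpha>\<bar>"
    have s: "s \<ge> 0" "s * M \<le> 1/3" using t \<alpha> M by (auto simp: s_def field_simps)
    have "(t * sgn \<alpha>) *\<^sub>R N = s *\<^sub>R (\<alpha> *\<^sub>R N)"
      using \<alpha> by (simp add: s_def sgn_if abs_if)
    also have "\<alpha> *\<^sub>R N = \<nu> *\<^sub>R v - A *\<^sub>R a - B *\<^sub>R b" using ex by simp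
    finally have eq: "p + (1/3) *\<^sub>R a + (1/3) *\<^sub>R b + (t * sgn \<alpha>) *\<^sub>R N =
        p + (1/3 - s * A) *\<^sub>R a + (1/3 - s * B) *\<^sub>R b + (s * \<nu>) *\<^sub>R v"
      by (simp add: algebra_simps)
    have le: "s * \<bar>A\<bar> + s * \<bar>B\<bar> + s * \<nu> \<le> 1/3" using s(2) by (simp add: M_def algebra_simps)
    have "s * A \<le> s * \<bar>A\<bar>" "s * B \<le> s * \<bar>B\<bar>" "s * (- A) \<le> s * \<bar>A\<bar>" "s * (- B) \<le> s * \<bar>B\<bar>"
      by (intro mult_left_mono s; simp)+
    hence "s * A \<le> s * \<bar>A\<bar>" "s * B \<le> s * \<bar>B\<bar>" "- (s * A) \<le> s * \<bar>A\<bar>" "- (s * B) \<le> s * \<bar>B\<bar>"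
      by simp_all
    moreover have "0 \<le> s * \<nu>" "0 \<le> s * \<bar>A\<bar>" "0 \<le> s * \<bar>B\<bar>" using s(1) \<nu> by simp_all
    moreover note le
    ultimately
    have "0 \<le> 1/3 - s * A" "0 \<le> 1/3 - s * B" "0 \<le> s * \<nu>" "(1/3 - s * A) + (1/3 - s * B) + s * \<nu> \<le> 1"
      by linarith+
    hence "p + (1/3 - s * A) *\<^sub>R a + (1/3 - s * B) *\<^sub>R b + (s * \<nu>) *\<^sub>R v \<in> convex hull {p, q, r, z}"
      unfolding a_def b_def v_def by (rule in_convex_hull_4)
    thus "p + (1/3) *\<^sub>R (q - p) + (1/3) *\<^sub>R (r - p) + (t * sgn (N \<bullet> (z - p))) *\<^sub>R N \<in> T"
      using eq rep by (simp only: facet_rep_def a_def b_def v_def \<alpha>_def)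
  qed
qed

text \<open>The factor \<open>c\<close> is the barycentric coordinate of \<open>w\<close> at the
  apex, so an element lies entirely on the side of its apex.\<close>

lemma facet_rep_height:
  assumes rep: "facet_rep F T p q r z" and w: "w \<in> T"
  obtains c where "c \<ge> 0" "cross3 (q - p) (r - p) \<bullet> (w - p) = c * (cross3 (q - p) (r - p) \<bullet> (z - p))"
proof -
  obtain a b c d where abcd: "0 \<le> a" "0 \<le> b" "0 \<le> c" "0 \<le> d" "a + b + c + d = 1"
    "w = a *\<^sub>R p + b *\<^sub>R q + c *\<^sub>R r + d *\<^sub>R z"
    using w rep unfolding facet_rep_def by (metis convex_hull_4E)
  have a: "a = 1 - b - c - d" using abcd(5) by simp
  have "w - p = b *\<^sub>R (q - p) + c *\<^sub>R (r - p) + d *\<^sub>R (z - p)"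
    unfolding abcd(6) a by (simp add: algebra_simps)
  hence "cross3 (q - p) (r - p) \<bullet> (w - p) = d * (cross3 (q - p) (r - p) \<bullet> (z - p))"
    by (simp add: inner_add_right dot_cross_self)
  thus thesis using that abcd(4) by blast
qed

lemma facet_height_0:
  assumes "facet_rep F T p q r z" "w \<in> F"
  shows "cross3 (q - p) (r - p) \<bullet> (w - p) = 0"
  using inner_const_hull_3[of "cross3 (q - p) (r - p)" q p r w] assms
  by (simp add: facet_rep_def dot_cross_self inner_diff_right[of _ w])

lemma mesh_face_Int:
  assumes "tet_mesh Th \<Omega>" "T \<in> Th" "T' \<in> Th"
  shows "(T \<inter> T') face_of T" "(T \<inter> T') face_of T'"
  using assms unfolding tet_mesh_def triangulation_def by (metis Int_commute)+

lemma mesh_aff_dim: "tet_mesh Th \<Omega> \<Longrightarrow> T \<in> Th \<Longrightarrow> aff_dim T = 3"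
  unfolding tet_mesh_def using aff_dim_simplex by fastforce

text \<open>Elements on the same side share a short normal segment over the centroid of
  \<open>F\<close>, hence a point \<open>w\<close> off \<open>F\<close>. If they differed, their
  intersection would be a common face strictly larger than \<open>F\<close> and strictly smaller
  than an element, of dimension strictly between 2 and 3.\<close>

lemma mesh_facet_unique:
  assumes mesh: "tet_mesh Th \<Omega>" and T: "T1 \<in> Th" "T2 \<in> Th"
    and rep: "facet_rep F T1 p q r z1" "facet_rep F T2 p q r z2"
  defines "N \<equiv> cross3 (q - p) (r - p)"
  assumes sgn: "sgn (N \<bullet> (z1 - p)) = sgn (N \<bullet> (z2 - p))"
  shows "T1 = T2"
proof -
  obtain t1 where t1: "t1 > 0" "\<And>t. 0 \<le> t \<Longrightarrow> t \<le> t1 \<Longrightarrow>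
       p + (1/3) *\<^sub>R (q - p) + (1/3) *\<^sub>R (r - p) + (t * sgn (N \<bullet> (z1 - p))) *\<^sub>R N \<in> T1"
    using facet_rep_near_centroid[OF rep(1)] unfolding N_def by blast
  obtain t2 where t2: "t2 > 0" "\<And>t. 0 \<le> t \<Longrightarrow> t \<le> t2 \<Longrightarrow>
       p + (1/3) *\<^sub>R (q - p) + (1/3) *\<^sub>R (r - p) + (t * sgn (N \<bullet> (z2 - p))) *\<^sub>R N \<in> T2"
    using facet_rep_near_centroid[OF rep(2)] unfolding N_def by blast
  define w where "w = p + (1/3) *\<^sub>R (q - p) + (1/3) *\<^sub>R (r - p) + (min t1 t2 * sgn (N \<bullet> (z1 - p))) *\<^sub>R N"
  have w: "w \<in> T1 \<inter> T2"
    using t1(2)[of "min t1 t2"] t2(2)[of "min t1 t2"] t1(1) t2(1) sgn by (simp add: w_def)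
  have NN: "N \<noteq> 0" "N \<bullet> (z1 - p) \<noteq> 0" using facet_rep_triple[OF rep(1)] by (auto simp: N_def)
  have "w - p = (1/3) *\<^sub>R (q - p) + (1/3) *\<^sub>R (r - p) + (min t1 t2 * sgn (N \<bullet> (z1 - p))) *\<^sub>R N"
    by (simp add: w_def)
  hence "N \<bullet> (w - p) = min t1 t2 * sgn (N \<bullet> (z1 - p)) * (N \<bullet> N)"
    by (simp add: inner_add_right) (simp add: N_def dot_cross_self)
  also have "\<dots> \<noteq> 0" using NN t1(1) t2(1) by (auto simp: sgn_if min_def)
  finally have wF: "w \<notin> F" using facet_height_0[OF rep(1)] by (auto simp: N_def)
  have *: "T \<inter> T' = T" if "T \<in> {T1, T2}" "T' \<in> {T1, T2}" "T \<noteq> T'" for T T'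
  proof (rule ccontr)
    assume ne: "T \<inter> T' \<noteq> T"
    have TT: "T \<in> Th" "T' \<in> Th" using that T by auto
    have fac: "F facet_of T" "F \<subseteq> T \<inter> T'" using that rep facet_rep_facet facet_rep_subset by blast+
    have cT: "convex T" using TT mesh mesh_face_Int(1)[OF mesh TT(1) TT(1)] by (metis Int_absorb face_of_imp_convex rep facet_rep_def convex_convex_hull that(1) empty_iff insert_iff)
    have "F face_of (T \<inter> T')" using fac by (meson face_of_subset facet_of_imp_face_of inf_le1)
    moreover have "F \<noteq> T \<inter> T'" using w wF that by auto
    moreover have "convex (T \<inter> T')" using mesh_face_Int(1)[OF mesh TT] face_of_imp_convex by blast
    ultimately have "aff_dim F < aff_dim (T \<inter> T')" by (intro face_of_aff_dim_lt)
    moreover have "aff_dim (T \<inter> T') < aff_dim T"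
      by (rule face_of_aff_dim_lt[OF cT mesh_face_Int(1)[OF mesh TT] ne])
    moreover have "aff_dim F = aff_dim T - 1" using fac by (simp add: facet_of_def)
    ultimately show False by linarith
  qed
  show ?thesis using *[of T1 T2] *[of T2 T1] by blast
qed

text \<open>A small step from a relative interior point \<open>y0\<close> of \<open>F\<close> in the
  direction \<sigma> \<open>N\<close> stays in \<Omega> and lands in some element that also contains
  \<open>y0\<close>. Conformity makes \<open>F\<close> a facet of that element, and
  \<open>facet_rep_height\<close> tells on which side its apex lies.\<close>

lemma mesh_facet_exists:
  assumes mesh: "tet_mesh Th \<Omega>" and op: "open \<Omega>" and x: "\<forall>T\<in>Th. tet_vertices (x T) T"
    and T: "T0 \<in> Th" and rep: "facet_rep F T0 p q r z0" and meet: "F \<inter> \<Omega> \<noteq> {}"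
    and \<sigma>: "\<sigma> = 1 \<or> \<sigma> = (-1::real)"
  obtains T z where "T \<in> Th" "facet_rep F T p q r z" "sgn (cross3 (q - p) (r - p) \<bullet> (z - p)) = \<sigma>"
proof -
  define N where "N = cross3 (q - p) (r - p)"
  have N: "N \<noteq> 0" using facet_rep_triple[OF rep] by (auto simp: N_def)
  have cF: "convex F" "F facet_of T0" using rep facet_rep_facet by (auto simp: facet_rep_def)
  have "closure (rel_interior F) = closure F" by (rule convex_closure_rel_interior[OF cF(1)])
  hence "\<Omega> \<inter> closure (rel_interior F) \<noteq> {}" using meet closure_subset by blast
  hence "\<Omega> \<inter> rel_interior F \<noteq> {}" using open_Int_closure_eq_empty[OF op] by blast
  then obtain y0 where y0: "y0 \<in> \<Omega>" "y0 \<in> rel_interior F" by blast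
  have fin: "finite Th" using mesh by (simp add: tet_mesh_def triangulation_def)
  have cl: "closed T" if "T \<in> Th" for T
    using x that unfolding tet_vertices_def
    by (metis compact_imp_closed finite_atLeastAtMost finite_imageI finite_imp_compact_convex_hull)
  \<comment> \<open>The elements that miss \<open>y0\<close> form a finite closed union, so near
    \<open>y0\<close> only elements containing \<open>y0\<close> occur.\<close>
  have "open (\<Omega> \<inter> - \<Union>{T \<in> Th. y0 \<notin> T})"
    using fin cl op by (intro open_Int open_Compl closed_Union) auto
  moreover have "y0 \<in> \<Omega> \<inter> - \<Union>{T \<in> Th. y0 \<notin> T}" using y0 by blast
  ultimately obtain e where e: "e > 0" "cball y0 e \<subseteq> \<Omega> \<inter> - \<Union>{T \<in> Th. y0 \<notin> T}"
    using open_contains_cball by blast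
  define w where "w = y0 + (e / norm N * \<sigma>) *\<^sub>R N"
  have "w \<in> cball y0 e" using N e(1) \<sigma> by (auto simp: w_def dist_norm)
  hence w: "w \<in> \<Omega>" "w \<notin> \<Union>{T \<in> Th. y0 \<notin> T}" using e(2) by auto
  have "\<Omega> \<subseteq> \<Union>Th" using mesh closure_subset by (auto simp: tet_mesh_def)
  then obtain T' where T': "T' \<in> Th" "w \<in> T'" "y0 \<in> T'" using w by blast
  have y0F: "y0 \<in> F" using y0(2) rel_interior_subset by blast
  have FT0: "F \<subseteq> T0" by (rule facet_rep_subset[OF rep])
  \<comment> \<open>A face of \<open>T0\<close> that meets the relative interior of a subset
    \<open>F\<close> of \<open>T0\<close> contains all of \<open>F\<close>.\<close>
  have "F \<subseteq> T0 \<inter> T'"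
    by (rule subset_of_face_of[OF mesh_face_Int(1)[OF mesh T T'(1)] FT0]) (use y0 y0F FT0 T' in blast)
  hence "F face_of (T0 \<inter> T')" using cF(2) by (meson face_of_subset facet_of_imp_face_of inf_le1)
  hence "F face_of T'" using mesh_face_Int(2)[OF mesh T T'(1)] face_of_trans by blast
  moreover have "F \<noteq> {}" "aff_dim F = aff_dim T' - 1"
    using cF(2) mesh_aff_dim[OF mesh T] mesh_aff_dim[OF mesh T'(1)] by (auto simp: facet_of_def)
  ultimately have "F facet_of T'" by (simp add: facet_of_def)
  then obtain p' q' r' z where "facet_rep F T' p' q' r' z" using facet_rep_exists x T'(1) by blast
  hence rep': "facet_rep F T' p q r z" by (rule facet_rep_transfer[OF rep])
  obtain c where c: "c \<ge> 0" "N \<bullet> (w - p) = c * (N \<bullet> (z - p))"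
    using facet_rep_height[OF rep' T'(2)] unfolding N_def by blast
  have "N \<bullet> (w - p) = N \<bullet> (y0 - p) + (e / norm N * \<sigma>) * (N \<bullet> N)"
    by (simp add: w_def inner_diff_right inner_add_right)
  also have "N \<bullet> (y0 - p) = 0" using facet_height_0[OF rep y0F] by (simp add: N_def)
  finally have eq: "c * (N \<bullet> (z - p)) = \<sigma> * (e * norm N)"
    using c(2) N by (simp add: dot_square_norm power2_eq_square field_simps)
  have "e * norm N > 0" using e N by simp
  hence "sgn (c * (N \<bullet> (z - p))) = \<sigma>" unfolding eq sgn_mult[of \<sigma>] using \<sigma> by (auto simp: sgn_pos)
  moreover have "c > 0" using c(1) eq \<open>e * norm N > 0\<close> \<sigma> by (cases "c = 0") auto
  ultimately have "sgn (N \<bullet> (z - p)) = \<sigma>" by (simp add: sgn_mult)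
  thus thesis using that[OF T'(1) rep'] by (simp add: N_def)
qed

text \<open>A facet that meets \<Omega> belongs to exactly two elements, one on either side. Their
  fluxes are taken with opposite normals, so equal normal components cancel.\<close>

lemma mesh_facet_flux_cancel:
  assumes mesh: "tet_mesh Th \<Omega>" and op: "open \<Omega>" and x: "\<forall>T\<in>Th. tet_vertices (x T) T"
    and F: "F facet_of T0" "T0 \<in> Th" "F \<inter> \<Omega> \<noteq> {}"
    and cG: "\<And>T. T \<in> Th \<Longrightarrow> F facet_of T \<Longrightarrow> continuous_on F (G T)"
    and tang: "\<And>T T' n y. T \<in> Th \<Longrightarrow> T' \<in> Th \<Longrightarrow> F facet_of T \<Longrightarrow> F facet_of T' \<Longrightarrow> y \<in> F \<Longrightarrow>
       unit_normal F n \<Longrightarrow> n \<bullet> G T y = n \<bullet> G T' y"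
  shows "(\<Sum>T | T \<in> Th \<and> F facet_of T. facet_flux T F (G T)) = 0"
proof -
  obtain p q r z where rep: "facet_rep F T0 p q r z" using facet_rep_exists x F by blast
  define N where "N = cross3 (q - p) (r - p)"
  have N: "N \<noteq> 0" using facet_rep_triple[OF rep] by (auto simp: N_def)
  obtain T1 z1 where 1: "T1 \<in> Th" "facet_rep F T1 p q r z1" "sgn (N \<bullet> (z1 - p)) = 1"
    using mesh_facet_exists[OF mesh op x F(2) rep F(3), of 1] unfolding N_def by blast
  obtain T2 z2 where 2: "T2 \<in> Th" "facet_rep F T2 p q r z2" "sgn (N \<bullet> (z2 - p)) = -1"
    using mesh_facet_exists[OF mesh op x F(2) rep F(3), of "-1"] unfolding N_def by blast
  have ne: "T1 \<noteq> T2" using 1 2 facet_rep_apex_eq by force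
  have "{T. T \<in> Th \<and> F facet_of T} = {T1, T2}"
  proof (intro equalityI subsetI)
    fix T assume "T \<in> {T. T \<in> Th \<and> F facet_of T}"
    hence T: "T \<in> Th" "F facet_of T" by auto
    obtain p' q' r' z' where "facet_rep F T p' q' r' z'" using facet_rep_exists x T by blast
    hence rT: "facet_rep F T p q r z'" by (rule facet_rep_transfer[OF rep])
    hence "N \<bullet> (z' - p) \<noteq> 0" using facet_rep_triple(1) by (simp add: N_def)
    hence "sgn (N \<bullet> (z' - p)) = 1 \<or> sgn (N \<bullet> (z' - p)) = -1" by (auto simp: sgn_if)
    thus "T \<in> {T1, T2}"
      using mesh_facet_unique[OF mesh T(1) 1(1) rT 1(2)] mesh_facet_unique[OF mesh T(1) 2(1) rT 2(2)] 1 2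
      by (auto simp: N_def)
  qed (use 1 2 facet_rep_facet in auto)
  hence "(\<Sum>T | T \<in> Th \<and> F facet_of T. facet_flux T F (G T)) = facet_flux T1 F (G T1) + facet_flux T2 F (G T2)"
    using ne by simp
  also have "\<dots> = mean_tri p q r (\<lambda>y. N \<bullet> G T1 y) - mean_tri p q r (\<lambda>y. N \<bullet> G T2 y)"
    using facet_flux_eq[OF 1(2)] facet_flux_eq[OF 2(2)] cG 1 2 facet_rep_facet
    by (simp add: tri_flux_def N_def)
  also have "mean_tri p q r (\<lambda>y. N \<bullet> G T1 y) = mean_tri p q r (\<lambda>y. N \<bullet> G T2 y)"
  proof (rule mean_tri_cong)
    fix y assume "y \<in> convex hull {p, q, r}"
    hence y: "y \<in> F" and hull: "F = convex hull {p, q, r}" using rep by (auto simp: facet_rep_def)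
    have "unit_normal F (N /\<^sub>R norm N)"
      unfolding unit_normal_facet_iff[OF hull] using N by (simp add: N_def dot_cross_self)
    from tang[OF 1(1) 2(1) _ _ y this] have "(N /\<^sub>R norm N) \<bullet> G T1 y = (N /\<^sub>R norm N) \<bullet> G T2 y"
      using 1(2) 2(2) facet_rep_facet by blast
    thus "N \<bullet> G T1 y = N \<bullet> G T2 y" using N by simp
  qed
  finally show ?thesis by simp
qed

section \<open>Piecewise smooth fields on a mesh\<close>

lemma mesh_elements:
  assumes "\<forall>T\<in>Th. tet_vertices (x T) T" "T \<in> Th"
  shows "compact T" "convex T" "closed T"
proof -
  have "T = convex hull (x T ` {1..4})" using assms by (auto simp: tet_vertices_def)
  thus "compact T" "convex T" "closed T"
    by (metis finite_atLeastAtMost finite_imageI finite_imp_compact_convex_hull,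
        metis convex_convex_hull,
        metis compact_imp_closed finite_atLeastAtMost finite_imageI finite_imp_compact_convex_hull)
qed

lemma mesh_interior_unique:
  assumes mesh: "tet_mesh Th \<Omega>" and "T \<in> Th" "T' \<in> Th" "y \<in> interior T" "y \<in> interior T'"
  shows "T = T'"
proof -
  have "T \<inter> T' = T"
    using face_of_disjoint_interior[OF mesh_face_Int(1)[OF mesh assms(2,3)]] assms(4,5) interior_subset by blast
  moreover have "T \<inter> T' = T'"
    using face_of_disjoint_interior[OF mesh_face_Int(2)[OF mesh assms(2,3)]] assms(4,5) interior_subset by blast
  ultimately show ?thesis by simp
qed

text \<open>Off the frontiers a point of \<Omega> lies in exactly one element. The sum thus
  represents \<open>f\<close> almost everywhere by functions that are continuous on compact sets,
  from which measurability and integrability are read off.\<close>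

lemma mesh_piecewise_sum:
  fixes u :: "(real^3) set \<Rightarrow> real^3 \<Rightarrow> 'b::euclidean_space"
  assumes mesh: "tet_mesh Th \<Omega>" and x: "\<forall>T\<in>Th. tet_vertices (x T) T"
    and y: "y \<in> \<Omega>" "y \<notin> (\<Union>T\<in>Th. frontier T)" and f: "\<And>T. T \<in> Th \<Longrightarrow> y \<in> interior T \<Longrightarrow> f y = u T y"
  shows "(\<Sum>T\<in>Th. indicator T y *\<^sub>R u T y) = f y"
proof -
  have fin: "finite Th" using mesh by (simp add: tet_mesh_def triangulation_def)
  have "\<Omega> \<subseteq> \<Union>Th" using mesh closure_subset by (auto simp: tet_mesh_def)
  then obtain T where T: "T \<in> Th" "y \<in> T" using y(1) by blast
  have int: "y \<in> interior T'" if "T' \<in> Th" "y \<in> T'" for T'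
    using that y(2) mesh_elements(3)[OF x that(1)] by (auto simp: frontier_def)
  have "(\<Sum>T\<in>Th. indicator T y *\<^sub>R u T y) = (\<Sum>T'\<in>Th. if T' = T then u T y else 0)"
  proof (rule sum.cong)
    fix T' assume T': "T' \<in> Th"
    have "y \<in> T' \<longleftrightarrow> T' = T"
      using mesh_interior_unique[OF mesh T' T(1)] int[OF T'] int[OF T] T(2) by blast
    thus "indicator T' y *\<^sub>R u T' y = (if T' = T then u T y else 0)" by (auto simp: indicator_def)
  qed simp
  also have "\<dots> = u T y" using fin T by simp
  also have "\<dots> = f y" using f[OF T(1)] int[OF T] by simp
  finally show ?thesis .
qed

lemma mesh_AE:
  assumes mesh: "tet_mesh Th \<Omega>" and x: "\<forall>T\<in>Th. tet_vertices (x T) T"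
  shows "AE y in lebesgue. y \<notin> (\<Union>T\<in>Th. frontier T)"
proof (rule AE_not_in)
  have "finite Th" using mesh by (simp add: tet_mesh_def triangulation_def)
  hence "negligible (\<Union>T\<in>Th. frontier T)"
    by (intro negligible_Union) (auto intro!: negligible_convex_frontier mesh_elements(2)[OF x])
  thus "(\<Union>T\<in>Th. frontier T) \<in> null_sets lebesgue" by (simp add: negligible_iff_null_sets)
qed

lemma integrable_lebesgue_compact:
  fixes h :: "'a::euclidean_space \<Rightarrow> 'b::euclidean_space"
  assumes "compact S" "continuous_on S h"
  shows "integrable lebesgue (\<lambda>y. indicator S y *\<^sub>R h y)"
    "(LINT y|lebesgue. indicator S y *\<^sub>R h y) = integral S h"
proof -
  have i: "integrable lborel (\<lambda>y. indicator S y *\<^sub>R h y)" by (rule borel_integrable_compact[OF assms])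
  hence m: "(\<lambda>y. indicator S y *\<^sub>R h y) \<in> borel_measurable lborel" by (rule borel_measurable_integrable)
  show "integrable lebesgue (\<lambda>y. indicator S y *\<^sub>R h y)" using i by (simp add: integrable_completion[OF m])
  show "(LINT y|lebesgue. indicator S y *\<^sub>R h y) = integral S h"
    by (simp add: integral_completion[OF m] integral_compact_eq[OF assms] set_lebesgue_integral_def)
qed

lemma mesh_piecewise_integrable:
  fixes u :: "(real^3) set \<Rightarrow> real^3 \<Rightarrow> 'b::euclidean_space"
  assumes mesh: "tet_mesh Th \<Omega>" and op: "open \<Omega>" and x: "\<forall>T\<in>Th. tet_vertices (x T) T"
    and f: "\<And>T y. T \<in> Th \<Longrightarrow> y \<in> interior T \<Longrightarrow> f y = u T y"
    and u: "\<And>T. T \<in> Th \<Longrightarrow> continuous_on T (u T)"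
  shows "integrable (lebesgue_on \<Omega>) f"
proof -
  have \<Omega>: "\<Omega> \<in> sets lebesgue" using op by auto
  have i: "integrable lebesgue (\<lambda>y. indicator \<Omega> y *\<^sub>R (\<Sum>T\<in>Th. indicator T y *\<^sub>R u T y))"
    by (intro integrable_mult_indicator \<Omega> Bochner_Integration.integrable_sum integrable_lebesgue_compact u mesh_elements(1)[OF x])
  have ae: "AE y in lebesgue. indicator \<Omega> y *\<^sub>R (\<Sum>T\<in>Th. indicator T y *\<^sub>R u T y) = indicator \<Omega> y *\<^sub>R f y"
    using mesh_AE[OF mesh x]
  proof eventually_elim
    case (elim y)
    thus ?case using mesh_piecewise_sum[OF mesh x _ elim, of f u] f by (cases "y \<in> \<Omega>") simp_all
  qed
  have m: "(\<lambda>y. indicator \<Omega> y *\<^sub>R f y) \<in> borel_measurable lebesgue"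
    by (rule borel_measurable_AE[OF borel_measurable_integrable[OF i] ae])
  have "integrable lebesgue (\<lambda>y. indicator \<Omega> y *\<^sub>R f y)"
    using integrable_cong_AE[OF borel_measurable_integrable[OF i] m ae] i by simp
  thus ?thesis using \<Omega> by (simp add: integrable_restrict_space)
qed

text \<open>The elements cover \<open>closure \<Omega>\<close>, and the open set \<Omega> may leave
  out a part of it of positive measure. Integrals over whole elements agree with the integral over
  \<Omega> because each \<open>u T\<close> vanishes outside \<Omega>; in the application the compact
  support of the test field provides this.\<close>

lemma mesh_piecewise_integral:
  fixes u :: "(real^3) set \<Rightarrow> real^3 \<Rightarrow> 'b::euclidean_space"
  assumes mesh: "tet_mesh Th \<Omega>" and op: "open \<Omega>" and x: "\<forall>T\<in>Th. tet_vertices (x T) T"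
    and f: "\<And>T y. T \<in> Th \<Longrightarrow> y \<in> interior T \<Longrightarrow> f y = u T y"
    and u: "\<And>T. T \<in> Th \<Longrightarrow> continuous_on T (u T)"
    and 0: "\<And>T y. T \<in> Th \<Longrightarrow> y \<notin> \<Omega> \<Longrightarrow> u T y = 0"
  shows "(LINT y|lebesgue_on \<Omega>. f y) = (\<Sum>T\<in>Th. integral T (u T))"
proof -
  have \<Omega>: "\<Omega> \<in> sets lebesgue" using op by auto
  have i: "integrable lebesgue (\<lambda>y. indicator \<Omega> y *\<^sub>R f y)"
    using mesh_piecewise_integrable[OF mesh op x f u] \<Omega> by (simp add: integrable_restrict_space)
  have iT: "integrable lebesgue (\<lambda>y. indicator T y *\<^sub>R u T y)" if "T \<in> Th" for T
    by (intro integrable_lebesgue_compact u mesh_elements(1)[OF x] that)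
  have "(LINT y|lebesgue_on \<Omega>. f y) = (LINT y|lebesgue. indicator \<Omega> y *\<^sub>R f y)"
    using \<Omega> by (simp add: integral_restrict_space)
  also have "\<dots> = (LINT y|lebesgue. (\<Sum>T\<in>Th. indicator T y *\<^sub>R u T y))"
  proof (rule integral_cong_AE)
    show "(\<lambda>y. \<Sum>T\<in>Th. indicator T y *\<^sub>R u T y) \<in> borel_measurable lebesgue"
      using iT by (intro borel_measurable_sum borel_measurable_integrable)
    show "AE y in lebesgue. indicator \<Omega> y *\<^sub>R f y = (\<Sum>T\<in>Th. indicator T y *\<^sub>R u T y)"
      using mesh_AE[OF mesh x]
    proof eventually_elim
      case (elim y)
      show ?case
      proof (cases "y \<in> \<Omega>")
        case True
        thus ?thesis using mesh_piecewise_sum[OF mesh x True elim, of f u] f by simp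
      qed (simp add: 0)
    qed
  qed (use i in auto)
  also have "\<dots> = (\<Sum>T\<in>Th. LINT y|lebesgue. indicator T y *\<^sub>R u T y)"
    by (rule Bochner_Integration.integral_sum[OF iT])
  also have "\<dots> = (\<Sum>T\<in>Th. integral T (u T))"
    by (intro sum.cong refl integrable_lebesgue_compact(2) u mesh_elements(1)[OF x])
  finally show ?thesis .
qed

lemma mesh_piecewise_L2:
  assumes mesh: "tet_mesh Th \<Omega>" and op: "open \<Omega>" and x: "\<forall>T\<in>Th. tet_vertices (x T) T"
    and f: "\<And>T y. T \<in> Th \<Longrightarrow> y \<in> interior T \<Longrightarrow> f y = u T y"
    and u: "\<And>T. T \<in> Th \<Longrightarrow> continuous_on T (u T)"
  shows "f \<in> L2_on \<Omega>"
proof -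
  have "integrable (lebesgue_on \<Omega>) f"
    by (rule mesh_piecewise_integrable[OF mesh op x f u])
  moreover have "integrable (lebesgue_on \<Omega>) (\<lambda>y. (norm (f y))\<^sup>2)"
    by (rule mesh_piecewise_integrable[OF mesh op x, where u = "\<lambda>T y. (norm (u T y))\<^sup>2"])
       (auto simp: f intro!: continuous_intros u)
  ultimately show ?thesis by (auto simp: L2_on_def dest: borel_measurable_integrable)
qed

section \<open>Green's formula and the weak curl\<close>

text \<open>The curl as a function of the derivative map, so that it also applies to derivatives
  within a closed element, where \<open>curl\<close> with its two-sided Jacobian says nothing at
  boundary points.\<close>

definition curl_of :: "(real^3 \<Rightarrow> real^3) \<Rightarrow> real^3" where
  "curl_of L = vector [L (axis 2 1) $ 3 - L (axis 3 1) $ 2, L (axis 3 1) $ 1 - L (axis 1 1) $ 3,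
     L (axis 1 1) $ 2 - L (axis 2 1) $ 1]"

lemma curl_eq_curl_of: "curl f y = curl_of (frechet_derivative f (at y))"
  by (simp add: curl_def curl_of_def jacobian_def matrix_def Let_def)

lemma continuous_on_curl_of:
  assumes "\<And>h. continuous_on S (\<lambda>y. f' y h)"
  shows "continuous_on S (\<lambda>y. curl_of (f' y))"
proof -
  have "continuous_on S (\<lambda>y. curl_of (f' y) $ i)" for i
    using exhaust_3[of i]
    by (elim disjE; simp add: curl_of_def vector_3; intro continuous_intros assms)
  hence "continuous_on S (\<lambda>y. \<chi> i. curl_of (f' y) $ i)" by (rule continuous_on_vec_lambda)
  thus ?thesis by simp
qed

lemma has_derivative_cross3:
  assumes "(f has_derivative f') (at y within S)" "(g has_derivative g') (at y within S)"
  shows "((\<lambda>y. cross3 (f y) (g y)) has_derivative (\<lambda>h. cross3 (f y) (g' h) + cross3 (f' h) (g y))) (at y within S)"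
  by (rule bounded_bilinear.FDERIV[OF _ assms])
     (use bilinear_cross bilinear_conv_bounded_bilinear in blast)

text \<open>The divergence theorem for the field \<open>cross3 (w y) (\<psi> y)\<close>, whose
  divergence is \<open>curl w \<bullet> \<psi> - w \<bullet> curl \<psi>\<close>. The facet terms
  carry a plus sign because \<open>facet_flux\<close> is oriented inward.\<close>

lemma tet_green_curl:
  assumes x: "tet_vertices x T"
    and w: "\<And>y. y \<in> T \<Longrightarrow> (w has_derivative w' y) (at y within T)" "\<And>h. continuous_on T (\<lambda>y. w' y h)"
    and \<psi>: "\<And>y. \<psi> differentiable (at y)" "\<And>h. continuous_on UNIV (\<lambda>y. frechet_derivative \<psi> (at y) h)"
  shows "integral T (\<lambda>y. w y \<bullet> curl \<psi> y) = integral T (\<lambda>y. curl_of (w' y) \<bullet> \<psi> y)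
     + (\<Sum>F | F facet_of T. facet_flux T F (\<lambda>y. cross3 (w y) (\<psi> y)))"
proof -
  let ?\<psi>' = "\<lambda>y. frechet_derivative \<psi> (at y)"
  have d\<psi>: "(\<psi> has_derivative ?\<psi>' y) (at y within T)" for y
    using \<psi>(1)[of y] frechet_derivative_works has_derivative_at_withinI by blast
  have c\<psi>': "continuous_on T (\<lambda>y. ?\<psi>' y h)" for h using \<psi>(2) continuous_on_subset by blast
  have c\<psi>: "continuous_on T \<psi>"
    using d\<psi> has_derivative_continuous continuous_on_eq_continuous_within by blast
  have cw: "continuous_on T w"
    using w(1) has_derivative_continuous continuous_on_eq_continuous_within by blast
  let ?G' = "\<lambda>y h. cross3 (w y) (?\<psi>' y h) + cross3 (w' y h) (\<psi> y)"
  have T: "compact T" using mesh_elements(1)[of "{T}" "\<lambda>_. x"] x by simp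
  have "integral T (\<lambda>y. \<Sum>i\<in>UNIV. ?G' y (axis i 1) $ i) =
      - (\<Sum>F | F facet_of T. facet_flux T F (\<lambda>y. cross3 (w y) (\<psi> y)))"
    by (rule tet_divergence_facets[OF x]; (intro has_derivative_cross3 w d\<psi> continuous_on_add continuous_on_cross cw c\<psi> c\<psi>')?)
  moreover have "(\<Sum>i\<in>UNIV. ?G' y (axis i 1) $ i) = curl_of (w' y) \<bullet> \<psi> y - w y \<bullet> curl \<psi> y" for y
    unfolding curl_eq_curl_of curl_of_def
    by (simp add: inner_vec_def cross3_def sum_3 vector_3 algebra_simps)
  moreover have "integral T (\<lambda>y. curl_of (w' y) \<bullet> \<psi> y - w y \<bullet> curl \<psi> y) =
      integral T (\<lambda>y. curl_of (w' y) \<bullet> \<psi> y) - integral T (\<lambda>y. w y \<bullet> curl \<psi> y)"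
    unfolding curl_eq_curl_of
    by (intro Henstock_Kurzweil_Integration.integral_diff integral_compact_eq(2)[OF T]
        continuous_on_inner continuous_on_curl_of w cw c\<psi> c\<psi>')
  ultimately show ?thesis by simp
qed

text \<open>Since \<open>n \<bullet> cross3 a \<psi> = cross3 n a \<bullet> \<psi>\<close>, the
  facet terms of Green's formula see only tangential traces. On facets that meet \<Omega> they
  cancel between the two neighbours; on all others the test field is zero, as its support lies in
  \<Omega>.\<close>

theorem mesh_Hcurl:
  assumes mesh: "tet_mesh Th \<Omega>" and op: "open \<Omega>" and x: "\<forall>T\<in>Th. tet_vertices (x T) T"
    and v: "\<And>T y. T \<in> Th \<Longrightarrow> y \<in> interior T \<Longrightarrow> v y = w T y"
    and C1: "\<And>T. T \<in> Th \<Longrightarrow> C1_within T (w T)"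
    and tang: "\<And>T T' F n y. T \<in> Th \<Longrightarrow> T' \<in> Th \<Longrightarrow> F facet_of T \<Longrightarrow> F facet_of T' \<Longrightarrow> F \<inter> \<Omega> \<noteq> {} \<Longrightarrow>
      unit_normal F n \<Longrightarrow> y \<in> F \<Longrightarrow> cross3 n (w T y) = cross3 n (w T' y)"
  shows "v \<in> Hcurl \<Omega>"
proof -
  have fin: "finite Th" using mesh by (simp add: tet_mesh_def triangulation_def)
  have "\<forall>T\<in>Th. \<exists>f'. (\<forall>y\<in>T. (w T has_derivative f' y) (at y within T)) \<and> (\<forall>h. continuous_on T (\<lambda>y. f' y h))"
    using C1 unfolding C1_within_def by blast
  then obtain w' where w': "\<And>T y. T \<in> Th \<Longrightarrow> y \<in> T \<Longrightarrow> (w T has_derivative w' T y) (at y within T)"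
    "\<And>T h. T \<in> Th \<Longrightarrow> continuous_on T (\<lambda>y. w' T y h)"
    by metis
  have cw: "continuous_on T (w T)" if "T \<in> Th" for T using C1_within_continuous_on[OF C1[OF that]] .
  \<comment> \<open>The piecewise curl, set to zero off the element interiors. On the frontiers the
    one-sided derivatives of neighbours may disagree, but these have measure zero.\<close>
  define W where "W y = (\<Sum>T\<in>Th. indicator (interior T) y *\<^sub>R curl_of (w' T y))" for y
  have W: "W y = curl_of (w' T y)" if "T \<in> Th" "y \<in> interior T" for T y
  proof -
    have "W y = (\<Sum>T'\<in>Th. if T' = T then curl_of (w' T y) else 0)"
      unfolding W_def
    proof (rule sum.cong)
      fix T' assume "T' \<in> Th"
      hence "y \<in> interior T' \<longleftrightarrow> T' = T" using mesh_interior_unique[OF mesh] that by blast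
      thus "indicator (interior T') y *\<^sub>R curl_of (w' T' y) = (if T' = T then curl_of (w' T y) else 0)"
        by (auto simp: indicator_def)
    qed simp
    thus ?thesis using fin that by simp
  qed
  have cW: "continuous_on T (\<lambda>y. curl_of (w' T y))" if "T \<in> Th" for T
    by (rule continuous_on_curl_of[OF w'(2)[OF that]])
  have "v \<in> L2_on \<Omega>" by (rule mesh_piecewise_L2[OF mesh op x v cw])
  moreover have "W \<in> L2_on \<Omega>" by (rule mesh_piecewise_L2[OF mesh op x W cW])
  moreover have "(LINT y|lebesgue_on \<Omega>. v y \<bullet> curl \<psi> y) = (LINT y|lebesgue_on \<Omega>. W y \<bullet> \<psi> y)"
    if \<psi>: "\<psi> \<in> test_fields \<Omega>" for \<psi>
  proof -
    have "Ck (Suc 0) \<psi>" using \<psi> by (simp add: test_fields_def)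
    hence d: "\<And>y. \<psi> differentiable (at y)" "\<And>h. continuous_on UNIV (\<lambda>y. frechet_derivative \<psi> (at y) h)"
      by auto
    obtain K where K: "compact K" "K \<subseteq> \<Omega>" "\<And>y. y \<notin> K \<Longrightarrow> \<psi> y = 0"
      using \<psi> by (auto simp: test_fields_def)
    have \<psi>0: "\<psi> y = 0" if "y \<notin> \<Omega>" for y using K(2,3) that by blast
    have c\<psi>: "continuous_on S \<psi>" for S
      using d(1) differentiable_imp_continuous_within continuous_at_imp_continuous_on by blast
    have ccurl: "continuous_on S (curl \<psi>)" for S
      unfolding curl_eq_curl_of[abs_def]
      by (rule continuous_on_curl_of) (rule continuous_on_subset[OF d(2)], simp)
    have curl0: "curl \<psi> y = 0" if "y \<notin> \<Omega>" for y
    proof -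
      have op': "open (- K)" using K(1) compact_imp_closed by auto
      have "(\<psi> has_derivative (\<lambda>_. 0)) (at y)"
      proof (rule has_derivative_transform_within_open[OF has_derivative_const op'])
        show "y \<in> - K" using that K(2) by blast
      qed (use K(3) in auto)
      hence "frechet_derivative \<psi> (at y) = (\<lambda>_. 0)" by (rule frechet_derivative_at[symmetric])
      thus ?thesis by (simp add: curl_eq_curl_of curl_of_def vec_eq_iff forall_3 vector_3)
    qed
    let ?G = "\<lambda>T y. cross3 (w T y) (\<psi> y)"
    let ?FF = "\<Union>T\<in>Th. {F. F facet_of T}"
    have finF: "finite {F. F facet_of T}" if "T \<in> Th" for T
      using facets_of_tet(1)[of "x T" T] x that by simp
    have flux0: "(\<Sum>T | T \<in> Th \<and> F facet_of T. facet_flux T F (?G T)) = 0" if F: "F \<in> ?FF" for F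
    proof -
      obtain T0 where T0: "T0 \<in> Th" "F facet_of T0" using F by blast
      have cG: "continuous_on F (?G T)" if "T \<in> Th" "F facet_of T" for T
        using continuous_on_subset[OF cw[OF that(1)] facet_of_imp_subset[OF that(2)]] c\<psi>
        by (intro continuous_on_cross)
      show ?thesis
      proof (cases "F \<inter> \<Omega> = {}")
        case False
        show ?thesis
        proof (rule mesh_facet_flux_cancel[OF mesh op x T0(2,1) False cG])
          fix T T' n y assume "T \<in> Th" "T' \<in> Th" "F facet_of T" "F facet_of T'" "y \<in> F" "unit_normal F n"
          hence "cross3 n (w T y) = cross3 n (w T' y)" using tang False by blast
          moreover have "n \<bullet> cross3 a (\<psi> y) = cross3 n a \<bullet> \<psi> y" for a
            by (simp add: inner_vec_def cross3_def sum_3 vector_3 algebra_simps)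
          ultimately show "n \<bullet> ?G T y = n \<bullet> ?G T' y" by simp
        qed
      next
        case True
        have "facet_flux T F (?G T) = 0" if T: "T \<in> Th" "F facet_of T" for T
        proof -
          obtain p q r z where rep: "facet_rep F T p q r z" using facet_rep_exists x T by blast
          have "mean_tri p q r (\<lambda>y. cross3 (q - p) (r - p) \<bullet> ?G T y) = mean_tri p q r (\<lambda>y. 0)"
          proof (rule mean_tri_cong)
            fix y assume "y \<in> convex hull {p, q, r}"
            hence "y \<in> F" using rep by (simp add: facet_rep_def)
            hence "\<psi> y = 0" using True K(2,3) by blast
            thus "cross3 (q - p) (r - p) \<bullet> ?G T y = 0" by simp
          qed
          thus ?thesis by (simp add: facet_flux_eq[OF rep cG[OF T]] tri_flux_def mean_tri_const)
        qed
        thus ?thesis by (intro sum.neutral) auto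
      qed
    qed
    \<comment> \<open>The double sum is regrouped facet by facet, so that each facet collects the
      fluxes of all elements that have it.\<close>
    have "(\<Sum>T\<in>Th. \<Sum>F | F facet_of T. facet_flux T F (?G T)) =
        (\<Sum>T\<in>Th. \<Sum>F\<in>{F \<in> ?FF. F facet_of T}. facet_flux T F (?G T))"
      by (intro sum.cong refl) auto
    also have "\<dots> = (\<Sum>F\<in>?FF. \<Sum>T | T \<in> Th \<and> F facet_of T. facet_flux T F (?G T))"
      using fin finF by (intro sum.swap_restrict) auto
    also have "\<dots> = 0" using flux0 by (intro sum.neutral) auto
    finally have flux: "(\<Sum>T\<in>Th. \<Sum>F | F facet_of T. facet_flux T F (?G T)) = 0" .
    have "(LINT y|lebesgue_on \<Omega>. v y \<bullet> curl \<psi> y) = (\<Sum>T\<in>Th. integral T (\<lambda>y. w T y \<bullet> curl \<psi> y))"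
      by (rule mesh_piecewise_integral[OF mesh op x, where u = "\<lambda>T y. w T y \<bullet> curl \<psi> y"])
         (auto simp: v curl0 intro!: continuous_on_inner cw ccurl)
    also have "\<dots> = (\<Sum>T\<in>Th. integral T (\<lambda>y. curl_of (w' T y) \<bullet> \<psi> y) +
        (\<Sum>F | F facet_of T. facet_flux T F (?G T)))"
      using x w' d by (intro sum.cong refl tet_green_curl) auto
    also have "\<dots> = (\<Sum>T\<in>Th. integral T (\<lambda>y. curl_of (w' T y) \<bullet> \<psi> y))"
      by (simp add: sum.distrib flux)
    also have "\<dots> = (LINT y|lebesgue_on \<Omega>. W y \<bullet> \<psi> y)"
      by (rule mesh_piecewise_integral[OF mesh op x, where u = "\<lambda>T y. curl_of (w' T y) \<bullet> \<psi> y", symmetric])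
         (auto simp: W \<psi>0 intro!: continuous_on_inner cW c\<psi>)
    finally show ?thesis .
  qed
  ultimately show ?thesis unfolding Hcurl_def by blast
qed

section \<open>Continuity of the tangential traces\<close>

lemma tet_vertices_extreme:
  assumes "tet_vertices x T"
  shows "{v. v extreme_point_of T} = x ` {1..4}"
proof -
  have T: "T = convex hull (x ` {1..4})" "\<not> affine_dependent (x ` {1..4})"
    using assms by (auto simp: tet_vertices_def)
  show ?thesis unfolding T(1) using extreme_point_of_convex_hull_affine_independent[OF T(2)] by blast
qed

text \<open>At \<open>y = x\<^sub>s\<close> the exponentials of the edge \<open>s, t\<close> cancel, which leaves \<open>w(x\<^sub>s) \<bullet> (x\<^sub>t - x\<^sub>s) = c\<^sub>s\<^sub>t\<close>.\<close>

lemma edge_eqs_vertex_values: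
  assumes x: "tet_vertices x T"
    and eq: "\<And>y. y \<in> T \<Longrightarrow> \<exists>J. edge_eqs (b y) x y J (w y) c"
    and y: "y \<in> T"
  obtains J where "\<And>P Q. P \<in> x ` {1..4} \<Longrightarrow> Q \<in> x ` {1..4} \<Longrightarrow> edge_eq (b y) y P Q J (w y) (w P \<bullet> (Q - P))"
proof -
  have xT: "x s \<in> T" if "s \<in> {1..4}" for s
    using x that by (auto simp: tet_vertices_def intro: hull_inc)
  have at_vertex: "\<phi> \<bullet> (Q - P) = k" if "edge_eq b' P P Q J \<phi> k" for b' P Q J \<phi> k
    using that exp_edge_pos[of "b' \<bullet> (Q - P)"] by (simp add: edge_eq_def)
  have c: "w (x s) \<bullet> (x t - x s) = c s t" "w (x t) \<bullet> (x s - x t) = - c s t"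
    if st: "s \<in> {1..4}" "t \<in> {1..4}" "s < t" for s t
  proof -
    have e: "\<exists>J. edge_eq (b z) z (x s) (x t) J (w z) (c s t)" if "z \<in> T" for z
      using eq[OF that] st unfolding edge_eqs_def by blast
    show "w (x s) \<bullet> (x t - x s) = c s t"
      using e[OF xT[OF st(1)]] by (elim exE) (rule at_vertex)
    show "w (x t) \<bullet> (x s - x t) = - c s t"
      using e[OF xT[OF st(2)]] by (elim exE) (rule at_vertex[OF edge_eq_commute])
  qed
  obtain J where J: "edge_eqs (b y) x y J (w y) c" using eq[OF y] by blast
  have "edge_eq (b y) y (x s) (x t) J (w y) (w (x s) \<bullet> (x t - x s))" if st: "s \<in> {1..4}" "t \<in> {1..4}" for s t
  proof -
    consider "s < t" | "t < s" | "s = t" by linarith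
    thus ?thesis
    proof cases
      case 1
      thus ?thesis using J st c(1)[OF st 1] unfolding edge_eqs_def by simp
    next
      case 2
      hence "edge_eq (b y) y (x t) (x s) J (w y) (c t s)" using J st unfolding edge_eqs_def by blast
      from edge_eq_commute[OF this] show ?thesis using c(2)[OF st(2,1) 2] by simp
    next
      case 3
      thus ?thesis by (simp add: edge_eq_def)
    qed
  qed
  thus thesis by (intro that[of J]) auto
qed

text \<open>On the edges of \<open>F\<close> the equations with \<open>b'\<close> are also equations
  with \<open>b\<close>, so the difference of the two solutions satisfies the homogeneous facet
  equations although \<open>J\<close> and \<open>J'\<close> may be unrelated. Facet uniqueness makes
  \<open>\<phi> - \<phi>'\<close> parallel to the normal.\<close>

lemma facet_fitted_tangential:
  assumes rep: "facet_rep F T p q r z" and y: "y \<in> F"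
    and e: "\<And>P Q. P \<in> {p, q, r} \<Longrightarrow> Q \<in> {p, q, r} \<Longrightarrow> edge_eq b y P Q J \<phi> (c P Q)"
      "\<And>P Q. P \<in> {p, q, r} \<Longrightarrow> Q \<in> {p, q, r} \<Longrightarrow> edge_eq b' y P Q J' \<phi>' (c P Q)"
    and b: "\<And>P. P \<in> {p, q, r} \<Longrightarrow> b \<bullet> (P - y) = b' \<bullet> (P - y)"
    and n: "unit_normal F n"
  shows "cross3 n \<phi> = cross3 n \<phi>'"
proof -
  have d: "edge_eq b y P Q (J - J') (\<phi> - \<phi>') 0" if PQ: "P \<in> {p, q, r}" "Q \<in> {p, q, r}" for P Q
  proof -
    have "edge_eq b y P Q J' \<phi>' (c P Q)" using e(2)[OF PQ] edge_eq_cong[OF b[OF PQ(1)] b[OF PQ(2)]] by simp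
    from edge_eq_diff[OF e(1)[OF PQ] this] show ?thesis by simp
  qed
  have hull: "F = convex hull {p, q, r}" using rep by (simp add: facet_rep_def)
  obtain u v t where uvt: "0 \<le> u" "0 \<le> v" "0 \<le> t" "u + v + t = 1" "y = u *\<^sub>R p + v *\<^sub>R q + t *\<^sub>R r"
    using y unfolding hull by (auto simp: convex_hull_3)
  note N = facet_rep_triple(2)[OF rep]
  have "(\<phi> - \<phi>') \<bullet> (q - p) = 0" "(\<phi> - \<phi>') \<bullet> (r - p) = 0"
    using edge_eq_unique_facet[OF N uvt(5) uvt(1-4) d d d] by auto
  then obtain k where k: "\<phi> - \<phi>' = k *\<^sub>R cross3 (q - p) (r - p)" using parallel_cross3 N by blast
  have "n \<bullet> (q - p) = 0" "n \<bullet> (r - p) = 0" using n unfolding unit_normal_facet_iff[OF hull] by auto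
  then obtain m where m: "n = m *\<^sub>R cross3 (q - p) (r - p)" using parallel_cross3 N by blast
  have "cross3 n (\<phi> - \<phi>') = 0" unfolding k m by (simp add: cross_mult_left cross_mult_right)
  thus ?thesis by (simp add: Cross3.right_diff_distrib)
qed

lemma facet_rep_edge:
  assumes "facet_rep F T p q r z" "P \<in> {p, q, r}" "Q \<in> {p, q, r}" "P \<noteq> Q"
  shows "convex hull {P, Q} edge_of T"
proof -
  have T: "T = convex hull {p, q, r, z}" "\<not> affine_dependent {p, q, r, z}"
    using assms(1) by (auto simp: facet_rep_def)
  have "convex hull {P, Q} face_of T"
    unfolding T(1) face_of_convex_hull_affine_independent[OF T(2)]
    using assms(2,3) by (intro exI[of _ "{P, Q}"]) auto
  moreover have "aff_dim (convex hull {P, Q}) = 1" using assms(4) aff_dim_2[of P Q] by (simp add: aff_dim_convex_hull)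
  ultimately show ?thesis by (simp add: edge_of_def)
qed

lemma inner_unit_tangent_eq:
  assumes "\<And>t. unit_tangent (convex hull {P, Q}) t \<Longrightarrow> a \<bullet> t = a' \<bullet> t"
  shows "a \<bullet> (Q - P) = a' \<bullet> (Q - P)"
proof (cases "P = Q")
  case False
  let ?t = "(Q - P) /\<^sub>R norm (Q - P)"
  have "Q - P \<in> {u - v | u v. u \<in> convex hull {P, Q} \<and> v \<in> convex hull {P, Q}}"
    using hull_inc[of P "{P, Q}" convex] hull_inc[of Q "{P, Q}" convex] by blast
  hence "unit_tangent (convex hull {P, Q}) ?t"
    using False unfolding unit_tangent_def by (intro conjI span_scale span_base) auto
  from assms[OF this] show ?thesis using False by simp
qed simp

text \<open>Equal tangential traces mean that \<open>a - a'\<close> is a multiple of the facet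
  normal, to which \<open>P - y\<close> is orthogonal.\<close>

lemma tangential_inner_eq:
  assumes rep: "facet_rep F T p q r z" and y: "y \<in> F" and P: "P \<in> {p, q, r}"
    and tang: "\<And>n. unit_normal F n \<Longrightarrow> cross3 n a = cross3 n a'"
  shows "a \<bullet> (P - y) = a' \<bullet> (P - y)"
proof -
  define N where "N = cross3 (q - p) (r - p)"
  have N: "N \<noteq> 0" using facet_rep_triple(2)[OF rep] by (simp add: N_def)
  have hull: "F = convex hull {p, q, r}" using rep by (simp add: facet_rep_def)
  have "unit_normal F (N /\<^sub>R norm N)"
    unfolding unit_normal_facet_iff[OF hull] using N by (simp add: N_def dot_cross_self)
  from tang[OF this] have "cross3 N (a - a') = 0"
    using N by (simp add: cross_mult_left Cross3.right_diff_distrib)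
  hence "(N \<bullet> N) *\<^sub>R (a - a') = (N \<bullet> (a - a')) *\<^sub>R N"
    using cross3_cross3[of N "a - a'" N] by (simp add: inner_commute)
  hence "(N \<bullet> N) * ((a - a') \<bullet> (P - y)) = (N \<bullet> (a - a')) * (N \<bullet> (P - y))"
    by (metis inner_scaleR_left)
  also have "N \<bullet> (P - y) = 0"
  proof -
    have "P \<in> F" using P by (auto simp: hull intro: hull_inc)
    thus ?thesis
      using facet_height_0[OF rep, of P] facet_height_0[OF rep y] by (simp add: N_def inner_diff_right)
  qed
  finally show ?thesis using N by (simp add: inner_diff_left)
qed

theorem S_global_subset_Hcurl:
  assumes \<epsilon>: "\<epsilon> > 0" and op: "open \<Omega>" and mesh: "tet_mesh Th \<Omega>" and x: "\<forall>T\<in>Th. tet_vertices (x T) T"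
    and tang: "tangentially_continuous Th \<Omega> \<beta>" and C1: "piecewise_C1 Th \<beta>"
  shows "S_global \<epsilon> Th x \<beta> \<subseteq> Hcurl \<Omega>"
proof
  fix v assume "v \<in> S_global \<epsilon> Th x \<beta>"
  then obtain w where w0: "\<forall>T\<in>Th. w T \<in> S_local \<epsilon> (x T) (\<beta> T) T \<and> (\<forall>y\<in>interior T. v y = w T y)"
    and edge0: "\<forall>T\<in>Th. \<forall>T'\<in>Th. \<forall>e. e edge_of T \<and> e edge_of T' \<longrightarrow>
                (\<forall>t. unit_tangent e t \<longrightarrow> (\<forall>y\<in>e. w T y \<bullet> t = w T' y \<bullet> t))"
    unfolding S_global_def mem_Collect_eq by (elim exE conjE) rule
  have w: "w T \<in> S_local \<epsilon> (x T) (\<beta> T) T" if "T \<in> Th" for T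
    using w0 that by blast
  have vw: "v y = w T y" if "T \<in> Th" "y \<in> interior T" for T y
    using w0 that by blast
  have edge: "w T y \<bullet> t = w T' y \<bullet> t"
    if "T \<in> Th" "T' \<in> Th" "e edge_of T" "e edge_of T'" "unit_tangent e t" "y \<in> e" for T T' e t y
    using edge0[rule_format, OF that(1,2)] that(3-6) by blast
  define b where "b T y = \<beta> T y /\<^sub>R \<epsilon>" for T y
  \<comment> \<open>The order of the quantifiers matters: \<open>c\<close> is constant on the
    element, so its values, read off at the vertices, fix the equations at every
    \<open>y\<close>.\<close>
  have "\<exists>c. \<forall>y\<in>T. \<exists>J. edge_eqs (b T y) (x T) y J (w T y) c" if "T \<in> Th" for T
    unfolding b_def by (rule S_local_edge_eqs[OF \<epsilon> x[rule_format, OF that] w[OF that]]) blast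
  then obtain c where eq: "\<And>T y. T \<in> Th \<Longrightarrow> y \<in> T \<Longrightarrow> \<exists>J. edge_eqs (b T y) (x T) y J (w T y) (c T)"
    by metis
  show "v \<in> Hcurl \<Omega>"
  proof (rule mesh_Hcurl[OF mesh op x vw])
    fix T assume T: "T \<in> Th"
    have "C1_within T (b T)"
      unfolding b_def
      by (intro C1_within_linear[OF bounded_linear_scaleR_right] C1_on_imp_C1_within)
         (use C1 T in \<open>simp add: piecewise_C1_def\<close>)
    thus "C1_within T (w T)" using edge_eqs_C1_within x T eq by blast
  next
    fix T T' F n y
    assume T: "T \<in> Th" "T' \<in> Th" "F facet_of T" "F facet_of T'" and meet: "F \<inter> \<Omega> \<noteq> {}"
      and n: "unit_normal F n" and y: "y \<in> F"
    obtain p q r z where rep: "facet_rep F T p q r z" using facet_rep_exists x T by blast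
    obtain p' q' r' z' where "facet_rep F T' p' q' r' z'" using facet_rep_exists x T by blast
    hence rep': "facet_rep F T' p q r z'" by (rule facet_rep_transfer[OF rep])
    have yT: "y \<in> T" "y \<in> T'" using y rep rep' facet_rep_subset by blast+
    \<comment> \<open>The labellings of the two elements are unrelated, so from here on equations
      are indexed by vertices as points.\<close>
    have V: "{p, q, r} \<subseteq> x T ` {1..4}" if "facet_rep F T p q r z" "T \<in> Th" for T z
    proof -
      have "tet_vertices (x T) T" using x that by blast
      hence "{v. v extreme_point_of T} = x T ` {1..4}"
        by (rule tet_vertices_extreme)
      thus ?thesis using facet_rep_vertices(2)[OF that(1)] by blast
    qed
    obtain J where J: "\<And>P Q. P \<in> x T ` {1..4} \<Longrightarrow> Q \<in> x T ` {1..4} \<Longrightarrow>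
        edge_eq (b T y) y P Q J (w T y) (w T P \<bullet> (Q - P))"
      using edge_eqs_vertex_values[of "x T" T "b T" "w T" "c T", OF x[rule_format, OF T(1)] eq[OF T(1)] yT(1)] by blast
    obtain J' where J': "\<And>P Q. P \<in> x T' ` {1..4} \<Longrightarrow> Q \<in> x T' ` {1..4} \<Longrightarrow>
        edge_eq (b T' y) y P Q J' (w T' y) (w T' P \<bullet> (Q - P))"
      using edge_eqs_vertex_values[of "x T'" T' "b T'" "w T'" "c T'", OF x[rule_format, OF T(2)] eq[OF T(2)] yT(2)] by blast
    \<comment> \<open>This is a tangential edge trace taken at the vertex \<open>P\<close>, so the
      edge continuity in \<open>S_global\<close> identifies it for the two elements.\<close>
    have cc: "w T' P \<bullet> (Q - P) = w T P \<bullet> (Q - P)" if PQ: "P \<in> {p, q, r}" "Q \<in> {p, q, r}" for P Q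
    proof (cases "P = Q")
      case False
      have "P \<in> convex hull {P, Q}" by (simp add: hull_inc)
      with facet_rep_edge[OF rep PQ False] facet_rep_edge[OF rep' PQ False] T show ?thesis
        by (intro inner_unit_tangent_eq edge) auto
    qed simp
    \<comment> \<open>An open set is disjoint from its frontier, and \<open>F\<close> has a point in
      \<Omega>.\<close>
    have "\<not> F \<subseteq> frontier \<Omega>"
      using meet op by (auto simp: frontier_def interior_open)
    hence \<beta>\<beta>: "cross3 m (\<beta> T y) = cross3 m (\<beta> T' y)" if "unit_normal F m" for m
      using tang T y that unfolding tangentially_continuous_def by blast
    have bb: "b T y \<bullet> (P - y) = b T' y \<bullet> (P - y)" if "P \<in> {p, q, r}" for P
    proof -
      have "\<beta> T y \<bullet> (P - y) = \<beta> T' y \<bullet> (P - y)" by (rule tangential_inner_eq[OF rep y that \<beta>\<beta>])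
      thus ?thesis by (simp add: b_def)
    qed
    show "cross3 n (w T y) = cross3 n (w T' y)"
    proof (rule facet_fitted_tangential[OF rep y _ _ bb n])
      fix P Q assume PQ: "P \<in> {p, q, r}" "Q \<in> {p, q, r}"
      show "edge_eq (b T y) y P Q J (w T y) (w T P \<bullet> (Q - P))"
        by (rule J) (use PQ V[OF rep T(1)] in blast)+
      show "edge_eq (b T' y) y P Q J' (w T' y) (w T P \<bullet> (Q - P))"
        unfolding cc[OF PQ, symmetric] by (rule J') (use PQ V[OF rep' T(2)] in blast)+
    qed
  qed
qed

theorem lemma3p3:
  fixes \<epsilon> :: real
  assumes "\<epsilon> > 0"
  shows
    "(\<forall>(T :: (real^3) set) (x :: nat \<Rightarrow> real^3) (\<beta> :: real^3 \<Rightarrow> real^3).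
        tet_vertices x T \<longrightarrow>
        (\<forall>i j. 1 \<le> i \<and> i < j \<and> j \<le> 4 \<longrightarrow>
           (\<forall>s\<in>{i, j}. \<forall>y\<in>tet_facet x s. cross3 (tet_normal x s) (\<phi>E \<epsilon> x \<beta> i j y) = 0)))
     \<and>
     (\<forall>(\<Omega> :: (real^3) set) (Th :: (real^3) set set) (x :: (real^3) set \<Rightarrow> nat \<Rightarrow> real^3)
        (\<beta> :: (real^3) set \<Rightarrow> real^3 \<Rightarrow> real^3).
        open \<Omega> \<and> bounded \<Omega> \<and> tet_mesh Th \<Omega> \<and> (\<forall>T\<in>Th. tet_vertices (x T) T) \<and>
        tangentially_continuous Th \<Omega> \<beta> \<and> piecewise_C1 Th \<beta> \<longrightarrow>
        S_global \<epsilon> Th x \<beta> \<subseteq> Hcurl \<Omega>)"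
  using cross3_normal_phiE[OF assms] S_global_subset_Hcurl[OF assms] by blast

end
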